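(* Let $\lambda_{\max}:K(H)^{sa}\to\mathbb{R}$ be the maximum eigenvalue function and let $A:c_0\to K(H)^{sa}$ be given by $A(x)=A_0+\mathrm{Diag}(x)=A_0+\sum_{k\in\mathbb{N}}x_ke_ke_k^*$, with $A_0\in K(H)^{sa}$ fixed. Consider the composition $\lambda_{\max}\circ A:c_0\to\mathbb{R}$, $\lambda_{\max}\circ A(x)=\lambda_{\max}(A(x))$. Let $s$ be the multiplicity of $\lambda_{\max}(A(x))$ and $S_{\max}$ the eigenspace of $\lambda_{\max}(A(x))$. Then the subdifferential $\partial\big(\lambda_{\max}(A(x))\big)$ of $\lambda_{\max}\circ A$ at $x\in c_0$ is $$\partial\big(\lambda_{\max}(A(x))\big)=\mathrm{Diag}(\mathcal{D}_{S_{\max}})=\mathrm{Diag}\big(\partial\lambda_{\max}(A(x))\big)=m_{S_{\max}},$$ where, in the third expression, $\partial\lambda_{\max}(A(x))$ is the subdifferential of $\lambda_{\max}:K(H)^{sa}\to\mathbb{R}$ at the operator $A(x)$, and $m_{S_{\max}}$ is the moment of $S_{\max}$. In particular, if $\lambda_{\max}(A(x))\neq0$, then $$\partial\big(\lambda_{\max}(A(x))\big)=\mathrm{Diag}\left(\{Q_{\max}(x)R_sQ_{\max}(x)^*: R_s\in M_s^h(\mathbb{C}),\ R_s\ge0,\ \mathrm{tr}(R_s)=1\}\right),$$ where the columns of $Q_{\max}(x)$ form an orthonormal set of ($s$) eigenvectors for $\lambda_{\max}(A(x))$.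
   Context: $H$ is a separable complex Hilbert space with a fixed orthonormal basis $\{e_k\}_{k\in\mathbb{N}}$; $K(H)^{sa}$ is the space of self-adjoint compact operators (operator norm), $B_1(H)^{sa}$ the self-adjoint trace class operators, $c_0$ the real sequences converging to $0$, and $M_s^h(\mathbb{C})$ the Hermitian $s\times s$ matrices. For an operator $C$, $\mathrm{Diag}(C)$ is the sequence $(\langle Ce_i,e_i\rangle)_{i\in\mathbb{N}}$ (diagonal operators are identified with sequences), and $\mathrm{Diag}$ of a set of operators is the set of their diagonals. $\lambda_{\max}(C)$ is the maximum of the spectrum of $C\in K(H)^{sa}$. For a convex $f:\mathcal{X}\to\mathbb{R}$ on a Banach space $\mathcal{X}$, the subdifferential at $x$ is $\partial f(x)=\{v\in\mathcal{X}^*: f(y)-f(x)\ge\mathrm{Re}\,v(y-x)\ \forall y\in\mathcal{X}\}$; for $\lambda_{\max}$ at $C\in K(H)^{sa}$ it is $\partial\lambda_{\max}(C)=\{Y\in B_1(H)^{sa}:\lambda_{\max}(B)-\lambda_{\max}(C)\ge\mathrm{Re}\,\mathrm{tr}(Y(B-C))\ \forall B\in K(H)^{sa}\}$. $\mathcal{D}_{S_{\max}}=\mathrm{co}\{qq^*: q\in H,\ A(x)q=\lambda_{\max}(A(x))q,\ \|q\|=1\}$, where $\mathrm{co}$ is the convex hull. The moment of a subspace $S$ of $H$ is $m_S=\mathrm{co}\{|v|^2: v\in S,\ \|v\|=1\}$, where $|v|^2=(|v_1|^2,|v_2|^2,\dots)$ and $v_k$ are the coordinates of $v$ in the fixed 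basis.
   Formalization: The equalities linking Diag(D_S) and m_S to the two subdifferentials are stated only for λ_max(A(x)) ≠ 0; at λ_max(A(x)) = 0 they always fail, since 0 is a subgradient but elements of m_S sum to 1. The first = third and second = fourth expressions are kept for every x. *)

theory Defs
  imports "HOL-Analysis.Analysis" "HOL-Library.Function_Algebras"
    "Jordan_Normal_Form.Schur_Decomposition"
begin

unbundle no vec_syntax

section \<open>Real sequences as a real vector space\<close>

instantiation "fun" :: (type, real_vector) real_vector
begin

definition scaleR_fun :: "real \<Rightarrow> ('a \<Rightarrow> 'b) \<Rightarrow> 'a \<Rightarrow> 'b" where
  "scaleR_fun r f = (\<lambda>x. r *\<^sub>R f x)"

instance
  by standard (auto simp: scaleR_fun_def fun_eq_iff algebra_simps)

end

section \<open>The Banach space of real null sequences\<close>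

typedef c0 = "{x :: nat \<Rightarrow> real. x \<longlonglongrightarrow> 0}"
  morphisms c0_nth Abs_c0
  by (rule exI[of _ "\<lambda>_. 0"]) simp

setup_lifting type_definition_c0

lemma c0_eqI: "(\<And>k. c0_nth x k = c0_nth y k) \<Longrightarrow> x = y"
  by (metis c0_nth_inject ext)

lemma c0_nth_tendsto: "c0_nth x \<longlonglongrightarrow> 0"
  using c0_nth by simp

lemma c0_bdd_above: "bdd_above (range (\<lambda>k. \<bar>c0_nth x k\<bar>))"
proof -
  have "Bseq (c0_nth x)"
    using c0_nth_tendsto convergentI convergent_imp_Bseq by blast
  then obtain K where "\<And>k. norm (c0_nth x k) \<le> K"
    by (meson BseqE)
  then show ?thesis by (auto intro!: bdd_aboveI[of _ K])
qed

instantiation c0 :: real_normed_vector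
begin

lift_definition zero_c0 :: c0 is "\<lambda>_. 0" by simp

lift_definition plus_c0 :: "c0 \<Rightarrow> c0 \<Rightarrow> c0" is "\<lambda>x y k. x k + y k"
  using tendsto_add_zero by auto

lift_definition minus_c0 :: "c0 \<Rightarrow> c0 \<Rightarrow> c0" is "\<lambda>x y k. x k - y k"
  using tendsto_diff[where a = "0::real" and b = 0] by auto

lift_definition uminus_c0 :: "c0 \<Rightarrow> c0" is "\<lambda>x k. - x k"
  using tendsto_minus[where a = "0::real"] by auto

lift_definition scaleR_c0 :: "real \<Rightarrow> c0 \<Rightarrow> c0" is "\<lambda>r x k. r * x k"
  using tendsto_mult_right_zero by auto

definition norm_c0 :: "c0 \<Rightarrow> real" where
  "norm_c0 x = (SUP k. \<bar>c0_nth x k\<bar>)"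

definition dist_c0 :: "c0 \<Rightarrow> c0 \<Rightarrow> real" where
  "dist_c0 x y = norm (x - y)"

definition sgn_c0 :: "c0 \<Rightarrow> c0" where
  "sgn_c0 x = inverse (norm x) *\<^sub>R x"

definition uniformity_c0 :: "(c0 \<times> c0) filter" where
  "uniformity_c0 = (INF e\<in>{0 <..}. principal {(x, y). dist x y < e})"

definition open_c0 :: "c0 set \<Rightarrow> bool" where
  "open_c0 U = (\<forall>x\<in>U. \<forall>\<^sub>F (x', y) in uniformity. x' = x \<longrightarrow> y \<in> U)"

instance
proof
  fix x y z :: c0 and a b :: real
  have le: "\<bar>c0_nth u k\<bar> \<le> norm u" for u k
    unfolding norm_c0_def by (rule cSUP_upper[OF _ c0_bdd_above]) simp
  show "x + y + z = x + (y + z)" by transfer (simp add: add.assoc)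
  show "x + y = y + x" by transfer (simp add: add.commute)
  show "0 + x = x" by transfer simp
  show "- x + x = 0" by transfer simp
  show "x - y = x + - y" by transfer simp
  show "a *\<^sub>R (x + y) = a *\<^sub>R x + a *\<^sub>R y" by transfer (simp add: algebra_simps)
  show "(a + b) *\<^sub>R x = a *\<^sub>R x + b *\<^sub>R x" by transfer (simp add: algebra_simps)
  show "a *\<^sub>R b *\<^sub>R x = (a * b) *\<^sub>R x" by transfer (simp add: mult.assoc)
  show "1 *\<^sub>R x = x" by transfer simp
  show "dist x y = norm (x - y)" by (rule dist_c0_def)
  show "sgn x = inverse (norm x) *\<^sub>R x" by (rule sgn_c0_def)
  show "uniformity = (INF e\<in>{0 <..}. principal {(x :: c0, y). dist x y < e})"
    by (rule uniformity_c0_def)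
  show "open U = (\<forall>x\<in>U. \<forall>\<^sub>F (x', y) in uniformity. x' = x \<longrightarrow> y \<in> U)" for U :: "c0 set"
    by (rule open_c0_def)
  show "norm x = 0 \<longleftrightarrow> x = 0"
  proof
    assume "norm x = 0"
    then show "x = 0" using le[of x] by (intro c0_eqI) (simp add: zero_c0.rep_eq)
  qed (simp add: norm_c0_def zero_c0.rep_eq)
  show "norm (x + y) \<le> norm x + norm y"
  proof -
    have "\<bar>c0_nth (x + y) k\<bar> \<le> norm x + norm y" for k
      using le[of x k] le[of y k] by (simp add: plus_c0.rep_eq)
    then show ?thesis unfolding norm_c0_def[of "x + y"] by (intro cSUP_least) auto
  qed
  have scale_le: "norm (r *\<^sub>R u) \<le> \<bar>r\<bar> * norm u" for r and u :: c0
  proof -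
    have "\<bar>c0_nth (r *\<^sub>R u) k\<bar> \<le> \<bar>r\<bar> * norm u" for k
      using le[of u k] by (simp add: scaleR_c0.rep_eq abs_mult mult_left_mono)
    then show ?thesis unfolding norm_c0_def[of "r *\<^sub>R u"] by (intro cSUP_least) auto
  qed
  show "norm (a *\<^sub>R x) = \<bar>a\<bar> * norm x"
  proof (rule antisym[OF scale_le])
    show "\<bar>a\<bar> * norm x \<le> norm (a *\<^sub>R x)"
    proof (cases "a = 0")
      case True
      have "0 \<le> \<bar>c0_nth (a *\<^sub>R x) 0\<bar>" by simp
      also have "\<dots> \<le> norm (a *\<^sub>R x)" by (rule le)
      finally show ?thesis using True by simp
    next
      case False
      have "x = inverse a *\<^sub>R (a *\<^sub>R x)"
        using False by (intro c0_eqI) (simp add: scaleR_c0.rep_eq)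
      then have "norm x \<le> \<bar>inverse a\<bar> * norm (a *\<^sub>R x)"
        by (metis scale_le)
      then show ?thesis using False by (simp add: field_simps)
    qed
  qed
qed

end

lemma c0_nth_le_norm: "\<bar>c0_nth x k\<bar> \<le> norm x"
  unfolding norm_c0_def by (rule cSUP_upper[OF _ c0_bdd_above]) simp

text \<open>The functional \<open>y \<mapsto> \<Sum>k. v k * y k\<close>, through which summable sequences are identified
  with the dual of \<open>c0\<close>; it is meaningful for absolutely summable \<open>v\<close> only.\<close>

definition ell1_functional :: "(nat \<Rightarrow> real) \<Rightarrow> c0 \<Rightarrow>\<^sub>L real" where
  "ell1_functional v = Blinfun (\<lambda>y. \<Sum>k. v k * c0_nth y k)"

lemma ell1_functional_apply:
  assumes "summable (\<lambda>k. \<bar>v k\<bar>)"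
  shows "blinfun_apply (ell1_functional v) y = (\<Sum>k. v k * c0_nth y k)"
proof -
  have le: "norm (v k * c0_nth y k) \<le> \<bar>v k\<bar> * norm y" for k y
    using c0_nth_le_norm[of y k] by (simp add: abs_mult mult_left_mono)
  have s2: "summable (\<lambda>k. \<bar>v k\<bar> * norm y)" for y :: c0
    using assms by (rule summable_mult2)
  have s: "summable (\<lambda>k. v k * c0_nth y k)" for y
    by (rule summable_comparison_test'[OF s2[of y], of 0]) (use le in auto)
  have sn: "summable (\<lambda>k. norm (v k * c0_nth y k))" for y
    by (rule summable_comparison_test'[OF s2[of y], of 0]) (use le in auto)
  have "bounded_linear (\<lambda>y. \<Sum>k. v k * c0_nth y k)"
  proof (rule bounded_linear_intro[where K = "\<Sum>k. \<bar>v k\<bar>"])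
    fix y z :: c0 and r :: real
    show "(\<Sum>k. v k * c0_nth (y + z) k) = (\<Sum>k. v k * c0_nth y k) + (\<Sum>k. v k * c0_nth z k)"
      by (subst suminf_add[OF s s]) (simp add: plus_c0.rep_eq algebra_simps)
    show "(\<Sum>k. v k * c0_nth (r *\<^sub>R y) k) = r *\<^sub>R (\<Sum>k. v k * c0_nth y k)"
      using suminf_mult[OF s[of y], of r] by (simp add: scaleR_c0.rep_eq algebra_simps)
    have "norm (\<Sum>k. v k * c0_nth y k) \<le> (\<Sum>k. norm (v k * c0_nth y k))"
      by (rule summable_norm[OF sn])
    also have "\<dots> \<le> (\<Sum>k. \<bar>v k\<bar> * norm y)"
      by (rule suminf_le[OF le sn s2])
    also have "\<dots> = norm y * (\<Sum>k. \<bar>v k\<bar>)"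
      using suminf_mult2[OF assms, of "norm y"] by (simp add: mult.commute)
    finally show "norm (\<Sum>k. v k * c0_nth y k) \<le> norm y * (\<Sum>k. \<bar>v k\<bar>)" .
  qed
  then show ?thesis by (simp add: ell1_functional_def bounded_linear_Blinfun_apply)
qed

definition subdifferential :: "('x::real_normed_vector \<Rightarrow> real) \<Rightarrow> 'x \<Rightarrow> ('x \<Rightarrow>\<^sub>L real) set" where
  "subdifferential f x = {v. \<forall>y. f y - f x \<ge> blinfun_apply v (y - x)}"

section \<open>Complex Hilbert spaces\<close>

text \<open>The complex inner product is linear in the first argument; its real part is the real inner
  product, so the norm, the topology and completeness are the ones of the library.\<close>

class chilbert_space = real_inner + banach +
  fixes cscale :: "complex \<Rightarrow> 'a \<Rightarrow> 'a"
    and cinner :: "'a \<Rightarrow> 'a \<Rightarrow> complex"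
  assumes cscale_add_right: "cscale a (u + v) = cscale a u + cscale a v"
    and cscale_add_left: "cscale (a + b) u = cscale a u + cscale b u"
    and cscale_cscale: "cscale a (cscale b u) = cscale (a * b) u"
    and cscale_of_real: "cscale (complex_of_real r) u = r *\<^sub>R u"
    and cinner_commute: "cinner u v = cnj (cinner v u)"
    and cinner_add_left: "cinner (u + v) w = cinner u w + cinner v w"
    and cinner_cscale_left: "cinner (cscale a u) v = a * cinner u v"
    and Re_cinner: "Re (cinner u v) = inner u v"

global_interpretation complex_vector: vector_space
  "cscale :: complex \<Rightarrow> 'a \<Rightarrow> 'a::chilbert_space"
  defines cspan = complex_vector.span
    and cdim = complex_vector.dim
proof
  show "cscale 1 u = u" for u :: 'a
    using cscale_of_real[of 1 u] by simp
qed (simp_all add: cscale_add_right cscale_add_left cscale_cscale)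

lemma norm_cscale: "norm (cscale a u) = cmod a * norm u"
proof -
  have "cinner (cscale a u) (cscale a u) = a * cnj a * cinner u u"
    by (metis cinner_cscale_left cinner_commute complex_cnj_mult mult.assoc)
  also have "\<dots> = complex_of_real ((cmod a)\<^sup>2) * cinner u u"
    by (simp only: complex_norm_square)
  finally have "inner (cscale a u) (cscale a u) = (cmod a)\<^sup>2 * inner u u"
    by (simp flip: Re_cinner)
  then have "(norm (cscale a u))\<^sup>2 = (cmod a * norm u)\<^sup>2"
    by (simp add: power2_norm_eq_inner power_mult_distrib)
  then show ?thesis by (simp add: power2_eq_iff_nonneg)
qed

lemma cmod_cinner_le: "cmod (cinner u v) \<le> norm u * norm v"
proof (cases "cinner u v = 0")
  case False
  define c where "c = cnj (cinner u v) / complex_of_real (cmod (cinner u v))"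
  have "cmod c = 1" using False by (simp add: c_def norm_divide)
  have "c * cinner u v = complex_of_real (cmod (cinner u v))"
    using False complex_norm_square[of "cinner u v"]
    by (simp add: c_def field_simps power2_eq_square)
  then have "cmod (cinner u v) = inner (cscale c u) v"
    by (metis Re_cinner Re_complex_of_real cinner_cscale_left)
  also have "\<dots> \<le> norm (cscale c u) * norm v" by (rule norm_cauchy_schwarz)
  finally show ?thesis using \<open>cmod c = 1\<close> by (simp add: norm_cscale)
qed simp

definition orthonormal_basis :: "(nat \<Rightarrow> 'a::chilbert_space) \<Rightarrow> bool" where
  "orthonormal_basis e \<longleftrightarrow>
     (\<forall>i j. cinner (e i) (e j) = (if i = j then 1 else 0)) \<and>
     closure (cspan (range e)) = UNIV"

section \<open>Operators\<close>

text \<open>The type \<open>'a \<Rightarrow>\<^sub>L 'a\<close> consists of the bounded real-linear maps, with the operator norm.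
  Complex linearity is part of \<open>self_adjoint\<close>.\<close>

definition self_adjoint :: "('a::chilbert_space \<Rightarrow>\<^sub>L 'a) \<Rightarrow> bool" where
  "self_adjoint C \<longleftrightarrow>
     (\<forall>a v. blinfun_apply C (cscale a v) = cscale a (blinfun_apply C v)) \<and>
     (\<forall>v w. cinner (blinfun_apply C v) w = cinner v (blinfun_apply C w))"

definition positive_op :: "('a::chilbert_space \<Rightarrow>\<^sub>L 'a) \<Rightarrow> bool" where
  "positive_op P \<longleftrightarrow> self_adjoint P \<and> (\<forall>v. 0 \<le> Re (cinner (blinfun_apply P v) v))"

definition compact_sa :: "('a::chilbert_space \<Rightarrow>\<^sub>L 'a) set" where
  "compact_sa = {C. self_adjoint C \<and> compact (closure (blinfun_apply C ` cball 0 1))}"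

definition op_trace :: "(nat \<Rightarrow> 'a::chilbert_space) \<Rightarrow> ('a \<Rightarrow>\<^sub>L 'a) \<Rightarrow> complex" where
  "op_trace e T = (\<Sum>k. cinner (blinfun_apply T (e k)) (e k))"

text \<open>For self-adjoint \<open>Y\<close> the operator \<open>P\<close> below is the modulus, the positive square root
  of \<open>Y\<^sup>*Y = Y\<^sup>2\<close>; the condition says that it has finite trace.\<close>

definition trace_class_sa :: "(nat \<Rightarrow> 'a::chilbert_space) \<Rightarrow> ('a \<Rightarrow>\<^sub>L 'a) set" where
  "trace_class_sa e = {Y. self_adjoint Y \<and>
     (\<exists>P. positive_op P \<and> P o\<^sub>L P = Y o\<^sub>L Y \<and>
          summable (\<lambda>k. Re (cinner (blinfun_apply P (e k)) (e k))))}"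

text \<open>A bounded real-linear two-sided inverse of a complex-linear map is complex-linear.\<close>

definition spectrum_op :: "('a::chilbert_space \<Rightarrow>\<^sub>L 'a) \<Rightarrow> complex set" where
  "spectrum_op C = {z. \<not> (\<exists>T :: 'a \<Rightarrow>\<^sub>L 'a. \<forall>v.
     blinfun_apply T (blinfun_apply C v - cscale z v) = v \<and>
     blinfun_apply C (blinfun_apply T v) - cscale z (blinfun_apply T v) = v)}"

text \<open>On an infinite-dimensional space \<open>0\<close> lies in the spectrum of every compact operator. Hence
  \<open>lambda_max\<close> is nonnegative on \<open>compact_sa\<close>, and \<open>0\<close> is a subgradient of it wherever it
  vanishes; it need not be an eigenvalue there.\<close>

definition lambda_max :: "('a::chilbert_space \<Rightarrow>\<^sub>L 'a) \<Rightarrow> real" where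
  "lambda_max C = (GREATEST r. complex_of_real r \<in> spectrum_op C)"

definition subdiff_lambda_max ::
    "(nat \<Rightarrow> 'a::chilbert_space) \<Rightarrow> ('a \<Rightarrow>\<^sub>L 'a) \<Rightarrow> ('a \<Rightarrow>\<^sub>L 'a) set" where
  "subdiff_lambda_max e C = {Y \<in> trace_class_sa e. \<forall>B \<in> compact_sa.
     lambda_max B - lambda_max C \<ge> Re (op_trace e (Y o\<^sub>L (B - C)))}"

definition eigenspace :: "('a::chilbert_space \<Rightarrow>\<^sub>L 'a) \<Rightarrow> real \<Rightarrow> 'a set" where
  "eigenspace C l = {q. blinfun_apply C q = l *\<^sub>R q}"

text \<open>\<open>outer u v\<close> is the rank one operator \<open>u v\<^sup>*\<close>.\<close>

definition outer :: "'a::chilbert_space \<Rightarrow> 'a \<Rightarrow> 'a \<Rightarrow>\<^sub>L 'a" where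
  "outer u v = Blinfun (\<lambda>w. cscale (cinner w v) u)"

lemma outer_apply: "blinfun_apply (outer u v) w = cscale (cinner w v) u"
proof -
  have "bounded_linear (\<lambda>w. cscale (cinner w v) u)"
  proof (rule bounded_linear_intro[where K = "norm v * norm u"])
    show "cscale (cinner (x + y) v) u = cscale (cinner x v) u + cscale (cinner y v) u" for x y
      by (simp add: cinner_add_left cscale_add_left)
    show "cscale (cinner (r *\<^sub>R x) v) u = r *\<^sub>R cscale (cinner x v) u" for r x
      by (simp add: cinner_cscale_left cscale_cscale flip: cscale_of_real)
    show "norm (cscale (cinner x v) u) \<le> norm x * (norm v * norm u)" for x
      using mult_right_mono[OF cmod_cinner_le[of x v], of "norm u"]
      by (simp add: norm_cscale mult.assoc)
  qed
  then show ?thesis by (simp add: outer_def bounded_linear_Blinfun_apply)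
qed

text \<open>The series converges in operator norm when \<open>e\<close> is orthonormal.\<close>

definition diag_op :: "(nat \<Rightarrow> 'a::chilbert_space) \<Rightarrow> c0 \<Rightarrow> 'a \<Rightarrow>\<^sub>L 'a" where
  "diag_op e x = (\<Sum>k. c0_nth x k *\<^sub>R outer (e k) (e k))"

text \<open>Only diagonals of self-adjoint operators are needed; their entries are real.\<close>

definition diag_seq :: "(nat \<Rightarrow> 'a::chilbert_space) \<Rightarrow> ('a \<Rightarrow>\<^sub>L 'a) \<Rightarrow> nat \<Rightarrow> real" where
  "diag_seq e C = (\<lambda>i. Re (cinner (blinfun_apply C (e i)) (e i)))"

definition pure_hull :: "'a::chilbert_space set \<Rightarrow> ('a \<Rightarrow>\<^sub>L 'a) set" where
  "pure_hull S = convex hull {outer q q | q. q \<in> S \<and> norm q = 1}"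

definition moment :: "(nat \<Rightarrow> 'a::chilbert_space) \<Rightarrow> 'a set \<Rightarrow> (nat \<Rightarrow> real) set" where
  "moment e S = convex hull {(\<lambda>k. (cmod (cinner v (e k)))\<^sup>2) | v. v \<in> S \<and> norm v = 1}"

section \<open>Operators of the form \<open>Q R Q\<^sup>*\<close>\<close>

definition density_mats :: "nat \<Rightarrow> complex mat set" where
  "density_mats s = {R \<in> carrier_mat s s. mat_adjoint R = R \<and>
     (\<forall>a \<in> carrier_vec s. 0 \<le> (R *\<^sub>v a) \<bullet>c a) \<and> (\<Sum>i<s. R $$ (i, i)) = 1}"

text \<open>\<open>q 0, \<dots>, q (s - 1)\<close> are the columns of \<open>Q\<close>: \<open>synthesis s q\<close> is the map
  \<open>Q\<close> from \<open>s\<close>-dimensional complex vectors to the Hilbert space, \<open>analysis s q\<close> its adjoint.\<close>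

definition synthesis :: "nat \<Rightarrow> (nat \<Rightarrow> 'a::chilbert_space) \<Rightarrow> complex vec \<Rightarrow> 'a" where
  "synthesis s q a = (\<Sum>j<s. cscale (vec_index a j) (q j))"

definition analysis :: "nat \<Rightarrow> (nat \<Rightarrow> 'a::chilbert_space) \<Rightarrow> 'a \<Rightarrow> complex vec" where
  "analysis s q v = Matrix.vec s (\<lambda>j. cinner v (q j))"

definition sandwich :: "nat \<Rightarrow> (nat \<Rightarrow> 'a::chilbert_space) \<Rightarrow> complex mat \<Rightarrow> 'a \<Rightarrow>\<^sub>L 'a" where
  "sandwich s q R = Blinfun (\<lambda>v. synthesis s q (R *\<^sub>v analysis s q v))"

lemma sandwich_eq_sum_outer:
  assumes "R \<in> carrier_mat s s"
  shows "sandwich s q R = (\<Sum>i<s. \<Sum>j<s. outer (cscale (R $$ (i, j)) (q i)) (q j))"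
proof -
  have "synthesis s q (R *\<^sub>v analysis s q v) =
      blinfun_apply (\<Sum>i<s. \<Sum>j<s. outer (cscale (R $$ (i, j)) (q i)) (q j)) v" for v
    using assms
    by (simp add: synthesis_def analysis_def scalar_prod_def blinfun.sum_left outer_apply
        cscale_cscale complex_vector.scale_sum_left mult.commute lessThan_atLeast0)
  then show ?thesis by (simp add: sandwich_def blinfun_apply_inverse)
qed

end

theory Submission
  imports Defs
begin

text \<open>
  On compact self-adjoint operators \<open>lambda_max C\<close> is the least \<open>r \<ge> 0\<close> with
  \<open>\<langle>C v, v\<rangle> \<le> r \<parallel>v\<parallel>\<^sup>2\<close> for all \<open>v\<close>, so it is the support function of the set of positive
  operators of trace at most \<open>1\<close>, here obtained as the norm closure of finite convex combinations
  of operators \<open>w w\<^sup>*\<close> and called substates.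

  A subgradient of \<open>lambda_max \<circ> A\<close> at \<open>x\<close> is given by a summable sequence \<open>d\<close>. For substates \<open>T\<close>
  the pairs \<open>(Diag T - d, tr (T A(x)) - lambda_max (A x))\<close> form a convex set in a Hilbert space. Its
  point nearest to \<open>0\<close>, if different from \<open>0\<close>, gives a null sequence contradicting the subgradient
  inequality, so the pairs come arbitrarily close to \<open>0\<close>. In place of weak compactness, the
  parallelogram law for the Hilbert-Schmidt norm yields a norm convergent choice of substates with
  pairs tending to \<open>0\<close>; the limit is a subgradient of \<open>lambda_max\<close> with diagonal \<open>d\<close>.

  Testing the subgradient inequality against perturbations of \<open>A x\<close> of finite rank shows that every
  subgradient of \<open>lambda_max\<close> at \<open>A x\<close> is positive, has trace at most \<open>1\<close> and range in the
  eigenspace. If \<open>lambda_max (A x) \<noteq> 0\<close>, the trace is \<open>1\<close> and the eigenspace is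
      finite-dimensional, and
  a Cholesky decomposition writes the subgradient as a convex combination of projections \<open>q q\<^sup>*\<close>.
\<close>


section \<open>Complex inner products\<close>

text \<open>The trace of a substate is only bounded by \<open>1\<close>, because norm limits can
  lose trace: \<open>(1 / real n) *\<^sub>R proj n\<close> has trace \<open>1\<close> and tends to
  \<open>0\<close>. What survives such limits is the trace against a compact operator, since its
  finite sections converge uniformly over all substates. This makes norm convergence strong enough
  for the final limit. A summable \<open>d\<close> is placed in the Hilbert space by
  \<open>embed\<close>, which weakens its norm to the square-summable one. There nearest points
  exist, and the separating direction found has square-summable coefficients, hence lies in
  \<open>c0\<close>, where the subgradient inequality can be tested. The second entry of a pair
  measures how far a substate is from attaining \<open>lambda_max\<close>. Driving it to
  \<open>0\<close> together with the diagonal error makes the limit a subgradient, and not merely an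
  operator with the right diagonal.\<close>

declare Re_cinner [simp]

lemma cinner_add_right: "cinner u (v + w) = cinner u v + cinner u w"
  by (metis cinner_add_left cinner_commute complex_cnj_add)

lemma cinner_cscale_right: "cinner u (cscale a v) = cnj a * cinner u v"
  by (metis cinner_cscale_left cinner_commute complex_cnj_mult)

global_interpretation cinner: bounded_bilinear "cinner :: 'a::chilbert_space \<Rightarrow> 'a \<Rightarrow> complex"
proof
  fix a b :: 'a and r :: real
  show "cinner (r *\<^sub>R a) b = r *\<^sub>R cinner a b"
    by (simp add: cinner_cscale_left scaleR_conv_of_real flip: cscale_of_real)
  show "cinner a (r *\<^sub>R b) = r *\<^sub>R cinner a b"
    by (simp add: cinner_cscale_right scaleR_conv_of_real flip: cscale_of_real)
  show "\<exists>K. \<forall>a b :: 'a. norm (cinner a b) \<le> norm a * norm b * K"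
    by (rule exI[of _ 1]) (simp add: cmod_cinner_le)
qed (simp_all add: cinner_add_left cinner_add_right)

global_interpretation cscale: bounded_bilinear "cscale :: complex \<Rightarrow> 'a::chilbert_space \<Rightarrow> 'a"
proof
  fix a :: complex and b :: 'a and r :: real
  show "cscale (r *\<^sub>R a) b = r *\<^sub>R cscale a b" "cscale a (r *\<^sub>R b) = r *\<^sub>R cscale a b"
    by (simp_all add: cscale_cscale scaleR_conv_of_real mult.commute flip: cscale_of_real)
  show "\<exists>K. \<forall>a (b :: 'a). norm (cscale a b) \<le> norm a * norm b * K"
    by (rule exI[of _ 1]) (simp add: norm_cscale)
qed (simp_all add: cscale_add_right cscale_add_left)

lemma cinner_self: "cinner v v = complex_of_real ((norm v)\<^sup>2)"
proof -
  have "Im (cinner v v) = 0"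
    by (metis cinner_commute complex_cnj_cancel_iff Reals_cnj_iff complex_is_Real_iff)
  then show ?thesis by (simp add: complex_eq_iff power2_norm_eq_inner)
qed

lemma cinner_mult_commute: "cinner u v * cinner v u = complex_of_real ((cmod (cinner u v))\<^sup>2)"
  by (metis cinner_commute complex_norm_square)

lemma inner_cscale_left: "inner (cscale a u) v = Re (a * cinner u v)"
  by (metis Re_cinner cinner_cscale_left)

lemma cinner_eq_zero_all: "(\<And>v. cinner u v = 0) \<Longrightarrow> u = 0"
  by (metis cinner_self norm_eq_zero of_real_eq_0_iff power_eq_0_iff)

section \<open>Self-adjoint and positive operators\<close>

lemma self_adjointD:
  assumes "self_adjoint C"
  shows "blinfun_apply C (cscale a v) = cscale a (blinfun_apply C v)"
    and "cinner (blinfun_apply C v) w = cinner v (blinfun_apply C w)"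
  using assms by (auto simp: self_adjoint_def)

lemma self_adjoint_inner:
  "self_adjoint C \<Longrightarrow> inner (blinfun_apply C v) w = inner v (blinfun_apply C w)"
  by (metis Re_cinner self_adjointD(2))

lemma self_adjoint_cinner_self:
  assumes "self_adjoint C"
  shows "cinner (blinfun_apply C v) v = complex_of_real (inner (blinfun_apply C v) v)"
proof -
  have "cinner (blinfun_apply C v) v = cnj (cinner (blinfun_apply C v) v)"
    using self_adjointD(2)[OF assms, of v v] cinner_commute by metis
  then have "Im (cinner (blinfun_apply C v) v) = 0"
    by (metis Reals_cnj_iff complex_is_Real_iff)
  then show ?thesis by (simp add: complex_eq_iff)
qed

lemma self_adjoint_zero: "self_adjoint 0"
  by (simp add: self_adjoint_def cinner.zero_left cinner.zero_right cscale.zero_right)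

lemma self_adjoint_add: "self_adjoint C \<Longrightarrow> self_adjoint D \<Longrightarrow> self_adjoint (C + D)"
  by (simp add: self_adjoint_def blinfun.add_left cscale_add_right cinner_add_left cinner_add_right)

lemma self_adjoint_scaleR: "self_adjoint C \<Longrightarrow> self_adjoint (r *\<^sub>R C)"
  by (simp add: self_adjoint_def blinfun.scaleR_left cinner.scaleR_left cinner.scaleR_right
      cscale.scaleR_right)

lemma self_adjoint_diff: "self_adjoint C \<Longrightarrow> self_adjoint D \<Longrightarrow> self_adjoint (C - D)"
  using self_adjoint_add[of C "(-1) *\<^sub>R D"] self_adjoint_scaleR[of D "-1"] by simp

lemma self_adjoint_sum: "(\<And>i. i \<in> I \<Longrightarrow> self_adjoint (f i)) \<Longrightarrow> self_adjoint (\<Sum>i\<in>I. f i)"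
  by (induction I rule: infinite_finite_induct) (auto intro: self_adjoint_zero self_adjoint_add)

lemma self_adjoint_id: "self_adjoint id_blinfun"
  by (simp add: self_adjoint_def)

lemma self_adjoint_outer: "self_adjoint (outer w w)"
  by (auto simp: self_adjoint_def outer_apply cinner_cscale_left cscale_cscale cinner_cscale_right
      mult.commute) (metis cinner_commute)

lemma inner_outer_self: "inner (blinfun_apply (outer w w) v) v = (cmod (cinner v w))\<^sup>2"
  by (simp add: outer_apply inner_cscale_left cinner_mult_commute)

lemma closed_self_adjoint: "closed {C :: 'a::chilbert_space \<Rightarrow>\<^sub>L 'a. self_adjoint C}"
  unfolding self_adjoint_def
  by (intro closed_Collect_conj closed_Collect_all closed_Collect_eq continuous_intros
      cinner.continuous_on cscale.continuous_on)

lemma positive_opD: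
  assumes "positive_op P"
  shows "self_adjoint P" and "0 \<le> inner (blinfun_apply P v) v"
  using assms by (auto simp: positive_op_def)

lemma positive_outer: "positive_op (outer w w)"
  by (simp add: positive_op_def self_adjoint_outer inner_outer_self)

lemma positive_op_closed: "closed {P :: 'a::chilbert_space \<Rightarrow>\<^sub>L 'a. positive_op P}"
  unfolding positive_op_def
  by (intro closed_Collect_conj closed_self_adjoint closed_Collect_all closed_Collect_le
      continuous_intros cinner.continuous_on)

lemma positive_op_convex: "convex {P :: 'a::chilbert_space \<Rightarrow>\<^sub>L 'a. positive_op P}"
  by (intro convexI)
    (auto simp: positive_op_def self_adjoint_add self_adjoint_scaleR blinfun.add_left
      blinfun.scaleR_left inner_add_left)

lemma discriminant_le:
  fixes a b c :: real
  assumes "\<And>t. 0 \<le> a + 2 * t * b + t\<^sup>2 * c"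
  shows "b\<^sup>2 \<le> a * c"
proof (cases "c = 0")
  case True
  have "b = 0"
  proof (rule ccontr)
    assume "b \<noteq> 0"
    \<comment> \<open>At this \<open>t\<close> the polynomial, which is affine when
      \<open>c = 0\<close>, takes the value \<open>-1\<close>.\<close>
    then show False using assms[of "- (a + 1) / (2 * b)"] True by (simp add: field_simps)
  qed
  then show ?thesis using True by simp
next
  case False
  have "c \<ge> 0"
  proof (rule ccontr)
    assume c: "\<not> 0 \<le> c"
    \<comment> \<open>Large enough that the term with \<open>c\<close> outweighs the two others: the
      polynomial is then at most \<open>- t\<close>.\<close>
    define t where "t = (\<bar>a\<bar> + 2 * \<bar>b\<bar> + 1) / (- c) + 1"
    have t: "t \<ge> 1" "t * (- c) \<ge> \<bar>a\<bar> + 2 * \<bar>b\<bar> + 1"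
      using c by (auto simp: t_def field_simps)
    have "t\<^sup>2 * (- c) \<ge> t * \<bar>a\<bar> + t * (2 * \<bar>b\<bar>) + t"
      using mult_left_mono[OF t(2), of t] t(1) by (simp add: power2_eq_square algebra_simps)
    moreover have "2 * t * b \<le> t * (2 * \<bar>b\<bar>)" using t(1) by auto
    moreover have "a \<le> t * \<bar>a\<bar>" using t(1) mult_right_mono[OF t(1), of "\<bar>a\<bar>"] by auto
    ultimately show False using assms[of t] t(1) by linarith
  qed
  with False have c: "c > 0" by simp
  have "0 \<le> a - b\<^sup>2 / c"
    using assms[of "- b / c"] c by (simp add: field_simps power2_eq_square)
  then show ?thesis using c by (simp add: field_simps)
qed

text \<open>Expanding the form at \<open>u + t *\<^sub>R w\<close> for real \<open>t\<close>
  controls only the real part of the product. Multiplying \<open>u\<close> by a unimodular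
  \<open>c\<close> makes the product real and nonnegative and leaves the form at \<open>u\<close>
  unchanged.\<close>

lemma positive_op_cauchy_schwarz:
  assumes P: "positive_op P"
  shows "(cmod (cinner (blinfun_apply P u) w))\<^sup>2
    \<le> inner (blinfun_apply P u) u * inner (blinfun_apply P w) w"
proof -
  note sa = positive_opD(1)[OF P]
  have real_case: "(inner (blinfun_apply P u) w)\<^sup>2
      \<le> inner (blinfun_apply P u) u * inner (blinfun_apply P w) w" for u w
  proof (rule discriminant_le)
    fix t :: real
    have "0 \<le> inner (blinfun_apply P (u + t *\<^sub>R w)) (u + t *\<^sub>R w)" by (rule positive_opD(2)[OF P])
    then show "0 \<le> inner (blinfun_apply P u) u + 2 * t * inner (blinfun_apply P u) w
        + t\<^sup>2 * inner (blinfun_apply P w) w"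
      using self_adjoint_inner[OF sa, of u w]
      by (simp add: blinfun.add_right blinfun.scaleR_right inner_add_left inner_add_right
          algebra_simps power2_eq_square inner_commute)
  qed
  show ?thesis
  proof (cases "cinner (blinfun_apply P u) w = 0")
    case False
    define z where "z = cinner (blinfun_apply P u) w"
    define c where "c = cnj z / complex_of_real (cmod z)"
    have c1: "cmod c = 1" using False by (simp add: c_def norm_divide z_def)
    have cz: "c * z = complex_of_real (cmod z)"
      using False complex_norm_square[of z] by (simp add: c_def field_simps power2_eq_square z_def)
    have "inner (blinfun_apply P (cscale c u)) w = cmod z"
      by (simp add: self_adjointD(1)[OF sa] inner_cscale_left cz flip: z_def)
    moreover have "inner (blinfun_apply P (cscale c u)) (cscale c u) = inner (blinfun_apply P u) u"
    proof -
      have "c * cnj c = 1" using c1 by (simp add: complex_norm_square[symmetric])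
      then have "cnj c * (c * a) = a" for a by (metis mult.assoc mult.commute mult_1)
      then show ?thesis
        unfolding Re_cinner[symmetric]
        by (simp only: self_adjointD(1)[OF sa] cinner_cscale_left cinner_cscale_right)
    qed
    ultimately show ?thesis using real_case[of "cscale c u" w] by (simp add: z_def)
  qed (simp add: positive_opD(2)[OF P])
qed

text \<open>Cauchy-Schwarz for the form of \<open>P\<close> with second vector \<open>P v\<close>,
  divided by the squared norm of \<open>P v\<close>. It converts smallness of the form into
  smallness of the vector.\<close>

lemma positive_op_norm_le:
  assumes P: "positive_op P"
  shows "(norm (blinfun_apply P v))\<^sup>2 \<le> norm P * inner (blinfun_apply P v) v"
proof (cases "blinfun_apply P v = 0")
  case False
  let ?n = "norm (blinfun_apply P v)"
  have "(?n\<^sup>2)\<^sup>2 = (cmod (cinner (blinfun_apply P v) (blinfun_apply P v)))\<^sup>2"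
    by (simp add: cinner_self norm_power)
  also have "\<dots> \<le> inner (blinfun_apply P v) v
      * inner (blinfun_apply P (blinfun_apply P v)) (blinfun_apply P v)"
    by (rule positive_op_cauchy_schwarz[OF P])
  also have "\<dots> \<le> inner (blinfun_apply P v) v * (norm P * ?n\<^sup>2)"
  proof (rule mult_left_mono[OF _ positive_opD(2)[OF P]])
    have "inner (blinfun_apply P (blinfun_apply P v)) (blinfun_apply P v)
        \<le> norm (blinfun_apply P (blinfun_apply P v)) * ?n"
      by (rule norm_cauchy_schwarz)
    also have "\<dots> \<le> norm P * ?n * ?n"
      by (intro mult_right_mono norm_blinfun) simp
    finally show "inner (blinfun_apply P (blinfun_apply P v)) (blinfun_apply P v) \<le> norm P * ?n\<^sup>2"
      by (simp add: power2_eq_square mult.assoc)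
  qed
  finally have "?n\<^sup>2 * ?n\<^sup>2 \<le> (norm P * inner (blinfun_apply P v) v) * ?n\<^sup>2"
    by (simp add: power2_eq_square algebra_simps)
  then show ?thesis using False by (elim mult_right_le_imp_le) simp
qed (simp add: positive_opD(2)[OF P])

lemma positive_op_eq_zero:
  assumes "positive_op P" "inner (blinfun_apply P v) v = 0"
  shows "blinfun_apply P v = 0"
  using positive_op_norm_le[OF assms(1), of v] assms(2) by simp

section \<open>Compact operators\<close>

text \<open>In a complete space the closure is complete, so total boundedness is all that remains,
  and a net of radius \<open>\<epsilon>/2\<close> for \<open>X\<close> is one of radius
  \<open>\<epsilon>\<close> for its closure.\<close>

lemma compact_closure_iff_nets:
  fixes X :: "'b::complete_space set"
  shows "compact (closure X) \<longleftrightarrow> (\<forall>\<epsilon>>0. \<exists>K. finite K \<and> X \<subseteq> (\<Union>y\<in>K. ball y \<epsilon>))"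
proof
  assume "compact (closure X)"
  then show "\<forall>\<epsilon>>0. \<exists>K. finite K \<and> X \<subseteq> (\<Union>y\<in>K. ball y \<epsilon>)"
    unfolding compact_eq_totally_bounded using closure_subset by fast
next
  assume nets: "\<forall>\<epsilon>>0. \<exists>K. finite K \<and> X \<subseteq> (\<Union>y\<in>K. ball y \<epsilon>)"
  show "compact (closure X)"
    unfolding compact_eq_totally_bounded
  proof (intro conjI allI impI)
    show "complete (closure X)" by (simp add: complete_eq_closed)
    fix \<epsilon> :: real assume "\<epsilon> > 0"
    then obtain K where K: "finite K" "X \<subseteq> (\<Union>y\<in>K. ball y (\<epsilon>/2))" using nets half_gt_zero by blast
    have "closure X \<subseteq> (\<Union>y\<in>K. cball y (\<epsilon>/2))"
      by (rule closure_minimal) (use K in \<open>auto intro: less_imp_le\<close>, force)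
    also have "\<dots> \<subseteq> (\<Union>y\<in>K. ball y \<epsilon>)" using \<open>\<epsilon> > 0\<close> by force
    finally show "\<exists>K. finite K \<and> closure X \<subseteq> (\<Union>y\<in>K. ball y \<epsilon>)" using K by blast
  qed
qed

lemma compact_sa_iff:
  "C \<in> compact_sa \<longleftrightarrow> self_adjoint C \<and>
     (\<forall>\<epsilon>>0. \<exists>K. finite K \<and> (\<forall>v. norm v \<le> 1 \<longrightarrow> (\<exists>y\<in>K. norm (blinfun_apply C v - y) < \<epsilon>)))"
  unfolding compact_sa_def compact_closure_iff_nets
  by (simp add: image_subset_iff dist_norm norm_minus_commute Ball_def)

lemma compact_sa_add:
  assumes "C \<in> compact_sa" "D \<in> compact_sa"
  shows "C + D \<in> compact_sa"
  unfolding compact_sa_iff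
proof (intro conjI allI impI)
  show "self_adjoint (C + D)" using assms by (simp add: compact_sa_iff self_adjoint_add)
  fix \<epsilon> :: real assume "\<epsilon> > 0"
  then have e2: "\<epsilon>/2 > 0" by simp
  obtain K L where K: "finite K" "\<And>v. norm v \<le> 1 \<Longrightarrow> \<exists>y\<in>K. norm (blinfun_apply C v - y) < \<epsilon>/2"
    and L: "finite L" "\<And>v. norm v \<le> 1 \<Longrightarrow> \<exists>y\<in>L. norm (blinfun_apply D v - y) < \<epsilon>/2"
    using assms e2 unfolding compact_sa_iff by meson
  show "\<exists>K. finite K \<and> (\<forall>v. norm v \<le> 1 \<longrightarrow> (\<exists>y\<in>K. norm (blinfun_apply (C + D) v - y) < \<epsilon>))"
  proof (intro exI[of _ "(\<lambda>(y, z). y + z) ` (K \<times> L)"] conjI allI impI)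
    show "finite ((\<lambda>(y, z). y + z) ` (K \<times> L))" using K L by simp
    fix v :: 'a assume v: "norm v \<le> 1"
    obtain y z where yz: "y \<in> K" "norm (blinfun_apply C v - y) < \<epsilon>/2"
      "z \<in> L" "norm (blinfun_apply D v - z) < \<epsilon>/2" using K(2)[OF v] L(2)[OF v] by auto
    then have "norm (blinfun_apply (C + D) v - (y + z)) < \<epsilon>"
      using norm_triangle_ineq[of "blinfun_apply C v - y" "blinfun_apply D v - z"]
      by (simp add: blinfun.add_left algebra_simps)
    with yz show "\<exists>y\<in>(\<lambda>(y, z). y + z) ` (K \<times> L). norm (blinfun_apply (C + D) v - y) < \<epsilon>" by force
  qed
qed

lemma compact_sa_scaleR:
  assumes "C \<in> compact_sa"
  shows "r *\<^sub>R C \<in> compact_sa"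
  unfolding compact_sa_iff
proof (intro conjI allI impI)
  show "self_adjoint (r *\<^sub>R C)" using assms by (simp add: compact_sa_iff self_adjoint_scaleR)
  fix \<epsilon> :: real assume "\<epsilon> > 0"
  then have e2: "\<epsilon> / (\<bar>r\<bar> + 1) > 0" by simp
  obtain K where K: "finite K" "\<And>v. norm v \<le> 1 \<Longrightarrow> \<exists>y\<in>K. norm (blinfun_apply C v - y) < \<epsilon> / (\<bar>r\<bar> + 1)"
    using assms e2 unfolding compact_sa_iff by meson
  show "\<exists>K. finite K \<and> (\<forall>v. norm v \<le> 1 \<longrightarrow> (\<exists>y\<in>K. norm (blinfun_apply (r *\<^sub>R C) v - y) < \<epsilon>))"
  proof (intro exI[of _ "(\<lambda>y. r *\<^sub>R y) ` K"] conjI allI impI)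
    show "finite ((\<lambda>y. r *\<^sub>R y) ` K)" using K by simp
    fix v :: 'a assume v: "norm v \<le> 1"
    obtain y where y: "y \<in> K" "norm (blinfun_apply C v - y) < \<epsilon> / (\<bar>r\<bar> + 1)" using K(2)[OF v] by
        auto
    have "norm (blinfun_apply (r *\<^sub>R C) v - r *\<^sub>R y) = \<bar>r\<bar> * norm (blinfun_apply C v - y)"
      by (simp add: blinfun.scaleR_left flip: scaleR_diff_right)
    also have "\<dots> \<le> (\<bar>r\<bar> + 1) * norm (blinfun_apply C v - y)" by (simp add: mult_right_mono)
    also have "\<dots> < \<epsilon>" using y(2) by (simp add: field_simps)
    finally show "\<exists>y\<in>(\<lambda>y. r *\<^sub>R y) ` K. norm (blinfun_apply (r *\<^sub>R C) v - y) < \<epsilon>" using y by blast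
  qed
qed

lemma compact_sa_diff: "C \<in> compact_sa \<Longrightarrow> D \<in> compact_sa \<Longrightarrow> C - D \<in> compact_sa"
  using compact_sa_add[of C "(-1) *\<^sub>R D"] compact_sa_scaleR[of D "-1"] by simp

lemma compact_sa_zero: "0 \<in> compact_sa"
  by (auto simp: compact_sa_iff self_adjoint_zero intro!: exI[of _ "{0}"])

lemma compact_sa_outer: "outer w w \<in> compact_sa"
proof -
  have "blinfun_apply (outer w w) ` cball 0 1 \<subseteq> (\<lambda>a. cscale a w) ` cball 0 (norm w)"
  proof clarify
    fix v :: 'a assume "v \<in> cball 0 1"
    then have "cmod (cinner v w) \<le> norm w"
      using cmod_cinner_le[of v w] mult_right_mono[of "norm v" 1 "norm w"] by simp
    then show "blinfun_apply (outer w w) v \<in> (\<lambda>a. cscale a w) ` cball 0 (norm w)"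
      by (auto simp: outer_apply)
  qed
  moreover have K: "compact ((\<lambda>a. cscale a w) ` cball 0 (norm w))"
    by (intro compact_continuous_image cscale.continuous_on continuous_intros) simp
  ultimately have "closure (blinfun_apply (outer w w) ` cball 0 1)
      \<subseteq> (\<lambda>a. cscale a w) ` cball 0 (norm w)"
    by (intro closure_minimal compact_imp_closed)
  then have "compact (closure (blinfun_apply (outer w w) ` cball 0 1))"
    using compact_Int_closed[OF K closed_closure] by (metis inf.absorb_iff2)
  then show ?thesis by (simp add: compact_sa_def self_adjoint_outer)
qed

lemma compact_sa_sum: "(\<And>i. i \<in> I \<Longrightarrow> f i \<in> compact_sa) \<Longrightarrow> (\<Sum>i\<in>I. f i) \<in> compact_sa"
  by (induction I rule: infinite_finite_induct) (auto intro: compact_sa_zero compact_sa_add)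

lemma compact_sa_lim:
  assumes C: "\<And>n. f n \<in> compact_sa" and lim: "f \<longlonglongrightarrow> D"
  shows "D \<in> compact_sa"
  unfolding compact_sa_iff
proof (intro conjI allI impI)
  show "self_adjoint D"
    using closed_sequentially[OF closed_self_adjoint _ lim] C by (auto simp: compact_sa_iff)
  fix \<epsilon> :: real assume "\<epsilon> > 0"
  then have e2: "\<epsilon>/2 > 0" by simp
  obtain n where n: "norm (f n - D) < \<epsilon>/2"
    using LIMSEQ_D[OF lim e2] by auto
  obtain K where K: "finite K" "\<And>v. norm v \<le> 1 \<Longrightarrow> \<exists>y\<in>K. norm (blinfun_apply (f n) v - y) < \<epsilon>/2"
    using C[of n] e2 unfolding compact_sa_iff by meson
  show "\<exists>K. finite K \<and> (\<forall>v. norm v \<le> 1 \<longrightarrow> (\<exists>y\<in>K. norm (blinfun_apply D v - y) < \<epsilon>))"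
  proof (intro exI[of _ K] conjI allI impI K(1))
    fix v :: 'a assume v: "norm v \<le> 1"
    obtain y where y: "y \<in> K" "norm (blinfun_apply (f n) v - y) < \<epsilon>/2" using K(2)[OF v] by auto
    have "norm (blinfun_apply (f n) v - blinfun_apply D v) \<le> norm (f n - D) * norm v"
      using norm_blinfun[of "f n - D" v] by (simp add: blinfun.diff_left)
    also have "\<dots> \<le> norm (f n - D)" using v mult_left_mono[OF v, of "norm (f n - D)"] by simp
    finally have "norm (blinfun_apply D v - y) < \<epsilon>"
      using y(2) n norm_triangle_ineq[of "blinfun_apply (f n) v - y" "blinfun_apply D v -
          blinfun_apply (f n) v"]
      by (simp add: norm_minus_commute)
    with y show "\<exists>y\<in>K. norm (blinfun_apply D v - y) < \<epsilon>" by blast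
  qed
qed

section \<open>Coercive operators\<close>

text \<open>Lax-Milgram by fixed points: the solutions of \<open>B v = w\<close> are the fixed
  points of \<open>v - t (B v - w)\<close>, a contraction for small \<open>t\<close>, and coercivity
  bounds the inverse.\<close>

lemma coercive_invertible:
  fixes B :: "'b::{real_inner,banach} \<Rightarrow>\<^sub>L 'b"
  assumes c: "c > 0" and coercive: "\<And>v. c * (norm v)\<^sup>2 \<le> inner (blinfun_apply B v) v"
  shows "\<exists>T :: 'b \<Rightarrow>\<^sub>L 'b. \<forall>v. blinfun_apply T (blinfun_apply B v) = v \<and> blinfun_apply B
      (blinfun_apply T v) = v"
proof -
  have lower: "c * norm v \<le> norm (blinfun_apply B v)" for v
  proof (cases "v = 0")
    case False
    have "c * norm v * norm v \<le> norm (blinfun_apply B v) * norm v"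
      using coercive[of v] norm_cauchy_schwarz[of "blinfun_apply B v" v]
      by (simp add: power2_eq_square mult.assoc)
    then show ?thesis using False by simp
  qed simp
  have inj: "u = v" if "blinfun_apply B u = blinfun_apply B v" for u v
    using lower[of "u - v"] that c by (simp add: blinfun.diff_right mult_le_0_iff)
  \<comment> \<open>Adding \<open>c\<^sup>2\<close> ensures \<open>K > 0\<close> and
    \<open>c\<^sup>2 \<le> K\<close> even on a trivial space. The choice \<open>t = c / K\<close>
    minimises \<open>1 - 2 * t * c + t\<^sup>2 * K\<close>, which bounds the squared Lipschitz
    constant.\<close>
  define K where "K = (norm B)\<^sup>2 + c\<^sup>2"
  have K: "K > 0" "c\<^sup>2 \<le> K" using c by (auto simp: K_def add_nonneg_pos)
  define t where "t = c / K"
  have surj: "\<exists>v. blinfun_apply B v = w" for w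
  proof -
    define f where "f v = v - t *\<^sub>R (blinfun_apply B v - w)" for v
    have "\<exists>!v. f v = v"
    proof (rule banach_fix_type)
      show "0 \<le> sqrt (1 - c\<^sup>2 / K)" "sqrt (1 - c\<^sup>2 / K) < 1" using K c by auto
      show "\<forall>x y. dist (f x) (f y) \<le> sqrt (1 - c\<^sup>2 / K) * dist x y"
      proof (intro allI)
        fix x y :: 'b
        define d where "d = x - y"
        have f_diff: "f x - f y = d - t *\<^sub>R blinfun_apply B d"
          by (simp add: f_def d_def blinfun.diff_right algebra_simps)
        have "(norm (blinfun_apply B d))\<^sup>2 \<le> (norm B * norm d)\<^sup>2"
          by (intro power_mono norm_blinfun) simp
        also have "\<dots> \<le> K * (norm d)\<^sup>2" by (simp add: K_def power_mult_distrib mult_right_mono)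
        finally have Bd: "(norm (blinfun_apply B d))\<^sup>2 \<le> K * (norm d)\<^sup>2" .
        have "(norm (f x - f y))\<^sup>2
            = (norm d)\<^sup>2 - 2 * t * inner (blinfun_apply B d) d + t\<^sup>2 * (norm (blinfun_apply B d))\<^sup>2"
          unfolding f_diff power2_norm_eq_inner
          by (simp add: inner_diff_left inner_diff_right inner_commute power2_eq_square
              algebra_simps)
        also have "\<dots> \<le> (norm d)\<^sup>2 - 2 * t * (c * (norm d)\<^sup>2) + t\<^sup>2 * (K * (norm d)\<^sup>2)"
          using c K by (intro add_mono diff_mono mult_left_mono Bd coercive) (auto simp: t_def)
        also have "\<dots> = (1 - c\<^sup>2 / K) * (norm d)\<^sup>2"
          using K by (simp add: t_def field_simps power2_eq_square)
        also have "\<dots> = (sqrt (1 - c\<^sup>2 / K) * norm d)\<^sup>2"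
          using K by (simp add: power_mult_distrib)
        finally have "norm (f x - f y) \<le> sqrt (1 - c\<^sup>2 / K) * norm d"
          using K by (elim power2_le_imp_le) simp
        then show "dist (f x) (f y) \<le> sqrt (1 - c\<^sup>2 / K) * dist x y"
          by (simp add: dist_norm d_def)
      qed
    qed
    then obtain v where "f v = v" by blast
    then show ?thesis using c K by (auto simp: f_def t_def)
  qed
  obtain g where g: "\<And>w. blinfun_apply B (g w) = w" using surj by metis
  have gB: "g (blinfun_apply B v) = v" for v by (rule inj) (rule g)
  have "bounded_linear g"
  proof (rule bounded_linear_intro[where K = "1 / c"])
    show "g (x + y) = g x + g y" for x y by (rule inj) (simp add: g blinfun.add_right)
    show "g (r *\<^sub>R x) = r *\<^sub>R g x" for r x by (rule inj) (simp add: g blinfun.scaleR_right)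
    show "norm (g x) \<le> norm x * (1 / c)" for x
      using lower[of "g x"] c by (simp add: g field_simps)
  qed
  then show ?thesis
    by (intro exI[of _ "Blinfun g"]) (simp add: bounded_linear_Blinfun_apply g gB)
qed

section \<open>Expansions in an orthonormal basis\<close>

locale onb =
  fixes e :: "nat \<Rightarrow> 'a::chilbert_space"
  assumes onb: "orthonormal_basis e"
begin

lemma cinner_e: "cinner (e i) (e j) = (if i = j then 1 else 0)"
  using onb by (simp add: orthonormal_basis_def)

lemma norm_e [simp]: "norm (e i) = 1"
  using cinner_self[of "e i"] by (simp add: cinner_e power2_eq_1_iff flip: of_real_power)
    (metis norm_ge_zero not_one_le_zero neg_0_le_iff_le)

definition proj :: "nat \<Rightarrow> 'a \<Rightarrow>\<^sub>L 'a" where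
  "proj N = (\<Sum>k<N. outer (e k) (e k))"

lemma proj_apply: "blinfun_apply (proj N) v = (\<Sum>k<N. cscale (cinner v (e k)) (e k))"
  by (simp add: proj_def blinfun.sum_left outer_apply)

lemma self_adjoint_proj: "self_adjoint (proj N)"
  by (simp add: proj_def self_adjoint_sum self_adjoint_outer)

lemma cinner_proj: "cinner (blinfun_apply (proj N) u) v = (\<Sum>k<N. cinner u (e k) * cinner (e k) v)"
  by (simp add: proj_apply cinner.sum_left cinner_cscale_left)

lemma cinner_proj_e: "cinner (blinfun_apply (proj N) v) (e j) = (if j < N then cinner v (e j) else
    0)"
  by (simp add: cinner_proj cinner_e if_distrib[of "\<lambda>z. _ * z"] cong: if_cong)

lemma proj_e: "blinfun_apply (proj N) (e j) = (if j < N then e j else 0)"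
proof -
  have "blinfun_apply (proj N) (e j) = (\<Sum>k<N. if k = j then e j else 0)"
    unfolding proj_apply
    by (intro sum.cong refl) (auto simp: cinner_e cscale.zero_left)
  then show ?thesis by simp
qed

lemma proj_proj: "blinfun_apply (proj N) (blinfun_apply (proj N) v) = blinfun_apply (proj N) v"
  by (simp add: proj_apply[of N "blinfun_apply (proj N) v"] cinner_proj_e) (simp add: proj_apply)

lemma norm_proj: "(norm (blinfun_apply (proj N) v))\<^sup>2 = (\<Sum>k<N. (cmod (cinner v (e k)))\<^sup>2)"
proof -
  have "complex_of_real ((norm (blinfun_apply (proj N) v))\<^sup>2) = cinner (blinfun_apply (proj N) v) v"
    by (metis cinner_self self_adjointD(2)[OF self_adjoint_proj] proj_proj)
  also have "\<dots> = complex_of_real (\<Sum>k<N. (cmod (cinner v (e k)))\<^sup>2)"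
    by (simp add: cinner_proj cinner_mult_commute)
  finally show ?thesis by (simp only: of_real_eq_iff)
qed

lemma norm_minus_proj:
  "(norm (v - blinfun_apply (proj N) v))\<^sup>2 = (norm v)\<^sup>2 - (norm (blinfun_apply (proj N) v))\<^sup>2"
proof -
  have "inner v (blinfun_apply (proj N) v) = (norm (blinfun_apply (proj N) v))\<^sup>2"
    by (metis inner_commute power2_norm_eq_inner proj_proj self_adjoint_inner[OF self_adjoint_proj])
  then show ?thesis
    by (simp add: power2_norm_eq_inner inner_diff_left inner_diff_right inner_commute)
qed

lemma norm_minus_proj_le: "norm (v - blinfun_apply (proj N) v) \<le> norm v"
  by (rule power2_le_imp_le) (simp_all add: norm_minus_proj)

lemma bessel: "(\<Sum>k<N. (cmod (cinner v (e k)))\<^sup>2) \<le> (norm v)\<^sup>2"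
  using norm_minus_proj[of v N] zero_le_power2[of "norm (v - blinfun_apply (proj N) v)"]
  by (simp add: norm_proj)

text \<open>From index \<open>N\<close> on, \<open>v\<close> and \<open>v - proj N v\<close> have
  the same coefficients, so Bessel's inequality applies to the latter.\<close>

lemma bessel_tail:
  "(\<Sum>k=N..<M. (cmod (cinner v (e k)))\<^sup>2) \<le> (norm (v - blinfun_apply (proj N) v))\<^sup>2"
proof -
  have "(\<Sum>k=N..<M. (cmod (cinner v (e k)))\<^sup>2)
      = (\<Sum>k=N..<M. (cmod (cinner (v - blinfun_apply (proj N) v) (e k)))\<^sup>2)"
    by (simp add: cinner.diff_left cinner_proj_e)
  also have "\<dots> \<le> (\<Sum>k<M. (cmod (cinner (v - blinfun_apply (proj N) v) (e k)))\<^sup>2)"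
    by (rule sum_mono2) auto
  also have "\<dots> \<le> (norm (v - blinfun_apply (proj N) v))\<^sup>2" by (rule bessel)
  finally show ?thesis .
qed

lemma proj_span:
  assumes "z \<in> cspan (e ` {..<M})" "M \<le> N"
  shows "blinfun_apply (proj N) z = z"
  using assms(1)
proof (induction rule: complex_vector.span_induct_alt)
  case base
  then show ?case by simp
next
  case (step c x y)
  then show ?case
    using assms(2) by (auto simp: blinfun.add_right self_adjointD(1)[OF self_adjoint_proj] proj_e)
qed

lemma span_range_finite:
  assumes "z \<in> cspan (range e)"
  shows "\<exists>M. z \<in> cspan (e ` {..<M})"
  using assms
proof (induction rule: complex_vector.span_induct_alt)
  case base
  then show ?case by (auto intro: complex_vector.span_zero)
next
  case (step c x y)
  then obtain M i where M: "y \<in> cspan (e ` {..<M})" and i: "x = e i" by auto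
  have "y \<in> cspan (e ` {..<max M (Suc i)})"
    by (rule subsetD[OF complex_vector.span_mono M]) auto
  moreover have "x \<in> cspan (e ` {..<max M (Suc i)})"
    by (rule complex_vector.span_base) (auto simp: i)
  ultimately show ?case
    by (intro exI[of _ "max M (Suc i)"] complex_vector.span_add complex_vector.span_scale)
qed

lemma proj_tendsto: "(\<lambda>N. blinfun_apply (proj N) v) \<longlonglongrightarrow> v"
proof (rule LIMSEQ_I)
  fix r :: real assume "r > 0"
  have "v \<in> closure (cspan (range e))" using onb by (simp add: orthonormal_basis_def)
  then obtain z where z: "z \<in> cspan (range e)" "dist z v < r"
    using \<open>r > 0\<close> closure_approachable by blast
  then obtain M where M: "z \<in> cspan (e ` {..<M})" using span_range_finite by blast
  have "norm (blinfun_apply (proj N) v - v) < r" if "N \<ge> M" for N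
  proof -
    have "v - blinfun_apply (proj N) v = (v - z) - blinfun_apply (proj N) (v - z)"
      using proj_span[OF M that] by (simp add: blinfun.diff_right)
    then have "norm (v - blinfun_apply (proj N) v) \<le> norm (v - z)"
      by (metis norm_minus_proj_le)
    also have "\<dots> < r" using z(2) by (simp add: dist_norm norm_minus_commute)
    finally show ?thesis by (simp add: norm_minus_commute)
  qed
  then show "\<exists>M. \<forall>N\<ge>M. norm (blinfun_apply (proj N) v - v) < r" by blast
qed

lemma parseval: "(\<lambda>k. cinner u (e k) * cinner (e k) v) sums cinner u v"
  unfolding sums_def cinner_proj[symmetric]
  by (intro cinner.tendsto proj_tendsto tendsto_const)

lemma parseval_norm: "(\<lambda>k. (cmod (cinner v (e k)))\<^sup>2) sums (norm v)\<^sup>2"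
  unfolding sums_def norm_proj[symmetric]
  by (intro tendsto_power tendsto_norm proj_tendsto)

lemma coefficient_tendsto_zero: "(\<lambda>k. inner v (e k)) \<longlonglongrightarrow> 0"
proof -
  have "(\<lambda>k. (cmod (cinner v (e k)))\<^sup>2) \<longlonglongrightarrow> 0"
    using parseval_norm sums_summable summable_LIMSEQ_zero by blast
  then have "(\<lambda>k. sqrt ((cmod (cinner v (e k)))\<^sup>2)) \<longlonglongrightarrow> sqrt 0" by (rule tendsto_real_sqrt)
  then have "(\<lambda>k. cinner v (e k)) \<longlonglongrightarrow> 0" by (simp add: tendsto_norm_zero_iff)
  then show ?thesis using tendsto_Re by fastforce
qed

text \<open>The projections converge pointwise, hence uniformly on a finite net of the image of the
  unit ball, and by \<open>norm_minus_proj_le\<close> on the whole image. In this form compactness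
  is used for the spectrum, for traces and for eigenspaces.\<close>

lemma compact_tail:
  fixes C :: "'a \<Rightarrow>\<^sub>L 'a"
  assumes C: "C \<in> compact_sa" and "\<epsilon> > 0"
  shows "\<exists>N. \<forall>v. norm (blinfun_apply C v - blinfun_apply (proj N) (blinfun_apply C v)) \<le> \<epsilon> * norm v"
proof -
  have "\<epsilon>/2 > 0" using \<open>\<epsilon> > 0\<close> by simp
  then obtain K where K: "finite K" "\<And>v. norm v \<le> 1 \<Longrightarrow> \<exists>y\<in>K. norm (blinfun_apply C v - y) < \<epsilon>/2"
    using C unfolding compact_sa_iff by meson
  have "\<forall>y\<in>K. \<forall>\<^sub>F N in sequentially. norm (blinfun_apply (proj N) y - y) < \<epsilon>/2"
    using tendstoD[OF proj_tendsto \<open>\<epsilon>/2 > 0\<close>] by (simp only: dist_norm) blast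
  then have "\<forall>\<^sub>F N in sequentially. \<forall>y\<in>K. norm (blinfun_apply (proj N) y - y) < \<epsilon>/2"
    by (rule eventually_ball_finite[OF K(1)])
  then obtain N where N: "\<And>y. y \<in> K \<Longrightarrow> norm (blinfun_apply (proj N) y - y) < \<epsilon>/2"
    by (auto simp: eventually_sequentially)
  have unit: "norm (blinfun_apply C v - blinfun_apply (proj N) (blinfun_apply C v)) \<le> \<epsilon>"
    if v: "norm v \<le> 1" for v
  proof -
    obtain y where y: "y \<in> K" "norm (blinfun_apply C v - y) < \<epsilon>/2" using K(2)[OF v] by auto
    let ?d = "blinfun_apply C v - y"
    have "blinfun_apply C v - blinfun_apply (proj N) (blinfun_apply C v)
        = (?d - blinfun_apply (proj N) ?d) + (y - blinfun_apply (proj N) y)"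
      by (simp add: blinfun.diff_right)
    then have "norm (blinfun_apply C v - blinfun_apply (proj N) (blinfun_apply C v))
        \<le> norm (?d - blinfun_apply (proj N) ?d) + norm (y - blinfun_apply (proj N) y)"
      by (metis norm_triangle_ineq)
    also have "\<dots> \<le> \<epsilon>/2 + \<epsilon>/2"
      using norm_minus_proj_le[of ?d N] y N[OF y(1)] by (intro add_mono) (auto simp:
          norm_minus_commute)
    finally show ?thesis by simp
  qed
  have "norm (blinfun_apply C v - blinfun_apply (proj N) (blinfun_apply C v)) \<le> \<epsilon> * norm v" for v
  proof (cases "v = 0")
    case False
    have "norm (blinfun_apply C v - blinfun_apply (proj N) (blinfun_apply C v)) / norm v
        = norm (blinfun_apply C (v /\<^sub>R norm v) - blinfun_apply (proj N) (blinfun_apply C (v /\<^sub>R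
            norm v)))"
      by (simp add: blinfun.scaleR_right divide_inverse_commute flip: scaleR_diff_right)
    also have "\<dots> \<le> \<epsilon>" by (rule unit) (use False in simp)
    finally show ?thesis using False by (simp add: field_simps)
  qed simp
  then show ?thesis by blast
qed

section \<open>The largest spectral value\<close>

text \<open>If \<open>r > m\<close>, then \<open>r - C\<close> is coercive with constant
  \<open>r - m\<close>, hence invertible.\<close>

lemma spectrum_upper_bound:
  fixes C :: "'a \<Rightarrow>\<^sub>L 'a"
  assumes le: "\<And>v. inner (blinfun_apply C v) v \<le> m * (norm v)\<^sup>2"
    and r: "complex_of_real r \<in> spectrum_op C"
  shows "r \<le> m"
proof (rule ccontr)
  assume "\<not> r \<le> m"
  define B where "B = r *\<^sub>R id_blinfun - C"
  have B: "blinfun_apply B v = r *\<^sub>R v - blinfun_apply C v" for v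
    by (simp add: B_def blinfun.diff_left blinfun.scaleR_left)
  have "(r - m) * (norm v)\<^sup>2 \<le> inner (blinfun_apply B v) v" for v
    using le[of v] by (simp add: B inner_diff_left power2_norm_eq_inner algebra_simps)
  then obtain T where T: "\<And>v. blinfun_apply T (blinfun_apply B v) = v"
      "\<And>v. blinfun_apply B (blinfun_apply T v) = v"
    using coercive_invertible[of "r - m" B] \<open>\<not> r \<le> m\<close> by auto
  have "blinfun_apply (- T) (blinfun_apply C v - cscale (complex_of_real r) v) = v" for v
    using T(1)[of v] by (simp add: B cscale_of_real blinfun.minus_left blinfun.diff_right)
  moreover have "blinfun_apply C (blinfun_apply (- T) v)
      - cscale (complex_of_real r) (blinfun_apply (- T) v) = v" for v
    using T(2)[of v] by (simp add: B cscale_of_real blinfun.minus_left blinfun.minus_right)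
  ultimately show False using r unfolding spectrum_op_def by blast
qed

text \<open>For a late index \<open>N\<close> the vector \<open>C (e N)\<close> is short:
  self-adjointness turns its squared norm into the coefficient of \<open>C (C (e N))\<close> at
  \<open>e N\<close>, which belongs to the tail. A bounded left inverse could not bring it back to
  norm \<open>1\<close>.\<close>

lemma zero_in_spectrum:
  fixes C :: "'a \<Rightarrow>\<^sub>L 'a"
  assumes C: "C \<in> compact_sa"
  shows "0 \<in> spectrum_op C"
proof (rule ccontr)
  assume "0 \<notin> spectrum_op C"
  then obtain T :: "'a \<Rightarrow>\<^sub>L 'a" where T: "\<And>v. blinfun_apply T (blinfun_apply C v) = v"
    by (auto simp: spectrum_op_def cscale.zero_left)
  have sa: "self_adjoint C" using C by (simp add: compact_sa_iff)
  \<comment> \<open>Makes \<open>norm T * \<epsilon> < 1\<close>; the added \<open>1\<close> covers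
    \<open>norm T = 0\<close>.\<close>
  define \<epsilon> where "\<epsilon> = 1 / (2 * (norm T + 1))"
  have "\<epsilon> > 0" by (simp add: \<epsilon>_def add_nonneg_pos)
  then obtain N where N: "\<And>v. norm (blinfun_apply C v - blinfun_apply (proj N) (blinfun_apply C
      v)) \<le> \<epsilon> * norm v"
    using compact_tail[OF C] by blast
  let ?w = "blinfun_apply C (e N)"
  have "inner (blinfun_apply (proj N) (blinfun_apply C ?w)) (e N) = 0"
    using cinner_proj_e[of N "blinfun_apply C ?w" N] by (simp flip: Re_cinner)
  then have "(norm ?w)\<^sup>2 = inner (blinfun_apply C ?w - blinfun_apply (proj N) (blinfun_apply C
      ?w)) (e N)"
    by (simp add: power2_norm_eq_inner inner_diff_left self_adjoint_inner[OF sa, of ?w])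
  also have "\<dots> \<le> \<epsilon> * norm ?w"
    using norm_cauchy_schwarz[of "blinfun_apply C ?w - blinfun_apply (proj N) (blinfun_apply C
        ?w)" "e N"] N[of ?w]
    by simp
  finally have "norm ?w \<le> \<epsilon>"
    using \<open>\<epsilon> > 0\<close> by (cases "?w = 0") (auto simp: power2_eq_square)
  have "1 = norm (blinfun_apply T ?w)" by (simp add: T)
  also have "\<dots> \<le> norm T * norm ?w" by (rule norm_blinfun)
  also have "\<dots> \<le> norm T * \<epsilon>" using \<open>norm ?w \<le> \<epsilon>\<close> by (simp add: mult_left_mono)
  also have "norm T * \<epsilon> < 1"
  proof -
    have "0 < 2 * (norm T + 1) \<and> norm T < 1 * (2 * (norm T + 1))"
      using norm_ge_zero[of T] by argo
    then show ?thesis unfolding \<epsilon>_def by (simp only: times_divide_eq_right mult_1_right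
        pos_divide_less_eq)
  qed
  finally show False by simp
qed

text \<open>A left inverse of \<open>C - m\<close> would bound \<open>norm v\<close> by
  \<open>norm (B v)\<close>, hence by the square root of the gap \<open>inner (B v) v\<close>. The
  form would then stay below \<open>m\<close> by a fixed amount on the unit ball, against
  \<open>least\<close>.\<close>

lemma form_sup_in_spectrum:
  fixes C :: "'a \<Rightarrow>\<^sub>L 'a"
  assumes sa: "self_adjoint C" and m: "m > 0"
    and le: "\<And>v. inner (blinfun_apply C v) v \<le> m * (norm v)\<^sup>2"
    and least: "\<And>b. (\<And>v. norm v \<le> 1 \<Longrightarrow> inner (blinfun_apply C v) v \<le> b) \<Longrightarrow> m \<le> b"
  shows "complex_of_real m \<in> spectrum_op C"
proof (rule ccontr)
  assume "complex_of_real m \<notin> spectrum_op C"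
  then obtain T :: "'a \<Rightarrow>\<^sub>L 'a" where T: "\<And>v. blinfun_apply T (blinfun_apply C v - m *\<^sub>R v) = v"
    by (auto simp: spectrum_op_def cscale_of_real)
  define B where "B = m *\<^sub>R id_blinfun - C"
  have B: "blinfun_apply B v = m *\<^sub>R v - blinfun_apply C v" for v
    by (simp add: B_def blinfun.diff_left blinfun.scaleR_left)
  have pos: "positive_op B"
    unfolding positive_op_def Re_cinner
    using le by (auto simp: B_def self_adjoint_diff self_adjoint_scaleR self_adjoint_id sa)
      (simp add: blinfun.diff_left blinfun.scaleR_left inner_diff_left power2_norm_eq_inner)
  \<comment> \<open>The estimate below ends in \<open>?x \<le> K * (m - ?x)\<close>; solved for
    \<open>?x\<close> it gives \<open>K * m / (1 + K)\<close>, which is less than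
    \<open>m\<close>.\<close>
  define K where "K = m * (norm T)\<^sup>2 * norm B"
  have K: "K \<ge> 0" using m by (simp add: K_def)
  have "inner (blinfun_apply C v) v \<le> K * m / (1 + K)" if v: "norm v \<le> 1" for v
  proof -
    let ?x = "inner (blinfun_apply C v) v"
    have "(norm v)\<^sup>2 \<le> 1" using v by (simp add: power_le_one)
    have "norm v = norm (blinfun_apply T (blinfun_apply B v))"
      using T[of v] by (metis B blinfun.minus_right minus_diff_eq norm_minus_cancel)
    then have "(norm v)\<^sup>2 \<le> (norm T * norm (blinfun_apply B v))\<^sup>2"
      by (metis norm_blinfun norm_ge_zero power_mono)
    also have "\<dots> \<le> (norm T)\<^sup>2 * (norm B * inner (blinfun_apply B v) v)"
      using positive_op_norm_le[OF pos, of v] by (simp add: power_mult_distrib mult_left_mono)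
    also have "\<dots> \<le> (norm T)\<^sup>2 * (norm B * (m - ?x))"
      using \<open>(norm v)\<^sup>2 \<le> 1\<close> m
      by (intro mult_left_mono) (auto simp: B inner_diff_left power2_norm_eq_inner)
    finally have "m * (norm v)\<^sup>2 \<le> m * ((norm T)\<^sup>2 * (norm B * (m - ?x)))"
      using m by simp
    then have "?x \<le> K * (m - ?x)" using le[of v] by (simp add: K_def mult.assoc)
    then show ?thesis using K by (simp add: field_simps)
  qed
  then have "m \<le> K * m / (1 + K)" by (rule least)
  then show False using K m by (simp add: field_simps)
qed

lemma lambda_max_properties:
  fixes C :: "'a \<Rightarrow>\<^sub>L 'a"
  assumes C: "C \<in> compact_sa"
  shows "0 \<le> lambda_max C \<and> (\<forall>v. inner (blinfun_apply C v) v \<le> lambda_max C * (norm v)\<^sup>2) \<and>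
    (\<forall>r\<ge>0. (\<forall>v. inner (blinfun_apply C v) v \<le> r * (norm v)\<^sup>2) \<longrightarrow> lambda_max C \<le> r)"
proof -
  have sa: "self_adjoint C" using C by (simp add: compact_sa_iff)
  define q where "q v = inner (blinfun_apply C v) v" for v
  \<comment> \<open>The ball in place of the sphere: the vector \<open>0\<close> forces
    \<open>m \<ge> 0\<close>, in accordance with \<open>0\<close> being a spectral value.\<close>
  define m where "m = (SUP v\<in>cball 0 1. q v)"
  have "q v \<le> norm C" if "norm v \<le> 1" for v
  proof -
    have "q v \<le> norm (blinfun_apply C v) * norm v" unfolding q_def by (rule norm_cauchy_schwarz)
    also have "\<dots> \<le> (norm C * norm v) * norm v" by (intro mult_right_mono norm_blinfun) simp
    also have "\<dots> \<le> (norm C * 1) * 1" by (intro mult_mono that) auto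
    finally show ?thesis by simp
  qed
  then have bdd: "bdd_above (q ` cball 0 1)" by (intro bdd_aboveI2[of _ _ "norm C"]) auto
  have unit: "q v \<le> m" if "norm v \<le> 1" for v
    unfolding m_def using that by (intro cSUP_upper bdd) auto
  have m0: "m \<ge> 0" using unit[of 0] by (simp add: q_def)
  have least: "m \<le> b" if "\<And>v. norm v \<le> 1 \<Longrightarrow> q v \<le> b" for b
    unfolding m_def using that by (intro cSUP_least) auto
  have le: "q v \<le> m * (norm v)\<^sup>2" for v
  proof (cases "v = 0")
    case False
    have "q v = (norm v)\<^sup>2 * q (v /\<^sub>R norm v)"
      using False by (simp add: q_def blinfun.scaleR_right power2_eq_square field_simps)
    also have "\<dots> \<le> (norm v)\<^sup>2 * m" using False by (intro mult_left_mono unit) auto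
    finally show ?thesis by (simp add: mult.commute)
  qed (simp add: q_def)
  have "complex_of_real m \<in> spectrum_op C"
  proof (cases "m = 0")
    case True
    then show ?thesis using zero_in_spectrum[OF C] by simp
  next
    case False
    then show ?thesis
      using form_sup_in_spectrum[OF sa, of m] m0 le least by (simp add: q_def)
  qed
  then have eq: "lambda_max C = m"
    unfolding lambda_max_def
    using spectrum_upper_bound[of C m] le by (intro Greatest_equality) (auto simp: q_def)
  have "m \<le> r" if r: "r \<ge> 0" and ub: "\<And>v. q v \<le> r * (norm v)\<^sup>2" for r
  proof (rule least)
    fix v :: 'a assume "norm v \<le> 1"
    then have "(norm v)\<^sup>2 \<le> 1" by (simp add: power_le_one)
    then show "q v \<le> r" using ub[of v] mult_left_mono[of "(norm v)\<^sup>2" 1 r] r by simp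
  qed
  then show ?thesis using eq m0 le by (simp add: q_def)
qed

lemma
  fixes C :: "'a \<Rightarrow>\<^sub>L 'a"
  assumes "C \<in> compact_sa"
  shows lambda_max_nonneg: "0 \<le> lambda_max C"
    and form_le_lambda_max: "inner (blinfun_apply C v) v \<le> lambda_max C * (norm v)\<^sup>2"
  using lambda_max_properties[OF assms] by blast+

lemma lambda_max_least:
  fixes C :: "'a \<Rightarrow>\<^sub>L 'a"
  shows "C \<in> compact_sa \<Longrightarrow> 0 \<le> r \<Longrightarrow> (\<And>v. inner (blinfun_apply C v) v \<le> r * (norm v)\<^sup>2) \<Longrightarrow> lambda_max
      C \<le> r"
  using lambda_max_properties by blast

end

section \<open>The dual of the space of null sequences\<close>

lemma norm_c0_le: "(\<And>k. \<bar>c0_nth y k\<bar> \<le> b) \<Longrightarrow> norm y \<le> b"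
  unfolding norm_c0_def by (rule cSUP_least) auto

definition c0_trunc :: "nat \<Rightarrow> (nat \<Rightarrow> real) \<Rightarrow> c0" where
  "c0_trunc N a = Abs_c0 (\<lambda>i. if i < N then a i else 0)"

lemma c0_nth_trunc: "c0_nth (c0_trunc N a) i = (if i < N then a i else 0)"
proof -
  have "(\<lambda>i. if i < N then a i else 0) \<longlonglongrightarrow> 0"
    by (rule tendsto_eventually) (auto simp: eventually_sequentially intro!: exI[of _ N])
  then show ?thesis by (simp add: c0_trunc_def Abs_c0_inverse)
qed

lemma c0_trunc_tendsto: "(\<lambda>N. c0_trunc N (c0_nth y)) \<longlonglongrightarrow> y"
proof (rule LIMSEQ_I)
  fix r :: real assume "r > 0"
  then have "r/2 > 0" by simp
  obtain M where M: "\<And>k. k \<ge> M \<Longrightarrow> \<bar>c0_nth y k\<bar> < r/2"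
    using LIMSEQ_D[OF c0_nth_tendsto[of y] \<open>r/2 > 0\<close>] by auto
  have "norm (c0_trunc N (c0_nth y) - y) < r" if "N \<ge> M" for N
  proof -
    have "norm (c0_trunc N (c0_nth y) - y) \<le> r/2"
    proof (rule norm_c0_le)
      show "\<bar>c0_nth (c0_trunc N (c0_nth y) - y) k\<bar> \<le> r/2" for k
        using M[of k] that \<open>r > 0\<close> by (auto simp: minus_c0.rep_eq c0_nth_trunc)
    qed
    then show ?thesis using \<open>r > 0\<close> by simp
  qed
  then show "\<exists>M. \<forall>N\<ge>M. norm (c0_trunc N (c0_nth y) - y) < r" by blast
qed

text \<open>Truncated sign sequences have norm at most \<open>1\<close>, and \<open>f\<close> maps
  them to the partial sums of \<open>\<bar>d k\<bar>\<close>, which are therefore bounded by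
  \<open>norm f\<close>. Density of truncations does the rest.\<close>

lemma c0_dual:
  fixes f :: "c0 \<Rightarrow>\<^sub>L real"
  obtains d where "summable (\<lambda>k. \<bar>d k\<bar>)" "f = ell1_functional d"
proof -
  define d where "d k = blinfun_apply f (Abs_c0 (\<lambda>i. if i = k then 1 else 0))" for k
  have trunc: "blinfun_apply f (c0_trunc N a) = (\<Sum>k<N. d k * a k)" for N a
  proof (induction N)
    case 0
    have "c0_trunc 0 a = 0" by (rule c0_eqI) (simp add: c0_nth_trunc zero_c0.rep_eq)
    then show ?case by simp
  next
    case (Suc N)
    have "(\<lambda>i. if i = N then 1 else 0 :: real) \<longlonglongrightarrow> 0"
      by (rule tendsto_eventually) (auto simp: eventually_sequentially intro!: exI[of _ "Suc N"])
    then have "c0_trunc (Suc N) a = c0_trunc N a + a N *\<^sub>R Abs_c0 (\<lambda>i. if i = N then 1 else 0)"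
      by (intro c0_eqI)
        (auto simp: c0_nth_trunc plus_c0.rep_eq scaleR_c0.rep_eq Abs_c0_inverse less_Suc_eq)
    then show ?case
      by (simp add: Suc blinfun.add_right blinfun.scaleR_right d_def mult.commute)
  qed
  have "(\<Sum>k<N. \<bar>d k\<bar>) \<le> norm f" for N
  proof -
    have "(\<Sum>k<N. \<bar>d k\<bar>) = blinfun_apply f (c0_trunc N (\<lambda>k. sgn (d k)))"
      unfolding trunc by (simp add: abs_sgn)
    also have "\<dots> \<le> norm f * norm (c0_trunc N (\<lambda>k. sgn (d k)))"
      using norm_blinfun[of f "c0_trunc N (\<lambda>k. sgn (d k))"] by simp
    also have "\<dots> \<le> norm f * 1"
      by (intro mult_left_mono norm_c0_le) (auto simp: c0_nth_trunc abs_sgn_eq)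
    finally show ?thesis by simp
  qed
  then have summable: "summable (\<lambda>k. \<bar>d k\<bar>)"
    by (intro summableI_nonneg_bounded) auto
  moreover have "f = ell1_functional d"
  proof (rule blinfun_eqI)
    fix y
    have "(\<lambda>N. blinfun_apply f (c0_trunc N (c0_nth y))) \<longlonglongrightarrow> blinfun_apply f y"
      by (intro blinfun.tendsto tendsto_const c0_trunc_tendsto)
    then have "(\<lambda>k. d k * c0_nth y k) sums blinfun_apply f y"
      by (simp add: trunc sums_def)
    then show "blinfun_apply f y = blinfun_apply (ell1_functional d) y"
      by (simp add: ell1_functional_apply[OF summable] sums_iff)
  qed
  ultimately show thesis by (rule that)
qed

context onb
begin

section \<open>Diagonal operators\<close>

lemma norm_sum_e:
  assumes "finite I"
  shows "(norm (\<Sum>k\<in>I. cscale (a k) (e k)))\<^sup>2 = (\<Sum>k\<in>I. (cmod (a k))\<^sup>2)"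
proof -
  let ?s = "\<Sum>k\<in>I. cscale (a k) (e k)"
  have "complex_of_real ((norm ?s)\<^sup>2) = cinner ?s ?s" by (simp add: cinner_self)
  also have "\<dots> = (\<Sum>k\<in>I. \<Sum>l\<in>I. a k * (cnj (a l) * (if k = l then 1 else 0)))"
    by (subst cinner.sum_left, rule sum.cong[OF refl], subst cinner.sum_right)
      (auto simp: cinner_cscale_left cinner_cscale_right cinner_e intro!: sum.cong)
  also have "\<dots> = (\<Sum>k\<in>I. a k * cnj (a k))"
    using assms by (intro sum.cong refl) (simp add: if_distrib[of "\<lambda>z. _ * z"] cong: if_cong)
  also have "\<dots> = complex_of_real (\<Sum>k\<in>I. (cmod (a k))\<^sup>2)"
    by (simp only: complex_norm_square of_real_sum)
  finally show ?thesis by (simp only: of_real_eq_iff)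
qed

text \<open>By orthogonality a block of a diagonal operator is no larger than its entries; null
  sequences therefore give series that are Cauchy in operator norm.\<close>

lemma norm_diag_block_le:
  assumes b: "b \<ge> 0" and le: "\<And>k. m \<le> k \<Longrightarrow> \<bar>y k\<bar> \<le> b"
  shows "norm (\<Sum>k=m..<n. y k *\<^sub>R outer (e k) (e k)) \<le> b"
proof (rule norm_blinfun_bound[OF b])
  fix v
  let ?D = "\<Sum>k=m..<n. y k *\<^sub>R outer (e k) (e k)"
  have "blinfun_apply ?D v = (\<Sum>k=m..<n. cscale (complex_of_real (y k) * cinner v (e k)) (e k))"
    by (simp add: blinfun.sum_left blinfun.scaleR_left outer_apply cscale_cscale flip:
        cscale_of_real)
  then have "(norm (blinfun_apply ?D v))\<^sup>2
      = (\<Sum>k=m..<n. (cmod (complex_of_real (y k) * cinner v (e k)))\<^sup>2)"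
    by (simp only: norm_sum_e[OF finite_atLeastLessThan])
  also have "\<dots> \<le> (\<Sum>k=m..<n. b\<^sup>2 * (cmod (cinner v (e k)))\<^sup>2)"
    by (intro sum_mono) (use le b in \<open>auto simp: norm_mult power_mult_distrib simp flip:
        abs_le_square_iff intro!: mult_right_mono\<close>)
  also have "\<dots> = b\<^sup>2 * (\<Sum>k=m..<n. (cmod (cinner v (e k)))\<^sup>2)" by (simp add: sum_distrib_left)
  also have "\<dots> \<le> b\<^sup>2 * (norm v)\<^sup>2"
  proof (rule mult_left_mono)
    have "(\<Sum>k=m..<n. (cmod (cinner v (e k)))\<^sup>2) \<le> (\<Sum>k<n. (cmod (cinner v (e k)))\<^sup>2)"
      by (rule sum_mono2) auto
    then show "(\<Sum>k=m..<n. (cmod (cinner v (e k)))\<^sup>2) \<le> (norm v)\<^sup>2"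
      using bessel[of v n] by linarith
  qed simp
  finally have "(norm (blinfun_apply ?D v))\<^sup>2 \<le> (b * norm v)\<^sup>2" by (simp add: power_mult_distrib)
  then show "norm (blinfun_apply ?D v) \<le> b * norm v"
    using b by (elim power2_le_imp_le) simp
qed

lemma diag_op_sums: "(\<lambda>k. c0_nth y k *\<^sub>R outer (e k) (e k)) sums diag_op e y"
proof -
  have "summable (\<lambda>k. c0_nth y k *\<^sub>R outer (e k) (e k))"
    unfolding summable_Cauchy
  proof (intro allI impI)
    fix r :: real assume "r > 0"
    then have "r/2 > 0" by simp
    obtain M where M: "\<And>k. k \<ge> M \<Longrightarrow> \<bar>c0_nth y k\<bar> < r/2"
      using LIMSEQ_D[OF c0_nth_tendsto[of y] \<open>r/2 > 0\<close>] by auto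
    have "norm (\<Sum>k=m..<n. c0_nth y k *\<^sub>R outer (e k) (e k)) < r" if "m \<ge> M" for m n
    proof -
      have "norm (\<Sum>k=m..<n. c0_nth y k *\<^sub>R outer (e k) (e k)) \<le> r/2"
        using M that \<open>r > 0\<close> by (intro norm_diag_block_le) (auto intro: less_imp_le)
      then show ?thesis using \<open>r > 0\<close> by simp
    qed
    then show "\<exists>N. \<forall>m\<ge>N. \<forall>n. norm (\<Sum>k=m..<n. c0_nth y k *\<^sub>R outer (e k) (e k)) < r" by blast
  qed
  then show ?thesis unfolding diag_op_def by (rule summable_sums)
qed

lemma diag_op_compact: "diag_op e y \<in> compact_sa"
  using diag_op_sums[of y] unfolding sums_def
  by (rule compact_sa_lim[rotated]) (intro compact_sa_sum compact_sa_scaleR compact_sa_outer)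

lemma diag_op_apply_sums: "(\<lambda>k. c0_nth y k *\<^sub>R cscale (cinner v (e k)) (e k)) sums blinfun_apply
    (diag_op e y) v"
  using bounded_linear.sums[OF blinfun.bounded_linear_left[of v] diag_op_sums[of y]]
  by (simp add: blinfun.scaleR_left outer_apply)

lemma diag_op_e: "blinfun_apply (diag_op e y) (e j) = c0_nth y j *\<^sub>R e j"
proof -
  have "(\<lambda>k. c0_nth y k *\<^sub>R cscale (cinner (e j) (e k)) (e k)) = (\<lambda>k. if k = j then c0_nth y k *\<^sub>R
      e k else 0)"
    by (auto simp: cinner_e cscale.zero_left)
  then show ?thesis
    using diag_op_apply_sums[of y "e j"] sums_single[of j "\<lambda>k. c0_nth y k *\<^sub>R e k"]
    by (metis sums_unique2)
qed

lemma diag_op_form_sums: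
  "(\<lambda>k. c0_nth y k * (cmod (cinner v (e k)))\<^sup>2) sums inner (blinfun_apply (diag_op e y) v) v"
proof -
  have "(\<lambda>k. inner (c0_nth y k *\<^sub>R cscale (cinner v (e k)) (e k)) v) sums inner (blinfun_apply
      (diag_op e y) v) v"
    by (rule bounded_linear.sums[OF bounded_linear_inner_left diag_op_apply_sums])
  then show ?thesis by (simp add: inner_cscale_left cinner_mult_commute)
qed

lemma diag_op_diff: "diag_op e (y - z) = diag_op e y - diag_op e z"
  using sums_diff[OF diag_op_sums[of y] diag_op_sums[of z]] diag_op_sums[of "y - z"]
  by (simp add: minus_c0.rep_eq sums_unique2 flip: scaleR_diff_left)

lemma diag_op_scaleR: "diag_op e (r *\<^sub>R y) = r *\<^sub>R diag_op e y"
  using bounded_linear.sums[OF bounded_linear_scaleR_right[of r] diag_op_sums[of y]]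
      diag_op_sums[of "r *\<^sub>R y"]
  by (simp add: scaleR_c0.rep_eq sums_unique2)

section \<open>Substates\<close>

definition substates :: "('a \<Rightarrow>\<^sub>L 'a) set" where
  "substates = closure (convex hull {outer w w | w. norm w \<le> 1})"

lemma outer_in_substates: "norm w \<le> 1 \<Longrightarrow> outer w w \<in> substates"
  unfolding substates_def by (rule subsetD[OF closure_subset], rule hull_inc) auto

lemma convex_substates: "convex substates"
  by (simp add: substates_def convex_closure)

text \<open>The induction principle for substates: a closed convex condition is checked on rank one
  operators.\<close>

lemma substates_subset:
  assumes "closed X" "convex X" "\<And>w. norm w \<le> 1 \<Longrightarrow> outer w w \<in> X"
  shows "substates \<subseteq> X"
  unfolding substates_def
  by (intro closure_minimal hull_minimal) (use assms in auto)

lemma substates_positive: "T \<in> substates \<Longrightarrow> positive_op T"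
  using substates_subset[OF positive_op_closed positive_op_convex] positive_outer by blast

lemma substates_norm:
  assumes "T \<in> substates"
  shows "norm T \<le> 1"
proof -
  have "norm (outer w w) \<le> 1" if w: "norm w \<le> 1" for w :: 'a
  proof (rule norm_blinfun_bound)
    fix v :: 'a
    have "norm (blinfun_apply (outer w w) v) \<le> (norm v * norm w) * norm w"
      using mult_right_mono[OF cmod_cinner_le[of v w], of "norm w"] by (simp add: outer_apply
          norm_cscale)
    also have "\<dots> \<le> (norm v * 1) * 1" using w by (intro mult_mono) auto
    finally show "norm (blinfun_apply (outer w w) v) \<le> 1 * norm v" by simp
  qed simp
  then show ?thesis using substates_subset[of "cball 0 1"] assms by auto
qed

text \<open>The sum is a segment of the trace of \<open>C o\<^sub>L T o\<^sub>L C\<close> and is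
  linear in \<open>T\<close>. For \<open>T = outer w w\<close> it consists of squared coefficients
  of \<open>C w\<close> beyond \<open>N\<close>.\<close>

lemma substates_form_tail:
  fixes C :: "'a \<Rightarrow>\<^sub>L 'a"
  assumes sa: "self_adjoint C" and \<tau>: "\<And>v. norm (blinfun_apply C v - blinfun_apply (proj N)
      (blinfun_apply C v)) \<le> \<tau> * norm v"
    and T: "T \<in> substates"
  shows "(\<Sum>k=N..<M. inner (blinfun_apply T (blinfun_apply C (e k))) (blinfun_apply C (e k))) \<le> \<tau>\<^sup>2"
proof -
  let ?f = "\<lambda>T. \<Sum>k=N..<M. inner (blinfun_apply T (blinfun_apply C (e k))) (blinfun_apply C (e k))"
  have "substates \<subseteq> {T. ?f T \<le> \<tau>\<^sup>2}"
  proof (rule substates_subset)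
    show "closed {T. ?f T \<le> \<tau>\<^sup>2}" by (intro closed_Collect_le continuous_intros)
    have lin: "?f (u *\<^sub>R x + v *\<^sub>R y) = u * ?f x + v * ?f y" for u v x y
      by (simp add: blinfun.add_left blinfun.scaleR_left inner_add_left sum.distrib
          sum_distrib_left)
    show "convex {T. ?f T \<le> \<tau>\<^sup>2}"
      by (rule convexI) (simp only: mem_Collect_eq lin convex_bound_le)
    fix w :: 'a assume w: "norm w \<le> 1"
    have "?f (outer w w) = (\<Sum>k=N..<M. (cmod (cinner (blinfun_apply C w) (e k)))\<^sup>2)"
      unfolding inner_outer_self
      by (intro sum.cong refl) (metis cinner_commute complex_mod_cnj self_adjointD(2)[OF sa])
    also have "\<dots> \<le> (norm (blinfun_apply C w - blinfun_apply (proj N) (blinfun_apply C w)))\<^sup>2"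
      by (rule bessel_tail)
    also have "\<dots> \<le> (\<tau> * norm w)\<^sup>2" by (intro power_mono \<tau>) simp
    also have "\<dots> \<le> \<tau>\<^sup>2"
      using w mult_left_mono[of "(norm w)\<^sup>2" 1 "\<tau>\<^sup>2"] by (simp add: power_mult_distrib power_le_one)
    finally show "outer w w \<in> {T. ?f T \<le> \<tau>\<^sup>2}" by simp
  qed
  then show ?thesis using T by blast
qed

lemma substates_partial_trace:
  assumes "T \<in> substates"
  shows "(\<Sum>k=N..<M. inner (blinfun_apply T (e k)) (e k)) \<le> 1"
proof -
  have "(norm (v - blinfun_apply (proj N) v)) \<le> 1 * norm v" for v
    using norm_minus_proj_le[of v N] by simp
  then show ?thesis
    using substates_form_tail[OF self_adjoint_id _ assms, of N 1 M] by simp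
qed

text \<open>Cauchy-Schwarz for the form of \<open>T\<close>, then for sums, splits the trace into
  the tail of \<open>substates_form_tail\<close> and a partial trace of \<open>T\<close>, which is
  at most \<open>1\<close>. The bound is uniform over substates.\<close>

lemma substates_trace_tail:
  fixes C :: "'a \<Rightarrow>\<^sub>L 'a"
  assumes sa: "self_adjoint C" and \<tau>: "\<And>v. norm (blinfun_apply C v - blinfun_apply (proj N)
      (blinfun_apply C v)) \<le> \<tau> * norm v"
    and "\<tau> \<ge> 0" and T: "T \<in> substates"
  shows "(\<Sum>k=N..<M. cmod (cinner (blinfun_apply T (blinfun_apply C (e k))) (e k))) \<le> \<tau>"
proof -
  note pos = substates_positive[OF T]
  define a where "a k = sqrt (inner (blinfun_apply T (blinfun_apply C (e k))) (blinfun_apply C (e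
      k)))" for k
  define b where "b k = sqrt (inner (blinfun_apply T (e k)) (e k))" for k
  have ab: "cmod (cinner (blinfun_apply T (blinfun_apply C (e k))) (e k)) \<le> a k * b k" for k
    using real_le_rsqrt[OF positive_op_cauchy_schwarz[OF pos, of "blinfun_apply C (e k)" "e k"]]
    by (simp add: a_def b_def real_sqrt_mult)
  have sq: "(a k)\<^sup>2 = inner (blinfun_apply T (blinfun_apply C (e k))) (blinfun_apply C (e k))"
    "(b k)\<^sup>2 = inner (blinfun_apply T (e k)) (e k)" for k
    by (simp_all add: a_def b_def positive_opD(2)[OF pos])
  have "(\<Sum>k=N..<M. a k * b k)\<^sup>2 \<le> (\<Sum>k=N..<M. (a k)\<^sup>2) * (\<Sum>k=N..<M. (b k)\<^sup>2)"
    by (rule Cauchy_Schwarz_ineq_sum)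
  also have "\<dots> \<le> \<tau>\<^sup>2 * 1"
    unfolding sq by (intro mult_mono substates_form_tail[OF sa \<tau> T] substates_partial_trace[OF T])
      (auto intro!: sum_nonneg positive_opD(2)[OF pos])
  finally have "(\<Sum>k=N..<M. a k * b k)\<^sup>2 \<le> \<tau>\<^sup>2" by simp
  then have "(\<Sum>k=N..<M. a k * b k) \<le> \<tau>"
    using \<open>\<tau> \<ge> 0\<close> by (rule power2_le_imp_le)
  moreover have "(\<Sum>k=N..<M. cmod (cinner (blinfun_apply T (blinfun_apply C (e k))) (e k))) \<le>
      (\<Sum>k=N..<M. a k * b k)"
    by (intro sum_mono ab)
  ultimately show ?thesis by simp
qed

lemma substates_trace_summable:
  fixes C :: "'a \<Rightarrow>\<^sub>L 'a"
  assumes sa: "self_adjoint C" and T: "T \<in> substates"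
  shows "summable (\<lambda>k. cinner (blinfun_apply (T o\<^sub>L C) (e k)) (e k))"
proof (rule summable_norm_cancel, rule summableI_nonneg_bounded)
  fix M
  \<comment> \<open>With \<open>N = 0\<close> the whole sum counts as tail, and the norm of
    \<open>C\<close> serves as its constant.\<close>
  have "(\<Sum>k=0..<M. cmod (cinner (blinfun_apply T (blinfun_apply C (e k))) (e k))) \<le> norm C"
    by (rule substates_trace_tail[OF sa _ _ T])
      (auto intro: order_trans[OF norm_minus_proj_le norm_blinfun])
  then show "(\<Sum>k<M. norm (cinner (blinfun_apply (T o\<^sub>L C) (e k)) (e k))) \<le> norm C"
    by (simp add: lessThan_atLeast0)
qed simp

lemma op_trace_sums:
  fixes C :: "'a \<Rightarrow>\<^sub>L 'a"
  assumes "self_adjoint C" "T \<in> substates"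
  shows "(\<lambda>k. cinner (blinfun_apply (T o\<^sub>L C) (e k)) (e k)) sums op_trace e (T o\<^sub>L C)"
  unfolding op_trace_def by (rule summable_sums[OF substates_trace_summable[OF assms]])

lemma op_trace_outer:
  fixes C :: "'a \<Rightarrow>\<^sub>L 'a"
  assumes "self_adjoint C"
  shows "op_trace e (outer w w o\<^sub>L C) = complex_of_real (inner (blinfun_apply C w) w)"
proof -
  have "(\<lambda>k. cinner w (e k) * cinner (e k) (blinfun_apply C w)) sums cinner w (blinfun_apply C w)"
    by (rule parseval)
  then have "op_trace e (outer w w o\<^sub>L C) = cinner w (blinfun_apply C w)"
    by (simp add: op_trace_def outer_apply cinner_cscale_left self_adjointD(2)[OF assms] sums_iff
        mult.commute)
  also have "\<dots> = cinner (blinfun_apply C w) w" by (simp add: self_adjointD(2)[OF assms])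
  finally show ?thesis by (simp add: self_adjoint_cinner_self[OF assms])
qed

lemma op_trace_combination:
  fixes C :: "'a \<Rightarrow>\<^sub>L 'a"
  assumes "self_adjoint C" "T \<in> substates" "U \<in> substates"
  shows "op_trace e ((r *\<^sub>R T + s *\<^sub>R U) o\<^sub>L C) = r *\<^sub>R op_trace e (T o\<^sub>L C) + s *\<^sub>R op_trace e (U
      o\<^sub>L C)"
  unfolding op_trace_def
  using sums_add[OF sums_scaleR_right[OF op_trace_sums[OF assms(1,2)], of r]
      sums_scaleR_right[OF op_trace_sums[OF assms(1,3)], of s]]
  by (simp add: sums_iff blinfun.add_left blinfun.scaleR_left cinner.add_left cinner.scaleR_left
      op_trace_def)

lemma op_trace_diff:
  fixes B C :: "'a \<Rightarrow>\<^sub>L 'a"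
  assumes "self_adjoint B" "self_adjoint C" "T \<in> substates"
  shows "op_trace e (T o\<^sub>L (B - C)) = op_trace e (T o\<^sub>L B) - op_trace e (T o\<^sub>L C)"
  unfolding op_trace_def
  using sums_diff[OF op_trace_sums[OF assms(1,3)] op_trace_sums[OF assms(2,3)]]
  by (simp add: sums_iff blinfun.diff_left blinfun.diff_right cinner.diff_left op_trace_def)

lemma op_trace_approx:
  fixes C :: "'a \<Rightarrow>\<^sub>L 'a"
  assumes sa: "self_adjoint C" and \<tau>: "\<And>v. norm (blinfun_apply C v - blinfun_apply (proj N)
      (blinfun_apply C v)) \<le> \<tau> * norm v"
    and "\<tau> \<ge> 0" and T: "T \<in> substates"
  shows "cmod (op_trace e (T o\<^sub>L C) - (\<Sum>k<N. cinner (blinfun_apply (T o\<^sub>L C) (e k)) (e k))) \<le> \<tau>"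
proof (rule tendsto_upperbound)
  let ?f = "\<lambda>k. cinner (blinfun_apply (T o\<^sub>L C) (e k)) (e k)"
  show "(\<lambda>M. cmod ((\<Sum>k<M. ?f k) - (\<Sum>k<N. ?f k))) \<longlonglongrightarrow> cmod (op_trace e (T o\<^sub>L C) - (\<Sum>k<N. ?f k))"
    using op_trace_sums[OF sa T] unfolding sums_def by (intro tendsto_norm tendsto_diff
        tendsto_const)
  show "\<forall>\<^sub>F M in sequentially. cmod ((\<Sum>k<M. ?f k) - (\<Sum>k<N. ?f k)) \<le> \<tau>"
    unfolding eventually_sequentially
  proof (intro exI[of _ N] allI impI)
    fix M assume "N \<le> M"
    then have "(\<Sum>k<M. ?f k) - (\<Sum>k<N. ?f k) = (\<Sum>k=N..<M. ?f k)"
      using sum_diff_nat_ivl[of 0 N M ?f] by (simp add: lessThan_atLeast0)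
    also have "cmod \<dots> \<le> (\<Sum>k=N..<M. cmod (?f k))" by (rule norm_sum)
    also have "\<dots> \<le> \<tau>" using substates_trace_tail[OF sa \<tau> \<open>\<tau> \<ge> 0\<close> T] by simp
    finally show "cmod ((\<Sum>k<M. ?f k) - (\<Sum>k<N. ?f k)) \<le> \<tau>" .
  qed
qed simp

text \<open>Finite sections of the trace are norm continuous, and \<open>op_trace_approx\<close>
  bounds the remainder uniformly over substates: an argument with thirds of
  \<open>r\<close>.\<close>

lemma op_trace_tendsto:
  fixes C :: "'a \<Rightarrow>\<^sub>L 'a"
  assumes C: "C \<in> compact_sa" and T: "\<And>n. T n \<in> substates" and lim: "T \<longlonglongrightarrow> U"
  shows "(\<lambda>n. op_trace e (T n o\<^sub>L C)) \<longlonglongrightarrow> op_trace e (U o\<^sub>L C)"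
proof (rule LIMSEQ_I)
  fix r :: real assume "r > 0"
  then have r3: "r/3 > 0" by simp
  have sa: "self_adjoint C" using C by (simp add: compact_sa_iff)
  have "closed substates" by (simp add: substates_def)
  then have U: "U \<in> substates" using T lim by (rule closed_sequentially)
  obtain N where N: "\<And>v. norm (blinfun_apply C v - blinfun_apply (proj N) (blinfun_apply C v)) \<le>
      r/3 * norm v"
    using compact_tail[OF C r3] by blast
  let ?p = "\<lambda>T. \<Sum>k<N. cinner (blinfun_apply (T o\<^sub>L C) (e k)) (e k)"
  have "(\<lambda>n. ?p (T n)) \<longlonglongrightarrow> ?p U"
    by (simp, intro tendsto_sum cinner.tendsto blinfun.tendsto tendsto_const lim)
  then obtain M where M: "\<And>n. n \<ge> M \<Longrightarrow> cmod (?p (T n) - ?p U) < r/3"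
    using LIMSEQ_D[OF _ r3] by blast
  have "cmod (op_trace e (T n o\<^sub>L C) - op_trace e (U o\<^sub>L C)) < r" if "n \<ge> M" for n
  proof -
    have "cmod (op_trace e (T n o\<^sub>L C) - ?p (T n)) \<le> r/3" "cmod (op_trace e (U o\<^sub>L C) - ?p U) \<le> r/3"
      using op_trace_approx[OF sa N _ T[of n]] op_trace_approx[OF sa N _ U] r3 by auto
    moreover have "cmod (x - y) \<le> cmod (x - a) + cmod (a - b) + cmod (y - b)" for x y a b :: complex
      using norm_triangle_ineq[of "x - a" "a - b"] norm_triangle_ineq4[of "x - b" "y - b"] by simp
    from this[of "op_trace e (T n o\<^sub>L C)" "op_trace e (U o\<^sub>L C)" "?p (T n)" "?p U"] calculation
    show ?thesis using M[OF that] by linarith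
  qed
  then show "\<exists>M. \<forall>n\<ge>M. cmod (op_trace e (T n o\<^sub>L C) - op_trace e (U o\<^sub>L C)) < r" by blast
qed

text \<open>On the convex hull this is the quadratic form estimate. It is extended along sequences,
  since \<open>op_trace_tendsto\<close> gives continuity only within
  \<open>substates\<close>.\<close>

lemma op_trace_le_lambda_max:
  fixes C :: "'a \<Rightarrow>\<^sub>L 'a"
  assumes C: "C \<in> compact_sa" and T: "T \<in> substates"
  shows "Re (op_trace e (T o\<^sub>L C)) \<le> lambda_max C"
proof -
  let ?H = "convex hull {outer w w | w :: 'a. norm w \<le> 1}"
  have sa: "self_adjoint C" using C by (simp add: compact_sa_iff)
  have "?H \<subseteq> {T \<in> substates. Re (op_trace e (T o\<^sub>L C)) \<le> lambda_max C}"
  proof (rule hull_minimal)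
    show "convex {T \<in> substates. Re (op_trace e (T o\<^sub>L C)) \<le> lambda_max C}"
      using convexD[OF convex_substates]
      by (intro convexI) (auto simp: op_trace_combination[OF sa] intro: convex_bound_le)
    show "{outer w w | w. norm w \<le> 1} \<subseteq> {T \<in> substates. Re (op_trace e (T o\<^sub>L C)) \<le> lambda_max C}"
    proof clarify
      fix w :: 'a assume w: "norm w \<le> 1"
      have "inner (blinfun_apply C w) w \<le> lambda_max C * (norm w)\<^sup>2" by (rule
          form_le_lambda_max[OF C])
      also have "\<dots> \<le> lambda_max C"
        using w mult_left_mono[of "(norm w)\<^sup>2" 1 "lambda_max C"] lambda_max_nonneg[OF C]
        by (simp add: power_le_one)
      finally show "outer w w \<in> substates \<and> Re (op_trace e (outer w w o\<^sub>L C)) \<le> lambda_max C"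
        using outer_in_substates[OF w] by (simp add: op_trace_outer[OF sa])
    qed
  qed
  moreover obtain U where U: "\<And>n. U n \<in> ?H" "U \<longlonglongrightarrow> T"
    using T unfolding substates_def closure_sequential by auto
  ultimately have "\<And>n. U n \<in> substates" "\<And>n. Re (op_trace e (U n o\<^sub>L C)) \<le> lambda_max C" by auto
  then show ?thesis
    using tendsto_Re[OF op_trace_tendsto[OF C _ U(2)]] LIMSEQ_le_const2 by blast
qed

lemma substates_diag_summable:
  assumes "T \<in> substates"
  shows "summable (\<lambda>k. \<bar>diag_seq e T k\<bar>)"
proof (rule summableI_nonneg_bounded)
  show "(\<Sum>k<M. \<bar>diag_seq e T k\<bar>) \<le> 1" for M
    using substates_partial_trace[OF assms, of 0 M] positive_opD(2)[OF substates_positive[OF assms]]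
    by (simp add: diag_seq_def lessThan_atLeast0)
qed simp

lemma substate_in_subdiff:
  fixes C :: "'a \<Rightarrow>\<^sub>L 'a"
  assumes C: "C \<in> compact_sa" and T: "T \<in> substates" and ge: "lambda_max C \<le> Re (op_trace e (T o\<^sub>L
      C))"
  shows "T \<in> subdiff_lambda_max e C"
proof -
  note pos = substates_positive[OF T]
  \<comment> \<open>Being positive, \<open>T\<close> is its own modulus.\<close>
  have "T \<in> trace_class_sa e"
    using pos positive_opD[OF pos] substates_diag_summable[OF T]
    by (auto simp: trace_class_sa_def diag_seq_def)
  moreover have "Re (op_trace e (T o\<^sub>L (B - C))) \<le> lambda_max B - lambda_max C" if B: "B \<in>
      compact_sa" for B
    using op_trace_le_lambda_max[OF B T] ge B C
    by (simp add: op_trace_diff[OF _ _ T] compact_sa_iff)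
  ultimately show ?thesis by (simp add: subdiff_lambda_max_def)
qed

section \<open>Hilbert-Schmidt norm of substates\<close>

definition hs_square :: "('a \<Rightarrow>\<^sub>L 'a) \<Rightarrow> real" where
  "hs_square D = (\<Sum>k. (norm (blinfun_apply D (e k)))\<^sup>2)"

text \<open>Since \<open>norm T \<le> 1\<close>, \<open>positive_op_norm_le\<close> bounds each
  summand by a diagonal entry of \<open>T\<close>.\<close>

lemma substates_hs_partial:
  assumes "T \<in> substates"
  shows "(\<Sum>k<M. (norm (blinfun_apply T (e k)))\<^sup>2) \<le> 1"
proof -
  note pos = substates_positive[OF assms]
  have "(norm (blinfun_apply T (e k)))\<^sup>2 \<le> inner (blinfun_apply T (e k)) (e k)" for k
    using positive_op_norm_le[OF pos, of "e k"] positive_opD(2)[OF pos, of "e k"]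
      mult_right_mono[OF substates_norm[OF assms], of "inner (blinfun_apply T (e k)) (e k)"] by simp
  then have "(\<Sum>k<M. (norm (blinfun_apply T (e k)))\<^sup>2) \<le> (\<Sum>k<M. inner (blinfun_apply T (e k)) (e k))"
    by (rule sum_mono)
  then show ?thesis using substates_partial_trace[OF assms, of 0 M] by (simp add: lessThan_atLeast0)
qed

lemma substates_hs_summable: "T \<in> substates \<Longrightarrow> summable (\<lambda>k. (norm (blinfun_apply T (e k)))\<^sup>2)"
  using substates_hs_partial by (intro summableI_nonneg_bounded) auto

text \<open>Parseval for \<open>D v\<close>, with each coefficient moved onto \<open>D (e k)\<close>
  by self-adjointness. It turns Hilbert-Schmidt Cauchy sequences into norm Cauchy ones.\<close>

lemma norm_le_hs:
  assumes sa: "self_adjoint D" and summable: "summable (\<lambda>k. (norm (blinfun_apply D (e k)))\<^sup>2)"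
  shows "(norm D)\<^sup>2 \<le> hs_square D"
proof -
  have nonneg: "0 \<le> hs_square D" unfolding hs_square_def by (intro suminf_nonneg summable) simp
  have "norm D \<le> sqrt (hs_square D)"
  proof (rule norm_blinfun_bound)
    fix v :: 'a
    have "(norm (blinfun_apply D v))\<^sup>2 \<le> hs_square D * (norm v)\<^sup>2"
    proof (rule sums_le)
      show "(\<lambda>k. (cmod (cinner (blinfun_apply D v) (e k)))\<^sup>2) sums (norm (blinfun_apply D v))\<^sup>2"
        by (rule parseval_norm)
      show "(\<lambda>k. (norm (blinfun_apply D (e k)))\<^sup>2 * (norm v)\<^sup>2) sums (hs_square D * (norm v)\<^sup>2)"
        unfolding hs_square_def by (intro sums_mult2 summable_sums summable)
      show "(cmod (cinner (blinfun_apply D v) (e k)))\<^sup>2 \<le> (norm (blinfun_apply D (e k)))\<^sup>2 * (norm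
          v)\<^sup>2" for k
        using power_mono[OF cmod_cinner_le[of v "blinfun_apply D (e k)"], of 2]
        by (simp add: self_adjointD(2)[OF sa] power_mult_distrib mult.commute)
    qed
    then have "(norm (blinfun_apply D v))\<^sup>2 \<le> (sqrt (hs_square D) * norm v)\<^sup>2"
      using nonneg by (simp add: power_mult_distrib)
    then show "norm (blinfun_apply D v) \<le> sqrt (hs_square D) * norm v"
      using nonneg by (elim power2_le_imp_le) simp
  qed (simp add: nonneg)
  then have "(norm D)\<^sup>2 \<le> (sqrt (hs_square D))\<^sup>2" by (intro power_mono) auto
  then show ?thesis using nonneg by simp
qed

end

section \<open>Closest points\<close>

text \<open>The infima of \<open>Q\<close> over the shrinking sets increase to a limit. The midpoint
  of two late near-minimisers cannot fall below an earlier infimum, so the parallelogram law leaves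
  little room for their difference. \<open>Q\<close> is abstract because it stands both for the
  squared norm on a fixed set and for \<open>hs_square\<close> on nested sets.\<close>

lemma parallelogram_sequence:
  fixes Q :: "'v::real_vector \<Rightarrow> real" and L :: "nat \<Rightarrow> 'v set"
  assumes convex: "\<And>n. convex (L n)" and dec: "\<And>m n. m \<le> n \<Longrightarrow> L n \<subseteq> L m"
    and nonneg: "\<And>a. a \<in> L 0 \<Longrightarrow> 0 \<le> Q a"
    and parallelogram: "\<And>a b. a \<in> L 0 \<Longrightarrow> b \<in> L 0 \<Longrightarrow> Q (a - b) + 4 * Q ((1/2) *\<^sub>R (a + b)) = 2 * Q a
        + 2 * Q b"
    and bound: "\<And>n. \<exists>a\<in>L n. Q a \<le> c"
  obtains T where "\<And>n. T n \<in> L n" "\<And>n. Q (T n) \<le> Inf (Q ` L n) + 1 / real (Suc n)"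
    "\<And>\<epsilon>. \<epsilon> > 0 \<Longrightarrow> \<exists>N. \<forall>m\<ge>N. \<forall>n\<ge>N. Q (T m - T n) < \<epsilon>"
proof -
  define d where "d n = Inf (Q ` L n)" for n
  have sub0: "L n \<subseteq> L 0" for n by (rule dec) simp
  have bdd: "bdd_below (Q ` L n)" for n
    using nonneg sub0[of n] by (intro bdd_belowI[of _ 0]) auto
  have ne: "L n \<noteq> {}" for n using bound[of n] by auto
  have d_le: "d n \<le> Q a" if "a \<in> L n" for a n
    unfolding d_def using that bdd by (intro cInf_lower) auto
  have d_mono: "d m \<le> d n" if "m \<le> n" for m n
    unfolding d_def using ne dec[OF that] bdd by (intro cInf_superset_mono) auto
  have "d n \<le> c" for n using bound[of n] d_le[of _ n] by force
  then obtain l where l: "d \<longlonglongrightarrow> l" "\<And>n. d n \<le> l"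
    using incseq_convergent[of d c] d_mono by (auto simp: incseq_def)
  have "\<exists>a\<in>L n. Q a < d n + 1 / real (Suc n)" for n
    using cInf_lessD[of "Q ` L n" "d n + 1 / real (Suc n)"] ne[of n] by (auto simp: d_def)
  then obtain T where T: "\<And>n. T n \<in> L n" "\<And>n. Q (T n) < d n + 1 / real (Suc n)" by metis
  \<comment> \<open>The midpoint lies in \<open>L N\<close>, so its value is at least
    \<open>d N\<close>, while \<open>Q (T m)\<close> and \<open>Q (T n)\<close> are below
    \<open>l + 1 / real (Suc N)\<close>.\<close>
  have close: "Q (T m - T n) \<le> 4 * (l - d N) + 4 * (1 / real (Suc N))" if "m \<ge> N" "n \<ge> N" for m n N
  proof -
    have mem: "T m \<in> L N" "T n \<in> L N" using T dec that by blast+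
    then have "(1/2) *\<^sub>R (T m + T n) \<in> L N"
      using convexD[OF convex mem, of "1/2" "1/2"] by (simp add: scaleR_add_right)
    then have "4 * d N \<le> 4 * Q ((1/2) *\<^sub>R (T m + T n))" using d_le by simp
    moreover have "Q (T m - T n) + 4 * Q ((1/2) *\<^sub>R (T m + T n)) = 2 * Q (T m) + 2 * Q (T n)"
      using parallelogram mem sub0 by blast
    moreover have "1 / real (Suc m) \<le> 1 / real (Suc N)" "1 / real (Suc n) \<le> 1 / real (Suc N)"
      using that by (auto intro!: divide_left_mono)
    moreover define h where "h k = 1 / real (Suc k)" for k
    ultimately show ?thesis
      using T(2)[of m] T(2)[of n] l(2)[of m] l(2)[of n] unfolding h_def[symmetric] by argo
  qed
  have "\<exists>N. \<forall>m\<ge>N. \<forall>n\<ge>N. Q (T m - T n) < \<epsilon>" if "\<epsilon> > 0" for \<epsilon>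
  proof -
    have "(\<lambda>N. 4 * (l - d N) + 4 * (1 / real (Suc N))) \<longlonglongrightarrow> 4 * (l - l) + 4 * 0"
      by (intro tendsto_intros l(1) LIMSEQ_Suc[OF lim_1_over_n])
    then have "\<forall>\<^sub>F N in sequentially. 4 * (l - d N) + 4 * (1 / real (Suc N)) < \<epsilon>"
      using that by (intro order_tendstoD(2)[of _ "4 * (l - l) + 4 * 0"]) auto
    then obtain N where "4 * (l - d N) + 4 * (1 / real (Suc N)) < \<epsilon>"
      by (auto simp: eventually_sequentially simp del: of_nat_Suc)
    then show ?thesis using close by (meson le_less_trans)
  qed
  then show thesis by (rule that[OF T(1) less_imp_le[OF T(2)[unfolded d_def]]])
qed

lemma parallelogram_midpoint:
  fixes a b :: "'b::real_inner"
  shows "(norm (a - b))\<^sup>2 + 4 * (norm ((1/2) *\<^sub>R (a + b)))\<^sup>2 = 2 * (norm a)\<^sup>2 + 2 * (norm b)\<^sup>2"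
proof -
  have "4 * (norm ((1/2) *\<^sub>R (a + b)))\<^sup>2 = (norm (a + b))\<^sup>2" by (simp only: norm_scaleR
      power_mult_distrib) (simp add: power2_eq_square)
  then show ?thesis
    by (simp add: power2_norm_eq_inner inner_add_left inner_add_right inner_diff_left
        inner_diff_right inner_commute)
qed

lemma Cauchy_norm_square:
  fixes T :: "nat \<Rightarrow> 'b::real_normed_vector"
  assumes "\<And>\<epsilon>. \<epsilon> > 0 \<Longrightarrow> \<exists>N. \<forall>m\<ge>N. \<forall>n\<ge>N. (norm (T m - T n))\<^sup>2 < \<epsilon>"
  shows "Cauchy T"
proof (rule CauchyI)
  fix r :: real assume "r > 0"
  then obtain N where "\<forall>m\<ge>N. \<forall>n\<ge>N. (norm (T m - T n))\<^sup>2 < r\<^sup>2" using assms[of "r\<^sup>2"] by auto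
  then show "\<exists>N. \<forall>m\<ge>N. \<forall>n\<ge>N. norm (T m - T n) < r"
    using \<open>r > 0\<close> by (meson power_less_imp_less_base less_imp_le)
qed

text \<open>With all sets equal to \<open>W\<close>, \<open>parallelogram_sequence\<close> yields a
  convergent minimising sequence; the inequality is the variational characterisation of its limit as
  nearest point of the closure.\<close>

lemma closest_point_to_zero:
  fixes W :: "'b::{real_inner,banach} set"
  assumes "convex W" "W \<noteq> {}"
  obtains p where "p \<in> closure W" "\<And>w. w \<in> W \<Longrightarrow> inner p p \<le> inner p w"
proof -
  obtain w0 where w0: "w0 \<in> W" using assms by auto
  obtain T where T: "\<And>n. T n \<in> W"
      "\<And>n. (norm (T n))\<^sup>2 \<le> Inf ((\<lambda>v. (norm v)\<^sup>2) ` W) + 1 / real (Suc n)"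
      "\<And>\<epsilon>. \<epsilon> > 0 \<Longrightarrow> \<exists>N. \<forall>m\<ge>N. \<forall>n\<ge>N. (norm (T m - T n))\<^sup>2 < \<epsilon>"
  proof (rule parallelogram_sequence[of "\<lambda>_. W" "\<lambda>v. (norm v)\<^sup>2" "(norm w0)\<^sup>2"])
    show "(norm (a - b))\<^sup>2 + 4 * (norm ((1/2) *\<^sub>R (a + b)))\<^sup>2 = 2 * (norm a)\<^sup>2 + 2 * (norm b)\<^sup>2"
        for a b :: 'b
      by (rule parallelogram_midpoint)
  qed (use assms w0 in auto)
  obtain p where p: "T \<longlonglongrightarrow> p"
    using Cauchy_norm_square[OF T(3)] Cauchy_convergent_iff convergent_def by blast
  have p_mem: "p \<in> closure W" using T(1) p closure_sequential by blast
  have "(norm p)\<^sup>2 \<le> Inf ((\<lambda>v. (norm v)\<^sup>2) ` W) + 0"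
    by (rule LIMSEQ_le[OF tendsto_power[OF tendsto_norm[OF p]] tendsto_add[OF tendsto_const
        LIMSEQ_Suc[OF lim_1_over_n]]])
      (use T(2) in auto)
  moreover have "Inf ((\<lambda>v. (norm v)\<^sup>2) ` W) \<le> (norm w)\<^sup>2" if "w \<in> W" for w
    by (rule cInf_lower) (use that in \<open>auto intro: bdd_belowI2[of _ 0]\<close>)
  ultimately have le: "(norm p)\<^sup>2 \<le> (norm w)\<^sup>2" if "w \<in> W" for w
    using that by (metis add_0_right order_trans)
  have "norm p \<le> norm w" if "w \<in> W" for w
    using le[OF that] by (rule power2_le_imp_le) simp
  then have "closure W \<subseteq> {z. norm p \<le> norm z}"
    by (intro closure_minimal closed_Collect_le continuous_intros) auto
  then have "inner (0 - p) (w - p) \<le> 0" if "w \<in> W" for w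
    using any_closest_point_dot[OF convex_closure[OF assms(1)] closed_closure p_mem, of w 0] that
      closure_subset[of W] by (auto simp: dist_norm)
  then show thesis using that[OF p_mem] by (simp add: inner_diff_right)
qed

context onb
begin

lemma closed_substates: "closed substates"
  by (simp add: substates_def)

lemma hs_parallelogram:
  assumes "T \<in> substates" "U \<in> substates"
  shows "summable (\<lambda>k. (norm (blinfun_apply (T - U) (e k)))\<^sup>2)"
    and "hs_square (T - U) + 4 * hs_square ((1/2) *\<^sub>R (T + U)) = 2 * hs_square T + 2 * hs_square U"
proof -
  let ?s = "\<lambda>D k. (norm (blinfun_apply D (e k)))\<^sup>2"
  have par: "?s (T - U) k + 4 * ?s ((1/2) *\<^sub>R (T + U)) k = 2 * ?s T k + 2 * ?s U k" for k
    unfolding blinfun.add_left blinfun.diff_left blinfun.scaleR_left by (rule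
        parallelogram_midpoint)
  note sT = substates_hs_summable[OF assms(1)] and sU = substates_hs_summable[OF assms(2)]
  have sum2: "summable (\<lambda>k. 2 * ?s T k + 2 * ?s U k)" by (intro summable_add summable_mult sT sU)
  have "?s (T - U) k \<le> 2 * ?s T k + 2 * ?s U k" "?s ((1/2) *\<^sub>R (T + U)) k \<le> 2 * ?s T k + 2 * ?s U
      k" for k
    using par[of k] zero_le_power2[of "norm (blinfun_apply (T - U) (e k))"]
      zero_le_power2[of "norm (blinfun_apply ((1/2) *\<^sub>R (T + U)) (e k))"] by linarith+
  then have s: "summable (?s (T - U))" "summable (?s ((1/2) *\<^sub>R (T + U)))"
    by (intro summable_comparison_test'[OF sum2, of 0]; simp)+
  then show "summable (?s (T - U))" by simp
  have "(\<lambda>k. ?s (T - U) k + 4 * ?s ((1/2) *\<^sub>R (T + U)) k) sums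
      (hs_square (T - U) + 4 * hs_square ((1/2) *\<^sub>R (T + U)))"
    unfolding hs_square_def by (intro sums_add sums_mult summable_sums s)
  moreover have "(\<lambda>k. 2 * ?s T k + 2 * ?s U k) sums (2 * hs_square T + 2 * hs_square U)"
    unfolding hs_square_def by (intro sums_add sums_mult summable_sums sT sU)
  ultimately show "hs_square (T - U) + 4 * hs_square ((1/2) *\<^sub>R (T + U)) = 2 * hs_square T + 2 *
      hs_square U"
    unfolding par by (rule sums_unique2)
qed

text \<open>\<open>hs_square\<close> is at most \<open>1\<close> on substates, which bounds the
  infima. The limit \<open>U\<close> need not lie in any \<open>L n\<close>, so the members
  \<open>T n\<close> are returned as well and properties pass to \<open>U\<close> along
  them.\<close>

lemma substates_nested:
  assumes L: "\<And>n. L n \<subseteq> substates" "\<And>n. L n \<noteq> {}" "\<And>n. convex (L n)" "\<And>m n. m \<le> n \<Longrightarrow> L n \<subseteq> L m"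
  obtains T U where "\<And>n. T n \<in> L n" "T \<longlonglongrightarrow> U"
proof -
  obtain T where T: "\<And>n. T n \<in> L n" "\<And>\<epsilon>. \<epsilon> > 0 \<Longrightarrow> \<exists>N. \<forall>m\<ge>N. \<forall>n\<ge>N. hs_square (T m - T n) < \<epsilon>"
  proof (rule parallelogram_sequence[of L hs_square 1])
    have "0 \<le> hs_square a \<and> hs_square a \<le> 1" if "a \<in> substates" for a
      unfolding hs_square_def
      using substates_hs_partial[OF that] substates_hs_summable[OF that]
      by (auto intro: suminf_nonneg suminf_le_const)
    then show "0 \<le> hs_square a" if "a \<in> L 0" for a using that L(1) by blast
    show "\<exists>a\<in>L n. hs_square a \<le> 1" for n
      using \<open>\<And>a. a \<in> substates \<Longrightarrow> _\<close> L(1,2)[of n] by blast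
    show "hs_square (a - b) + 4 * hs_square ((1/2) *\<^sub>R (a + b)) = 2 * hs_square a + 2 * hs_square b"
      if "a \<in> L 0" "b \<in> L 0" for a b
      using that L(1)[of 0] by (intro hs_parallelogram) auto
  qed (use L in auto)
  have "(norm (T m - T n))\<^sup>2 \<le> hs_square (T m - T n)" for m n
    using T(1) L(1) by (intro norm_le_hs hs_parallelogram self_adjoint_diff positive_opD(1)[OF
        substates_positive]) blast+
  then have "\<exists>N. \<forall>m\<ge>N. \<forall>n\<ge>N. (norm (T m - T n))\<^sup>2 < \<epsilon>" if "\<epsilon> > 0" for \<epsilon>
    using T(2)[OF that] by (meson le_less_trans)
  then obtain U where "T \<longlonglongrightarrow> U"
    using Cauchy_norm_square Cauchy_convergent_iff convergent_def by blast
  with T(1) show thesis by (rule that)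
qed

section \<open>Subgradients are diagonals\<close>

definition embed :: "(nat \<Rightarrow> real) \<Rightarrow> 'a" where
  "embed d = (\<Sum>k. d k *\<^sub>R e k)"

lemma embed_sums: "summable (\<lambda>k. \<bar>d k\<bar>) \<Longrightarrow> (\<lambda>k. d k *\<^sub>R e k) sums embed d"
  unfolding embed_def by (rule summable_sums, rule summable_norm_cancel) simp

lemma inner_embed_sums:
  assumes "summable (\<lambda>k. \<bar>d k\<bar>)"
  shows "(\<lambda>k. d k * inner p (e k)) sums inner p (embed d)"
  using bounded_linear.sums[OF bounded_linear_inner_right embed_sums[OF assms], of p] by simp

lemma inner_e_embed:
  assumes "summable (\<lambda>k. \<bar>d k\<bar>)"
  shows "inner (e j) (embed d) = d j"
proof -
  have "inner (e j) (e k) = (if k = j then 1 else 0)" for k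
    unfolding Re_cinner[symmetric] cinner_e by simp
  then have "(\<lambda>k. d k * inner (e j) (e k)) = (\<lambda>k. if k = j then d k else 0)" by auto
  then show ?thesis
    using inner_embed_sums[OF assms, of "e j"] sums_single[of j d] by (simp add: sums_unique2)
qed

lemma embed_combination:
  assumes "summable (\<lambda>k. \<bar>a k\<bar>)" "summable (\<lambda>k. \<bar>b k\<bar>)"
  shows "embed (\<lambda>k. r * a k + s * b k) = r *\<^sub>R embed a + s *\<^sub>R embed b"
  unfolding embed_def[of "\<lambda>k. r * a k + s * b k"]
  using sums_add[OF sums_scaleR_right[OF embed_sums[OF assms(1)], of r]
      sums_scaleR_right[OF embed_sums[OF assms(2)], of s]]
  by (simp add: sums_iff scaleR_add_left)

lemma diag_seq_outer: "diag_seq e (outer w w) k = (cmod (cinner w (e k)))\<^sup>2"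
  unfolding diag_seq_def Re_cinner inner_outer_self by (metis cinner_commute complex_mod_cnj)

lemma diag_seq_combination:
  "diag_seq e (r *\<^sub>R T + s *\<^sub>R U) = (\<lambda>k. r * diag_seq e T k + s * diag_seq e U k)"
  by (simp add: diag_seq_def blinfun.add_left blinfun.scaleR_left inner_add_left)

text \<open>If the convex set \<open>W\<close> of defects stayed away from \<open>0\<close>, the point of its closure nearest to \<open>0\<close>
  would be a direction along which \<open>lambda_max\<close> violates the subgradient inequality.\<close>

lemma subgradient_defect_closure:
  fixes C :: "'a \<Rightarrow>\<^sub>L 'a"
  assumes C: "C \<in> compact_sa" and d: "summable (\<lambda>k. \<bar>d k\<bar>)"
    and sub: "\<And>y. lambda_max C + (\<Sum>k. d k * c0_nth y k) \<le> lambda_max (C + diag_op e y)"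
  defines "\<Phi> \<equiv> \<lambda>T. (embed (diag_seq e T) - embed d, Re (op_trace e (T o\<^sub>L C)) - lambda_max C)"
  shows "0 \<in> closure (\<Phi> ` substates)"
    and "\<And>r s T U. T \<in> substates \<Longrightarrow> U \<in> substates \<Longrightarrow> r + s = 1 \<Longrightarrow>
      \<Phi> (r *\<^sub>R T + s *\<^sub>R U) = r *\<^sub>R \<Phi> T + s *\<^sub>R \<Phi> U"
proof -
  have sa: "self_adjoint C" using C by (simp add: compact_sa_iff)
  show affine: "\<Phi> (r *\<^sub>R T + s *\<^sub>R U) = r *\<^sub>R \<Phi> T + s *\<^sub>R \<Phi> U"
    if TU: "T \<in> substates" "U \<in> substates" and rs: "r + s = 1" for r s T U
  proof -
    have "embed d = r *\<^sub>R embed d + s *\<^sub>R embed d" "lambda_max C = r * lambda_max C + s *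
        lambda_max C"
      using rs by (simp_all flip: scaleR_add_left distrib_right)
    then show ?thesis
      using embed_combination[OF substates_diag_summable substates_diag_summable, OF TU, of r s]
      by (simp add: \<Phi>_def diag_seq_combination op_trace_combination[OF sa TU] algebra_simps)
  qed
  let ?W = "\<Phi> ` substates"
  have "convex ?W"
  proof (rule convexI)
    fix a b and u v :: real
    assume "a \<in> ?W" "b \<in> ?W" and uv: "0 \<le> u" "0 \<le> v" "u + v = 1"
    then obtain T U where TU: "T \<in> substates" "U \<in> substates" "a = \<Phi> T" "b = \<Phi> U" by auto
    then have "u *\<^sub>R a + v *\<^sub>R b = \<Phi> (u *\<^sub>R T + v *\<^sub>R U)" by (simp add: affine uv)
    then show "u *\<^sub>R a + v *\<^sub>R b \<in> ?W" using convexD[OF convex_substates TU(1,2) uv] by simp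
  qed
  moreover have "?W \<noteq> {}" using outer_in_substates[of 0] by auto
  ultimately obtain p where p: "p \<in> closure ?W" "\<And>w. w \<in> ?W \<Longrightarrow> inner p p \<le> inner p w"
    by (rule closest_point_to_zero) blast
  have "closure ?W \<subseteq> {z. snd z \<le> 0}"
    by (intro closure_minimal closed_Collect_le continuous_intros)
      (use op_trace_le_lambda_max[OF C] in \<open>auto simp: \<Phi>_def\<close>)
  then have "snd p \<le> 0" using p(1) by auto
  \<comment> \<open>Separating data: \<open>\<alpha>\<close>, which is nonnegative, weights
    \<open>C\<close>, and \<open>y\<close> weights the diagonal; \<open>y\<close> is a null sequence
    because the coefficients of \<open>fst p\<close> are square-summable.\<close>
  define \<alpha> where "\<alpha> = - snd p"
  define \<delta> where "\<delta> = inner p p"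
  define y where "y = Abs_c0 (\<lambda>k. - inner (fst p) (e k))"
  have nth_y: "c0_nth y k = - inner (fst p) (e k)" for k
    using tendsto_minus[OF coefficient_tendsto_zero[of "fst p"]] by (simp add: y_def Abs_c0_inverse)
  define t where "t = (\<Sum>k. d k * c0_nth y k)"
  have t: "inner (fst p) (embed d) = - t"
    using sums_minus[OF inner_embed_sums[OF d, of "fst p"]] by (simp add: t_def nth_y sums_iff)
  \<comment> \<open>What remains when \<open>\<delta> \<le> inner p (\<Phi> (outer w w))\<close> is
    solved for the two quadratic forms in \<open>w\<close>.\<close>
  define r where "r = t + \<alpha> * lambda_max C - \<delta>"
  have unit: "inner (blinfun_apply (diag_op e y) w) w + \<alpha> * inner (blinfun_apply C w) w \<le> r"
    if w: "norm w \<le> 1" for w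
  proof -
    have mem: "outer w w \<in> substates" by (rule outer_in_substates[OF w])
    have "inner (fst p) (embed (diag_seq e (outer w w))) = - inner (blinfun_apply (diag_op e y) w)
        w"
    proof (rule sums_unique2[OF inner_embed_sums[OF substates_diag_summable[OF mem]]])
      show "(\<lambda>k. diag_seq e (outer w w) k * inner (fst p) (e k)) sums - inner (blinfun_apply
          (diag_op e y) w) w"
        using sums_minus[OF diag_op_form_sums[of y w]] by (simp add: nth_y diag_seq_outer
            mult.commute)
    qed
    moreover have "\<delta> \<le> inner p (\<Phi> (outer w w))" unfolding \<delta>_def using p(2) mem by blast
    ultimately show ?thesis
      by (simp add: \<Phi>_def inner_prod_def op_trace_outer[OF sa] inner_diff_right t r_def \<alpha>_def
          algebra_simps)
  qed
  \<comment> \<open>The zero vector is among the admissible \<open>w\<close>;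
    \<open>lambda_max_least\<close> accepts nonnegative bounds only.\<close>
  have r0: "0 \<le> r" using unit[of 0] by simp
  have form: "inner (blinfun_apply (diag_op e y) w) w + \<alpha> * inner (blinfun_apply C w) w \<le> r *
      (norm w)\<^sup>2" for w
  proof (cases "w = 0")
    case False
    let ?u = "w /\<^sub>R norm w"
    have "inner (blinfun_apply (diag_op e y) w) w + \<alpha> * inner (blinfun_apply C w) w
      = (norm w)\<^sup>2 * (inner (blinfun_apply (diag_op e y) ?u) ?u + \<alpha> * inner (blinfun_apply C ?u)
          ?u)"
      using False by (simp add: blinfun.scaleR_right field_simps power2_eq_square)
    also have "\<dots> \<le> (norm w)\<^sup>2 * r" using False by (intro mult_left_mono unit) auto
    finally show ?thesis by (simp add: mult.commute)
  qed simp
  have "\<delta> \<le> 0"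
  proof (cases "\<alpha> = 0")
    case True
    \<comment> \<open>Here \<open>r = t - \<delta>\<close>: adding \<open>diag_op e y\<close> raises
      \<open>lambda_max\<close> by at most \<open>t - \<delta>\<close>, whereas \<open>sub\<close>
      demands at least \<open>t\<close>.\<close>
    have "lambda_max (C + diag_op e y) \<le> lambda_max C + r"
    proof (rule lambda_max_least)
      show "inner (blinfun_apply (C + diag_op e y) v) v \<le> (lambda_max C + r) * (norm v)\<^sup>2" for v
        using form[of v] form_le_lambda_max[OF C, of v] True
        by (simp add: blinfun.add_left inner_add_left algebra_simps)
    qed (auto intro: compact_sa_add C diag_op_compact add_nonneg_nonneg lambda_max_nonneg r0)
    then show ?thesis using sub[of y] True by (simp add: r_def t_def)
  next
    case False
    then have \<alpha>: "\<alpha> > 0" using \<open>snd p \<le> 0\<close> by (simp add: \<alpha>_def)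
    \<comment> \<open>Division by \<open>\<alpha>\<close> gives \<open>C\<close> the coefficient
      \<open>1\<close>. Then \<open>r / \<alpha>\<close> equals
      \<open>lambda_max C + (t - \<delta>) / \<alpha>\<close>, which contradicts \<open>sub\<close>
      unless \<open>\<delta> \<le> 0\<close>.\<close>
    let ?y = "(1 / \<alpha>) *\<^sub>R y"
    have "lambda_max (C + diag_op e ?y) \<le> r / \<alpha>"
    proof (rule lambda_max_least)
      fix v
      show "inner (blinfun_apply (C + diag_op e ?y) v) v \<le> r / \<alpha> * (norm v)\<^sup>2"
        using mult_left_mono[OF form[of v], of \<alpha>] \<alpha>
        by (simp add: diag_op_scaleR blinfun.add_left blinfun.scaleR_left inner_add_left
            field_simps)
    qed (use r0 \<alpha> in \<open>auto intro: compact_sa_add C diag_op_compact\<close>)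
    moreover have "(\<Sum>k. d k * c0_nth ?y k) = t / \<alpha>"
    proof -
      have "(\<lambda>k. d k * c0_nth y k) sums t"
        using sums_minus[OF inner_embed_sums[OF d, of "fst p"]] by (simp add: nth_y t)
      from sums_mult[OF this, of "1 / \<alpha>"] show ?thesis
        by (simp add: scaleR_c0.rep_eq sums_iff mult_ac)
    qed
    ultimately have "lambda_max C + t / \<alpha> \<le> r / \<alpha>" using sub[of ?y] by simp
    then show ?thesis using \<alpha> by (auto simp: r_def field_simps mult_le_0_iff)
  qed
  then have "p = 0" unfolding \<delta>_def by (metis inner_eq_zero_iff inner_ge_zero order_antisym)
  then show "0 \<in> closure ?W" using p(1) by simp
qed

lemma subgradient_is_diagonal:
  fixes C :: "'a \<Rightarrow>\<^sub>L 'a"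
  assumes C: "C \<in> compact_sa" and d: "summable (\<lambda>k. \<bar>d k\<bar>)"
    and sub: "\<And>y. lambda_max C + (\<Sum>k. d k * c0_nth y k) \<le> lambda_max (C + diag_op e y)"
  shows "\<exists>U \<in> subdiff_lambda_max e C. diag_seq e U = d"
proof -
  define \<Phi> where "\<Phi> T = (embed (diag_seq e T) - embed d, Re (op_trace e (T o\<^sub>L C)) - lambda_max
      C)" for T
  have zero: "0 \<in> closure (\<Phi> ` substates)"
    and affine: "\<And>r s T U. T \<in> substates \<Longrightarrow> U \<in> substates \<Longrightarrow> r + s = 1 \<Longrightarrow>
      \<Phi> (r *\<^sub>R T + s *\<^sub>R U) = r *\<^sub>R \<Phi> T + s *\<^sub>R \<Phi> U"
    unfolding \<Phi>_def by (rule subgradient_defect_closure[OF C d sub]; assumption?)+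
  \<comment> \<open>Nonempty because \<open>0\<close> is in the closure of the defects, convex
    because \<open>\<Phi>\<close> is affine, nested because the tolerance decreases.\<close>
  define L where "L n = {T \<in> substates. norm (\<Phi> T) \<le> 1 / real (Suc n)}" for n
  obtain T U where T: "\<And>n. T n \<in> L n" and lim: "T \<longlonglongrightarrow> U"
  proof (rule substates_nested[of L])
    show "L n \<subseteq> substates" for n by (auto simp: L_def)
    show "L n \<noteq> {}" for n
    proof -
      have "\<exists>z\<in>\<Phi> ` substates. dist z 0 < 1 / real (Suc n)"
        using zero closure_approachable[of 0 "\<Phi> ` substates"] by simp
      then show ?thesis by (auto simp: L_def intro: less_imp_le)
    qed
    show "convex (L n)" for n
    proof (rule convexI)
      fix T U and u v :: real
      assume TU: "T \<in> L n" "U \<in> L n" and uv: "0 \<le> u" "0 \<le> v" "u + v = 1"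
      have "norm (\<Phi> (u *\<^sub>R T + v *\<^sub>R U)) \<le> u * norm (\<Phi> T) + v * norm (\<Phi> U)"
        using TU uv norm_triangle_ineq[of "u *\<^sub>R \<Phi> T" "v *\<^sub>R \<Phi> U"] by (simp add: affine L_def)
      also have "\<dots> \<le> 1 / real (Suc n)" using TU uv by (intro convex_bound_le) (auto simp: L_def)
      finally show "u *\<^sub>R T + v *\<^sub>R U \<in> L n"
        using TU uv convexD[OF convex_substates] by (simp add: L_def)
    qed
    show "L n \<subseteq> L m" if "m \<le> n" for m n
    proof -
      have "1 / real (Suc n) \<le> 1 / real (Suc m)" using that by (auto intro!: divide_left_mono)
      then show ?thesis by (auto simp: L_def)
    qed
  qed blast
  have Ts: "T n \<in> substates" and small: "norm (\<Phi> (T n)) \<le> 1 / real (Suc n)" for n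
    using T by (auto simp: L_def)
  have U: "U \<in> substates" using closed_sequentially[OF closed_substates Ts lim] .
  have "(\<lambda>n. norm (\<Phi> (T n))) \<longlonglongrightarrow> 0"
    by (rule tendsto_sandwich[OF _ _ tendsto_const LIMSEQ_Suc[OF lim_1_over_n]]) (use small in auto)
  then have \<Phi>0: "(\<lambda>n. \<Phi> (T n)) \<longlonglongrightarrow> 0" by (simp add: tendsto_norm_zero_iff)
  have "diag_seq e U k = d k" for k
  proof -
    have "(\<lambda>n. inner (e k) (fst (\<Phi> (T n)))) \<longlonglongrightarrow> inner (e k) (fst (0 :: 'a \<times> real))"
      by (intro tendsto_intros \<Phi>0)
    moreover have "inner (e k) (fst (\<Phi> (T n))) = diag_seq e (T n) k - d k" for n
      by (simp add: \<Phi>_def inner_diff_right inner_e_embed d substates_diag_summable[OF Ts])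
    ultimately have "(\<lambda>n. diag_seq e (T n) k - d k) \<longlonglongrightarrow> 0" by simp
    then have "(\<lambda>n. diag_seq e (T n) k) \<longlonglongrightarrow> d k" by (rule LIM_zero_cancel)
    moreover have "(\<lambda>n. diag_seq e (T n) k) \<longlonglongrightarrow> diag_seq e U k"
      unfolding diag_seq_def Re_cinner by (intro tendsto_intros lim)
    ultimately show ?thesis by (rule LIMSEQ_unique[rotated])
  qed
  moreover have "Re (op_trace e (U o\<^sub>L C)) = lambda_max C"
  proof -
    have "(\<lambda>n. snd (\<Phi> (T n))) \<longlonglongrightarrow> snd (0 :: 'a \<times> real)" by (intro tendsto_intros \<Phi>0)
    then have "(\<lambda>n. Re (op_trace e (T n o\<^sub>L C)) - lambda_max C) \<longlonglongrightarrow> 0" by (simp add: \<Phi>_def)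
    then have "(\<lambda>n. Re (op_trace e (T n o\<^sub>L C))) \<longlonglongrightarrow> lambda_max C" by (rule LIM_zero_cancel)
    then show ?thesis using tendsto_Re[OF op_trace_tendsto[OF C Ts lim]] LIMSEQ_unique by blast
  qed
  ultimately show ?thesis using substate_in_subdiff[OF C U] by auto
qed

end

section \<open>The structure of the subgradients\<close>

lemma subspace_eigenspace:
  assumes "self_adjoint C"
  shows "complex_vector.subspace (eigenspace C l)"
  unfolding complex_vector.subspace_def eigenspace_def
  by (simp add: blinfun.add_right scaleR_add_right self_adjointD(1)[OF assms] cscale.scaleR_right)

lemma subspace_scaleR:
  "complex_vector.subspace V \<Longrightarrow> v \<in> V \<Longrightarrow> r *\<^sub>R v \<in> V"
  by (metis complex_vector.subspace_scale cscale_of_real)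

lemma convex_range_subset:
  "complex_vector.subspace V \<Longrightarrow> convex {T :: 'a::chilbert_space \<Rightarrow>\<^sub>L 'a. range (blinfun_apply T) \<subseteq> V}"
  by (intro convexI)
    (auto simp: blinfun.add_left blinfun.scaleR_left intro!: complex_vector.subspace_add
        subspace_scaleR)

text \<open>A Cholesky step: subtracting \<open>w w\<^sup>*\<close> with \<open>w = Y q / sqrt \<langle>Y q, q\<rangle>\<close> keeps \<open>Y\<close> positive and
  makes it vanish at \<open>q\<close>.\<close>

lemma positive_op_eliminate:
  fixes Y :: "'a::chilbert_space \<Rightarrow>\<^sub>L 'a"
  assumes F: "finite F" and V: "complex_vector.subspace V"
    and Y: "positive_op Y" "range (blinfun_apply Y) \<subseteq> V"
  shows "\<exists>Z ws. Y = Z + (\<Sum>w\<leftarrow>ws. outer w w) \<and> set ws \<subseteq> V \<and> positive_op Z \<and>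
    range (blinfun_apply Z) \<subseteq> V \<and> (\<forall>q\<in>F. blinfun_apply Z q = 0)"
  using F
proof (induction F)
  case empty
  show ?case by (rule exI[of _ Y], rule exI[of _ "[]"]) (use Y in simp)
next
  case (insert q F)
  then obtain Z ws where Z: "Y = Z + (\<Sum>w\<leftarrow>ws. outer w w)" "set ws \<subseteq> V" "positive_op Z"
    "range (blinfun_apply Z) \<subseteq> V" "\<And>p. p \<in> F \<Longrightarrow> blinfun_apply Z p = 0" by auto
  define c where "c = inner (blinfun_apply Z q) q"
  show ?case
  proof (cases "c = 0")
    case True
    then have "blinfun_apply Z q = 0" using positive_op_eq_zero[OF Z(3)] by (simp add: c_def)
    then show ?thesis using Z by (intro exI[of _ Z] exI[of _ ws]) auto
  next
    case False
    then have c: "c > 0" using positive_opD(2)[OF Z(3), of q] by (simp add: c_def)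
    define w where "w = (1 / sqrt c) *\<^sub>R blinfun_apply Z q"
    define U where "U = Z - outer w w"
    have wV: "w \<in> V" unfolding w_def by (rule subspace_scaleR[OF V]) (use Z(4) in auto)
    have cw: "cinner v w = complex_of_real (1 / sqrt c) * cinner v (blinfun_apply Z q)" for v
      by (simp add: w_def cinner.scaleR_right scaleR_conv_of_real)
    have "positive_op U"
      unfolding positive_op_def Re_cinner
    proof (intro conjI allI)
      show "self_adjoint U"
        unfolding U_def by (intro self_adjoint_diff self_adjoint_outer positive_opD(1)[OF Z(3)])
      fix v
      have "(cmod (cinner v (blinfun_apply Z q)))\<^sup>2 \<le> inner (blinfun_apply Z v) v * c"
        using positive_op_cauchy_schwarz[OF Z(3), of v q]
        by (simp add: c_def self_adjointD(2)[OF positive_opD(1)[OF Z(3)]])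
      then have "(cmod (cinner v w))\<^sup>2 \<le> inner (blinfun_apply Z v) v"
        using c by (simp add: cw norm_mult power_mult_distrib power_divide norm_divide field_simps)
      then show "0 \<le> inner (blinfun_apply U v) v"
        by (simp add: U_def blinfun.diff_left inner_diff_left inner_outer_self)
    qed
    moreover have "range (blinfun_apply U) \<subseteq> V"
      using Z(4) by (auto simp: U_def blinfun.diff_left outer_apply
          intro!: complex_vector.subspace_diff[OF V] complex_vector.subspace_scale[OF V] wV)
    moreover have "blinfun_apply U p = 0" if "p \<in> insert q F" for p
    proof (cases "p = q")
      case True
      have "cinner q (blinfun_apply Z q) = complex_of_real c"
        by (metis c_def self_adjoint_cinner_self[OF positive_opD(1)[OF Z(3)]]
            self_adjointD(2)[OF positive_opD(1)[OF Z(3)]])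
      then have "cinner q w = complex_of_real (c / sqrt c)" by (simp add: cw)
      then have "cscale (cinner q w) w = blinfun_apply Z q"
        using c by (simp add: w_def cscale_of_real del: of_real_divide)
      then show ?thesis using True by (simp add: U_def blinfun.diff_left outer_apply)
    next
      case False
      \<comment> \<open>Earlier eliminations persist: as \<open>Z p = 0\<close>, \<open>p\<close> is
        orthogonal to \<open>Z q\<close>, so the subtracted operator vanishes at \<open>p\<close>
        too.\<close>
      then have "blinfun_apply Z p = 0" using that Z(5) by auto
      then have "cinner p (blinfun_apply Z q) = 0"
        by (metis self_adjointD(2)[OF positive_opD(1)[OF Z(3)]] cinner.zero_left)
      then show ?thesis
        using \<open>blinfun_apply Z p = 0\<close>
        by (simp add: U_def blinfun.diff_left outer_apply cw cscale.zero_left)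
    qed
    moreover have "Y = U + (\<Sum>v\<leftarrow>w # ws. outer v v)" by (simp add: Z(1) U_def)
    ultimately show ?thesis using Z(2) wV by (intro exI[of _ U] exI[of _ "w # ws"]) auto
  qed
qed

text \<open>The remainder \<open>Z\<close> of the elimination vanishes on a spanning set of
  \<open>V\<close>, hence on \<open>V\<close>. Its range lies in \<open>V\<close>, so
  self-adjointness makes it \<open>0\<close>.\<close>

lemma positive_op_sum_outer:
  fixes Y :: "'a::chilbert_space \<Rightarrow>\<^sub>L 'a"
  assumes F: "finite F" "V \<subseteq> cspan F" and V: "complex_vector.subspace V"
    and Y: "positive_op Y" "range (blinfun_apply Y) \<subseteq> V"
  obtains ws where "Y = (\<Sum>w\<leftarrow>ws. outer w w)" "set ws \<subseteq> V"
proof -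
  obtain Z ws where Z: "Y = Z + (\<Sum>w\<leftarrow>ws. outer w w)" "set ws \<subseteq> V" "positive_op Z"
    "range (blinfun_apply Z) \<subseteq> V" "\<forall>q\<in>F. blinfun_apply Z q = 0"
    using positive_op_eliminate[OF F(1) V Y] by (elim exE conjE) (rule that)
  note sa = positive_opD(1)[OF Z(3)]
  have zero: "blinfun_apply Z v = 0" if "v \<in> V" for v
    using subsetD[OF F(2) that]
    by (induction rule: complex_vector.span_induct_alt)
      (simp_all add: Z(5) blinfun.add_right self_adjointD(1)[OF sa] cscale.zero_right)
  have "blinfun_apply Z v = 0" for v
  proof (rule cinner_eq_zero_all)
    fix u
    have "cinner (blinfun_apply Z v) (blinfun_apply Z v) = 0"
      using zero[of "blinfun_apply Z v"] Z(4) by (simp add: self_adjointD(2)[OF sa]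
          cinner.zero_right image_subset_iff)
    then have "blinfun_apply Z v = 0" by (simp add: cinner_self)
    then show "cinner (blinfun_apply Z v) u = 0" by (simp add: cinner.zero_left)
  qed
  then have "Z = 0" by (intro blinfun_eqI) simp
  then show thesis using Z that by simp
qed

text \<open>Normalising \<open>w\<close> turns \<open>outer w w\<close> into a pure state with
  weight \<open>(norm w)\<^sup>2\<close>. Zero vectors, which cannot be normalised, are dropped
  first.\<close>

lemma sum_outer_in_pure_hull:
  assumes V: "complex_vector.subspace V" and ws: "set ws \<subseteq> V" and one: "(\<Sum>w\<leftarrow>ws. (norm w)\<^sup>2) = 1"
  shows "(\<Sum>w\<leftarrow>ws. outer w w) \<in> pure_hull V"
proof -
  define I where "I = {i. i < length ws \<and> ws ! i \<noteq> 0}"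
  define u where "u i = ws ! i /\<^sub>R norm (ws ! i)" for i
  have I: "finite I" "I \<subseteq> {0..<length ws}" by (auto simp: I_def)
  have outer_scale: "outer (ws ! i) (ws ! i) = (norm (ws ! i))\<^sup>2 *\<^sub>R outer (u i) (u i)" if "i \<in> I"
      for i
    using that
    by (intro blinfun_eqI)
      (simp add: I_def u_def blinfun.scaleR_left outer_apply cscale.scaleR_right cscale.scaleR_left
        cinner.scaleR_right power2_eq_square field_simps)
  have "(\<Sum>w\<leftarrow>ws. outer w w) = (\<Sum>i=0..<length ws. outer (ws ! i) (ws ! i))"
    by (simp add: sum_list_sum_nth)
  also have "\<dots> = (\<Sum>i\<in>I. outer (ws ! i) (ws ! i))"
    by (rule sum.mono_neutral_right)
      (auto simp: I_def intro!: blinfun_eqI simp: outer_apply cscale.zero_right)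
  also have "\<dots> = (\<Sum>i\<in>I. (norm (ws ! i))\<^sup>2 *\<^sub>R outer (u i) (u i))"
    by (rule sum.cong[OF refl outer_scale])
  also have "\<dots> \<in> pure_hull V"
    unfolding pure_hull_def
  proof (rule convex_sum[OF I(1) convex_convex_hull])
    have "(\<Sum>i\<in>I. (norm (ws ! i))\<^sup>2) = (\<Sum>i=0..<length ws. (norm (ws ! i))\<^sup>2)"
      by (rule sum.mono_neutral_left) (auto simp: I_def)
    then show "(\<Sum>i\<in>I. (norm (ws ! i))\<^sup>2) = 1" using one by (simp add: sum_list_sum_nth)
    fix i assume i: "i \<in> I"
    then have "u i \<in> V" "norm (u i) = 1"
      using ws by (auto simp: u_def I_def intro!: subspace_scaleR[OF V])
    then show "outer (u i) (u i) \<in> convex hull {outer q q | q. q \<in> V \<and> norm q = 1}"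
      by (intro hull_inc) auto
  qed simp
  finally show ?thesis .
qed

section \<open>Perturbation tests for a subgradient\<close>

context onb
begin

text \<open>Parseval evaluates the trace of \<open>Y\<close> against a rank one perturbation, so
  such a perturbation tests the form of \<open>Y\<close> at \<open>w\<close>.\<close>

lemma op_trace_outer_right:
  assumes "self_adjoint Y"
  shows "(\<lambda>k. cinner (blinfun_apply (Y o\<^sub>L outer w w) (e k)) (e k)) sums complex_of_real (inner
      (blinfun_apply Y w) w)"
proof -
  have "(\<lambda>k. cinner (blinfun_apply Y w) (e k) * cinner (e k) w) sums cinner (blinfun_apply Y w) w"
    by (rule parseval)
  then show ?thesis
    by (simp add: outer_apply self_adjointD(1)[OF assms] cinner_cscale_left mult.commute
        self_adjoint_cinner_self[OF assms])
qed

lemma form_outer_sums: "(\<lambda>k. inner (blinfun_apply (outer w w) (e k)) (e k)) sums (norm w)\<^sup>2"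
  unfolding inner_outer_self using parseval_norm[of w]
  by (metis (no_types, lifting) cinner_commute complex_mod_cnj sums_cong)

lemma form_sum_outer_sums:
  "(\<lambda>k. inner (blinfun_apply (\<Sum>w\<leftarrow>ws. outer w w) (e k)) (e k)) sums (\<Sum>w\<leftarrow>ws. (norm w)\<^sup>2)"
proof (induction ws)
  case (Cons w ws)
  show ?case using sums_add[OF form_outer_sums[of w] Cons] by (simp add: blinfun.add_left
      inner_add_left)
qed simp

text \<open>Subtracting \<open>outer w w\<close> from \<open>C\<close> cannot raise
  \<open>lambda_max\<close>, while the linear side changes by minus the form of \<open>Y\<close> at
  \<open>w\<close>.\<close>

lemma subdiff_positive:
  fixes C :: "'a \<Rightarrow>\<^sub>L 'a"
  assumes C: "C \<in> compact_sa" and Y: "Y \<in> subdiff_lambda_max e C"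
  shows "positive_op Y"
  unfolding positive_op_def Re_cinner
proof (intro conjI allI)
  show sa: "self_adjoint Y" using Y by (simp add: subdiff_lambda_max_def trace_class_sa_def)
  fix w
  let ?B = "C - outer w w"
  have B: "?B \<in> compact_sa" by (intro compact_sa_diff C compact_sa_outer)
  have "lambda_max ?B \<le> lambda_max C"
  proof (rule lambda_max_least[OF B lambda_max_nonneg[OF C]])
    show "inner (blinfun_apply ?B v) v \<le> lambda_max C * (norm v)\<^sup>2" for v
    proof -
      have "inner (blinfun_apply ?B v) v \<le> inner (blinfun_apply C v) v"
        by (simp add: blinfun.diff_left inner_diff_left inner_outer_self)
      then show ?thesis using form_le_lambda_max[OF C, of v] by linarith
    qed
  qed
  moreover have "Re (op_trace e (Y o\<^sub>L (?B - C))) \<le> lambda_max ?B - lambda_max C"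
    using Y B unfolding subdiff_lambda_max_def by blast
  moreover have "op_trace e (Y o\<^sub>L (?B - C)) = - complex_of_real (inner (blinfun_apply Y w) w)"
    using sums_minus[OF op_trace_outer_right[OF sa, of w]]
    by (simp add: op_trace_def sums_iff blinfun.minus_left blinfun.minus_right cinner.minus_left)
  ultimately show "0 \<le> inner (blinfun_apply Y w) w" by simp
qed

text \<open>Adding \<open>proj N\<close> to \<open>C\<close> raises \<open>lambda_max\<close> by at
  most \<open>1\<close>, and the trace of \<open>Y\<close> against \<open>proj N\<close> is the
  partial sum.\<close>

lemma subdiff_partial_trace:
  fixes C :: "'a \<Rightarrow>\<^sub>L 'a"
  assumes C: "C \<in> compact_sa" and Y: "Y \<in> subdiff_lambda_max e C"
  shows "(\<Sum>k<N. diag_seq e Y k) \<le> 1"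
proof -
  let ?B = "C + proj N"
  have B: "?B \<in> compact_sa" unfolding proj_def by (intro compact_sa_add compact_sa_sum C
      compact_sa_outer)
  have "lambda_max ?B \<le> lambda_max C + 1"
  proof (rule lambda_max_least[OF B])
    show "inner (blinfun_apply ?B v) v \<le> (lambda_max C + 1) * (norm v)\<^sup>2" for v
    proof -
      have "inner (blinfun_apply (proj N) v) v = (norm (blinfun_apply (proj N) v))\<^sup>2"
        by (metis power2_norm_eq_inner proj_proj self_adjoint_inner[OF self_adjoint_proj])
      also have "\<dots> \<le> (norm v)\<^sup>2" using bessel[of v N] by (simp add: norm_proj)
      finally show ?thesis
        using form_le_lambda_max[OF C, of v] by (simp add: blinfun.add_left inner_add_left
            algebra_simps)
    qed
  qed (simp add: lambda_max_nonneg[OF C])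
  moreover have "Re (op_trace e (Y o\<^sub>L (?B - C))) \<le> lambda_max ?B - lambda_max C"
    using Y B unfolding subdiff_lambda_max_def by blast
  moreover have "op_trace e (Y o\<^sub>L (?B - C)) = (\<Sum>k<N. cinner (blinfun_apply Y (e k)) (e k))"
    unfolding op_trace_def
    by (subst suminf_finite[of "{..<N}"]) (auto simp: proj_e cinner.zero_left)
  ultimately show ?thesis by (simp add: diag_seq_def)
qed

lemma subdiff_diag:
  fixes C :: "'a \<Rightarrow>\<^sub>L 'a"
  assumes C: "C \<in> compact_sa" and Y: "Y \<in> subdiff_lambda_max e C"
  shows "0 \<le> diag_seq e Y k" and "summable (\<lambda>k. \<bar>diag_seq e Y k\<bar>)" and "summable (diag_seq e Y)"
    and "suminf (diag_seq e Y) \<le> 1"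
proof -
  show nonneg: "0 \<le> diag_seq e Y k" for k
    using positive_opD(2)[OF subdiff_positive[OF assms]] by (simp add: diag_seq_def)
  show summable: "summable (diag_seq e Y)"
    using subdiff_partial_trace[OF assms] by (intro summableI_nonneg_bounded[of _ 1] nonneg) auto
  then show "summable (\<lambda>k. \<bar>diag_seq e Y k\<bar>)" by (simp add: nonneg)
  show "suminf (diag_seq e Y) \<le> 1"
    by (intro suminf_le_const summable subdiff_partial_trace[OF assms])
qed

text \<open>For \<open>w = (l - C) u\<close> with \<open>l = lambda_max C\<close> the Cauchy-Schwarz inequality for the positive
  form of \<open>l - C\<close> shows that adding a small multiple of \<open>w w\<^sup>*\<close> to \<open>C\<close> does not increase
  \<open>lambda_max\<close>; hence \<open>\<langle>Y w, w\<rangle> \<le> 0\<close>.\<close>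

lemma subdiff_annihilates:
  fixes C :: "'a \<Rightarrow>\<^sub>L 'a"
  assumes C: "C \<in> compact_sa" and Y: "Y \<in> subdiff_lambda_max e C"
  shows "blinfun_apply Y (blinfun_apply C u) = lambda_max C *\<^sub>R blinfun_apply Y u"
proof -
  note pos = subdiff_positive[OF C Y] and l0 = lambda_max_nonneg[OF C]
  have saC: "self_adjoint C" using C by (simp add: compact_sa_iff)
  define R where "R = lambda_max C *\<^sub>R id_blinfun - C"
  have R_apply: "blinfun_apply R v = lambda_max C *\<^sub>R v - blinfun_apply C v" for v
    by (simp add: R_def blinfun.diff_left blinfun.scaleR_left)
  have saR: "self_adjoint R"
    unfolding R_def by (intro self_adjoint_diff self_adjoint_scaleR self_adjoint_id saC)
  have R: "positive_op R"
    unfolding positive_op_def Re_cinner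
    using saR form_le_lambda_max[OF C] by (simp add: R_apply inner_diff_left power2_norm_eq_inner)
  \<comment> \<open>Small enough for \<open>t * inner (R u) u \<le> 1\<close>; the added
    \<open>1\<close> keeps the denominator positive.\<close>
  define t where "t = 1 / (inner (blinfun_apply R u) u + 1)"
  have t: "t > 0" "t * inner (blinfun_apply R u) u \<le> 1"
    using positive_opD(2)[OF R, of u] by (simp_all add: t_def field_simps add_nonneg_pos)
  define w where "w = sqrt t *\<^sub>R blinfun_apply R u"
  let ?B = "C + outer w w"
  have B: "?B \<in> compact_sa" by (intro compact_sa_add C compact_sa_outer)
  have "lambda_max ?B \<le> lambda_max C"
  proof (rule lambda_max_least[OF B l0])
    fix v
    have "(cmod (cinner v w))\<^sup>2 = t * (cmod (cinner (blinfun_apply R u) v))\<^sup>2"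
      using t by (simp add: w_def cinner.scaleR_right power_mult_distrib)
        (metis cinner_commute complex_mod_cnj)
    also have "\<dots> \<le> t * (inner (blinfun_apply R u) u * inner (blinfun_apply R v) v)"
      using t by (intro mult_left_mono positive_op_cauchy_schwarz R) auto
    also have "\<dots> \<le> 1 * inner (blinfun_apply R v) v"
      unfolding mult.assoc[symmetric] by (intro mult_right_mono t positive_opD(2)[OF R])
    finally show "inner (blinfun_apply ?B v) v \<le> lambda_max C * (norm v)\<^sup>2"
      by (simp add: blinfun.add_left inner_add_left inner_outer_self R_apply inner_diff_left
          power2_norm_eq_inner)
  qed
  moreover have "Re (op_trace e (Y o\<^sub>L (?B - C))) \<le> lambda_max ?B - lambda_max C"
    using Y B unfolding subdiff_lambda_max_def by blast
  moreover have "op_trace e (Y o\<^sub>L (?B - C)) = complex_of_real (inner (blinfun_apply Y w) w)"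
    using op_trace_outer_right[OF positive_opD(1)[OF pos], of w] by (simp add: op_trace_def
        sums_iff)
  ultimately have "inner (blinfun_apply Y w) w = 0"
    using positive_opD(2)[OF pos, of w] by simp
  then have "blinfun_apply Y w = 0" by (rule positive_op_eq_zero[OF pos])
  then have "blinfun_apply Y (blinfun_apply R u) = 0"
    using t by (simp add: w_def blinfun.scaleR_right)
  then show ?thesis by (simp add: R_apply blinfun.diff_right blinfun.scaleR_right)
qed

text \<open>Taking adjoints in \<open>subdiff_annihilates\<close> moves \<open>C\<close> to the left
  of \<open>Y\<close>.\<close>

lemma subdiff_range:
  fixes C :: "'a \<Rightarrow>\<^sub>L 'a"
  assumes C: "C \<in> compact_sa" and Y: "Y \<in> subdiff_lambda_max e C"
  shows "range (blinfun_apply Y) \<subseteq> eigenspace C (lambda_max C)"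
proof clarify
  fix v
  have saC: "self_adjoint C" using C by (simp add: compact_sa_iff)
  note saY = positive_opD(1)[OF subdiff_positive[OF C Y]]
  have "blinfun_apply C (blinfun_apply Y v) - lambda_max C *\<^sub>R blinfun_apply Y v = 0"
  proof (rule cinner_eq_zero_all)
    show "cinner (blinfun_apply C (blinfun_apply Y v) - lambda_max C *\<^sub>R blinfun_apply Y v) u = 0"
        for u
      by (simp add: cinner.diff_left cinner.scaleR_left cinner.scaleR_right self_adjointD(2)[OF saC]
          self_adjointD(2)[OF saY] subdiff_annihilates[OF C Y])
  qed
  then show "blinfun_apply Y v \<in> eigenspace C (lambda_max C)" by (simp add: eigenspace_def)
qed

text \<open>The test operator is \<open>0\<close>, where \<open>lambda_max\<close> vanishes. As
  \<open>Y C = lambda_max C Y\<close>, the inequality bounds \<open>lambda_max C\<close> times the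
  trace from below by \<open>lambda_max C\<close>; after cancelling, the trace is at least
  \<open>1\<close>.\<close>

lemma subdiff_trace:
  fixes C :: "'a \<Rightarrow>\<^sub>L 'a"
  assumes C: "C \<in> compact_sa" and Y: "Y \<in> subdiff_lambda_max e C" and "lambda_max C \<noteq> 0"
  shows "diag_seq e Y sums 1"
proof -
  have l: "lambda_max C > 0" using lambda_max_nonneg[OF C] assms(3) by simp
  note saY = positive_opD(1)[OF subdiff_positive[OF C Y]]
  note summable = subdiff_diag(3)[OF C Y]
  have "lambda_max (0 :: 'a \<Rightarrow>\<^sub>L 'a) = 0"
    using lambda_max_least[OF compact_sa_zero, of 0] lambda_max_nonneg[OF compact_sa_zero] by simp
  then have "Re (op_trace e (Y o\<^sub>L (0 - C))) \<le> - lambda_max C"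
    using Y compact_sa_zero by (force simp: subdiff_lambda_max_def)
  moreover have "(\<lambda>k. complex_of_real (- lambda_max C * diag_seq e Y k)) sums
      complex_of_real (- lambda_max C * suminf (diag_seq e Y))"
    unfolding sums_of_real_iff by (intro sums_mult summable_sums summable)
  then have "op_trace e (Y o\<^sub>L (0 - C)) = complex_of_real (- lambda_max C * suminf (diag_seq e Y))"
    by (simp add: op_trace_def sums_iff blinfun.minus_left blinfun.minus_right
        subdiff_annihilates[OF C Y]
        cinner.minus_left cinner.scaleR_left self_adjoint_cinner_self[OF saY] diag_seq_def
            scaleR_conv_of_real)
  ultimately have "lambda_max C * 1 \<le> lambda_max C * suminf (diag_seq e Y)" by simp
  then have "suminf (diag_seq e Y) = 1" using l subdiff_diag(4)[OF C Y] by simp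
  then show ?thesis using summable by (simp add: sums_iff)
qed

section \<open>The eigenspace of a nonzero eigenvalue\<close>

text \<open>With tail constant \<open>\<bar>l\<bar> / 2\<close> the map \<open>proj N\<close> is
  injective on the eigenspace: for an eigenvector \<open>w\<close> in its kernel,
  \<open>l *\<^sub>R w\<close> is its own tail. A basis is thus mapped to independent vectors in the
  span of \<open>N\<close> vectors.\<close>

lemma eigenspace_finite_dim:
  fixes C :: "'a \<Rightarrow>\<^sub>L 'a"
  assumes C: "C \<in> compact_sa" and l: "l \<noteq> 0"
  obtains B where "finite B" "B \<subseteq> eigenspace C l" "eigenspace C l \<subseteq> cspan B" "card B = cdim
      (eigenspace C l)"
proof -
  let ?S = "eigenspace C l"
  have saC: "self_adjoint C" using C by (simp add: compact_sa_iff)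
  obtain B where B: "B \<subseteq> ?S" "complex_vector.independent B" "?S \<subseteq> cspan B" "card B = cdim ?S"
    using complex_vector.basis_exists by blast
  have "\<bar>l\<bar> / 2 > 0" using l by simp
  then obtain N where N: "\<And>v. norm (blinfun_apply C v - blinfun_apply (proj N) (blinfun_apply C
      v)) \<le> \<bar>l\<bar> / 2 * norm v"
    using compact_tail[OF C] by blast
  have kernel: "w = 0" if w: "w \<in> ?S" "blinfun_apply (proj N) w = 0" for w
  proof -
    have "\<bar>l\<bar> * norm w \<le> \<bar>l\<bar> / 2 * norm w"
      using N[of w] w by (simp add: eigenspace_def blinfun.scaleR_right)
    then show ?thesis using l by (simp add: mult_le_cancel_right)
  qed
  have span: "cspan B = ?S"
    using B(1,3) complex_vector.span_minimal[OF B(1) subspace_eigenspace[OF saC]] by blast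
  have inj: "inj_on (blinfun_apply (proj N)) (cspan B)"
    unfolding span
  proof (rule inj_onI)
    fix u v assume uv: "u \<in> ?S" "v \<in> ?S" "blinfun_apply (proj N) u = blinfun_apply (proj N) v"
    then have "u - v = 0"
      by (intro kernel[OF complex_vector.subspace_diff[OF subspace_eigenspace[OF saC]]])
        (simp_all add: blinfun.diff_right)
    then show "u = v" by simp
  qed
  interpret pair: vector_space_pair "cscale :: complex \<Rightarrow> 'a \<Rightarrow> 'a" "cscale :: complex \<Rightarrow> 'a \<Rightarrow> 'a"
    by unfold_locales
  have "Vector_Spaces.linear cscale cscale (blinfun_apply (proj N))"
    unfolding Vector_Spaces.linear_iff
    by (simp add: blinfun.add_right self_adjointD(1)[OF self_adjoint_proj]
        complex_vector.vector_space_axioms)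
  then have "complex_vector.independent (blinfun_apply (proj N) ` B)"
    using B(2) inj[unfolded cspan_def] by (rule pair.linear_independent_injective_image)
  moreover have "blinfun_apply (proj N) ` B \<subseteq> cspan (e ` {..<N})"
    unfolding proj_apply
    by (auto intro!: complex_vector.span_sum complex_vector.span_scale intro:
        complex_vector.span_base)
  ultimately have "finite (blinfun_apply (proj N) ` B)"
    using complex_vector.independent_span_bound by blast
  then have "finite B"
    using inj_on_subset[OF inj complex_vector.span_superset] finite_imageD by blast
  with B show thesis using that by blast
qed

text \<open>The rank one substate of a unit eigenvector attains \<open>lambda_max C\<close>, and
  attaining it is an affine condition on substates.\<close>

lemma pure_hull_subset_subdiff:
  fixes C :: "'a \<Rightarrow>\<^sub>L 'a"
  assumes C: "C \<in> compact_sa"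
  shows "pure_hull (eigenspace C (lambda_max C)) \<subseteq> subdiff_lambda_max e C"
proof -
  have sa: "self_adjoint C" using C by (simp add: compact_sa_iff)
  let ?X = "{T \<in> substates. Re (op_trace e (T o\<^sub>L C)) = lambda_max C}"
  have "pure_hull (eigenspace C (lambda_max C)) \<subseteq> ?X"
    unfolding pure_hull_def
  proof (rule hull_minimal)
    show "convex ?X"
      using convexD[OF convex_substates]
      by (intro convexI) (auto simp: op_trace_combination[OF sa] simp flip: distrib_right)
    show "{outer q q |q. q \<in> eigenspace C (lambda_max C) \<and> norm q = 1} \<subseteq> ?X"
      by (auto simp: outer_in_substates op_trace_outer[OF sa] eigenspace_def simp flip:
          power2_norm_eq_inner)
  qed
  also have "\<dots> \<subseteq> subdiff_lambda_max e C" using substate_in_subdiff[OF C] by auto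
  finally show ?thesis .
qed

lemma subdiff_eq_pure_hull:
  fixes C :: "'a \<Rightarrow>\<^sub>L 'a"
  assumes C: "C \<in> compact_sa" and l: "lambda_max C \<noteq> 0"
  shows "subdiff_lambda_max e C = pure_hull (eigenspace C (lambda_max C))"
proof (intro equalityI pure_hull_subset_subdiff[OF C] subsetI)
  fix Y assume Y: "Y \<in> subdiff_lambda_max e C"
  let ?S = "eigenspace C (lambda_max C)"
  have V: "complex_vector.subspace ?S" using C by (intro subspace_eigenspace) (simp add:
      compact_sa_iff)
  obtain B where B: "finite B" "?S \<subseteq> cspan B" by (rule eigenspace_finite_dim[OF C l])
  obtain ws where ws: "Y = (\<Sum>w\<leftarrow>ws. outer w w)" "set ws \<subseteq> ?S"
    by (rule positive_op_sum_outer[OF B V subdiff_positive[OF C Y] subdiff_range[OF C Y]])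
  have "(\<Sum>w\<leftarrow>ws. (norm w)\<^sup>2) = 1"
    using subdiff_trace[OF C Y l] form_sum_outer_sums[of ws] sums_unique2
    unfolding diag_seq_def Re_cinner ws(1) by blast
  then show "Y \<in> pure_hull ?S" unfolding ws(1) by (rule sum_outer_in_pure_hull[OF V ws(2)])
qed

text \<open>Taking diagonals is linear, so it commutes with convex hulls.\<close>

lemma diag_seq_pure_hull: "diag_seq e ` pure_hull S = moment e S"
proof -
  have "linear (diag_seq e)"
    by (rule linearI) (auto simp: diag_seq_def blinfun.add_left blinfun.scaleR_left inner_add_left
        scaleR_fun_def)
  then have "diag_seq e ` pure_hull S = convex hull (diag_seq e ` {outer q q |q. q \<in> S \<and> norm q =
      1})"
    unfolding pure_hull_def by (rule convex_hull_linear_image)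
  also have "diag_seq e ` {outer q q |q. q \<in> S \<and> norm q = 1}
      = {(\<lambda>k. (cmod (cinner v (e k)))\<^sup>2) | v. v \<in> S \<and> norm v = 1}"
  proof -
    have "diag_seq e (outer q q) = (\<lambda>k. (cmod (cinner q (e k)))\<^sup>2)" for q
      by (rule ext) (rule diag_seq_outer)
    then show ?thesis unfolding setcompr_eq_image image_image by simp
  qed
  finally show ?thesis by (simp add: moment_def)
qed

end

section \<open>Density matrices\<close>

lemma adjoint_mat_index:
  "i < dim_col R \<Longrightarrow> j < dim_row R \<Longrightarrow> mat_adjoint R $$ (i, j) = cnj (R $$ (j, i))"
  by (simp add: mat_adjoint_def mat_of_rows_def)

locale orthonormal_family =
  fixes s :: nat and q :: "nat \<Rightarrow> 'a::chilbert_space"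
  assumes orthonormal: "i < s \<Longrightarrow> j < s \<Longrightarrow> cinner (q i) (q j) = (if i = j then 1 else 0)"
begin

definition family_span :: "'a set" where
  "family_span = cspan (q ` {..<s})"

lemma q_in_span: "i < s \<Longrightarrow> q i \<in> family_span"
  unfolding family_span_def by (rule complex_vector.span_base) simp

lemma subspace_family_span: "complex_vector.subspace family_span"
  unfolding family_span_def by (rule complex_vector.subspace_span)

lemma independent_q: "complex_vector.independent (q ` {..<s})"
  unfolding complex_vector.dependent_def
proof clarify
  fix i assume i: "i < s" and mem: "q i \<in> cspan (q ` {..<s} - {q i})"
  have "cinner v (q i) = 0" if "v \<in> cspan (q ` {..<s} - {q i})" for v
    using that
  proof (induction rule: complex_vector.span_induct_alt)
    case base
    show ?case by (rule cinner.zero_left)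
  next
    case (step c x y)
    then obtain j where "x = q j" "j < s" "j \<noteq> i" by auto
    then show ?case using step i by (simp add: cinner_add_left cinner_cscale_left orthonormal)
  qed
  then show False using mem orthonormal[OF i i] by simp
qed

lemma card_q: "card (q ` {..<s}) = s"
proof -
  have "inj_on q {..<s}"
    using orthonormal by (intro inj_onI) (metis lessThan_iff zero_neq_one)
  then show ?thesis by (simp add: card_image)
qed

lemma expand_in_span: "v \<in> family_span \<Longrightarrow> (\<Sum>j<s. cscale (cinner v (q j)) (q j)) = v"
  unfolding family_span_def
proof (induction rule: complex_vector.span_induct_alt)
  case base
  show ?case by (simp add: cinner.zero_left cscale.zero_left)
next
  case (step c x y)
  then obtain i where i: "x = q i" "i < s" by auto
  have "(\<Sum>j<s. cscale (cinner x (q j)) (q j)) = (\<Sum>j<s. if j = i then q i else 0)"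
    by (rule sum.cong) (auto simp: i orthonormal cscale.zero_left)
  then have x: "(\<Sum>j<s. cscale (cinner x (q j)) (q j)) = x" using i by simp
  have "(\<Sum>j<s. cscale (cinner (cscale c x + y) (q j)) (q j))
      = cscale c (\<Sum>j<s. cscale (cinner x (q j)) (q j)) + (\<Sum>j<s. cscale (cinner y (q j)) (q j))"
    by (simp add: cinner_add_left cinner_cscale_left cscale_add_left cscale_cscale cscale.sum_right
        flip: sum.distrib)
  then show ?case by (simp add: x step)
qed

lemma norm_in_span:
  assumes "v \<in> family_span"
  shows "(\<Sum>j<s. (cmod (cinner v (q j)))\<^sup>2) = (norm v)\<^sup>2"
proof -
  have "complex_of_real ((norm v)\<^sup>2) = cinner (\<Sum>j<s. cscale (cinner v (q j)) (q j)) v"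
    by (simp only: expand_in_span[OF assms] cinner_self)
  also have "\<dots> = complex_of_real (\<Sum>j<s. (cmod (cinner v (q j)))\<^sup>2)"
    by (simp add: cinner.sum_left cinner_cscale_left cinner_mult_commute)
  finally show ?thesis by (simp only: of_real_eq_iff)
qed

lemma form_outer_in_span:
  "w \<in> family_span \<Longrightarrow> (\<Sum>i<s. inner (blinfun_apply (outer w w) (q i)) (q i)) = (norm w)\<^sup>2"
  unfolding inner_outer_self by (metis (no_types, lifting) cinner_commute complex_mod_cnj
      norm_in_span sum.cong)

text \<open>A trace taken over the finite family \<open>q\<close> alone; it misses nothing since all
  vectors of \<open>ws\<close> lie in the span.\<close>

lemma form_sum_outer_in_span:
  "set ws \<subseteq> family_span \<Longrightarrow>
    (\<Sum>i<s. inner (blinfun_apply (\<Sum>w\<leftarrow>ws. outer w w) (q i)) (q i)) = (\<Sum>w\<leftarrow>ws. (norm w)\<^sup>2)"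
  by (induction ws) (auto simp: blinfun.add_left inner_add_left sum.distrib form_outer_in_span)

lemma sandwich_apply:
  assumes "R \<in> carrier_mat s s"
  shows "blinfun_apply (sandwich s q R) v = (\<Sum>i<s. \<Sum>j<s. cscale (R $$ (i, j) * cinner v (q j)) (q
      i))"
  unfolding sandwich_eq_sum_outer[OF assms]
  by (simp add: blinfun.sum_left outer_apply cscale_cscale mult.commute)

lemma cinner_sandwich:
  assumes "R \<in> carrier_mat s s"
  shows "cinner (blinfun_apply (sandwich s q R) v) w
    = (\<Sum>i<s. \<Sum>j<s. R $$ (i, j) * cinner v (q j) * cinner (q i) w)"
  unfolding sandwich_apply[OF assms] by (simp add: cinner.sum_left cinner_cscale_left)

lemma cscalar_prod_form:
  fixes R :: "complex mat"
  assumes "R \<in> carrier_mat s s" "a \<in> carrier_vec s"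
  shows "(R *\<^sub>v a) \<bullet>c a = (\<Sum>i<s. \<Sum>j<s. R $$ (i, j) * vec_index a j * cnj (vec_index a i))"
  using assms
  by (simp add: scalar_prod_def sum_distrib_right lessThan_atLeast0)

lemma sandwich_positive:
  assumes R: "R \<in> density_mats s"
  shows "positive_op (sandwich s q R)"
proof -
  have carrier: "R \<in> carrier_mat s s" and adj: "mat_adjoint R = R"
    and pos: "\<And>a. a \<in> carrier_vec s \<Longrightarrow> 0 \<le> (R *\<^sub>v a) \<bullet>c a"
    using R by (auto simp: density_mats_def)
  have cnj_R: "cnj (R $$ (i, j)) = R $$ (j, i)" if "i < s" "j < s" for i j
    using adjoint_mat_index[of j R i] adj carrier that by simp
  have "self_adjoint (sandwich s q R)"
    unfolding self_adjoint_def
  proof (intro conjI allI)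
    show "blinfun_apply (sandwich s q R) (cscale a v) = cscale a (blinfun_apply (sandwich s q R)
        v)" for a v
      by (simp add: sandwich_apply[OF carrier] cinner_cscale_left cscale.sum_right cscale_cscale
          mult_ac)
    fix v w
    have "cinner v (blinfun_apply (sandwich s q R) w) = cnj (cinner (blinfun_apply (sandwich s q
        R) w) v)"
      by (rule cinner_commute)
    also have "\<dots> = (\<Sum>i<s. \<Sum>j<s. R $$ (j, i) * cinner (q j) w * cinner v (q i))"
      unfolding cinner_sandwich[OF carrier] cnj_sum
      by (intro sum.cong refl) (simp add: cnj_R flip: cinner_commute)
    also have "\<dots> = (\<Sum>j<s. \<Sum>i<s. R $$ (j, i) * cinner (q j) w * cinner v (q i))"
      by (rule sum.swap)
    also have "\<dots> = cinner (blinfun_apply (sandwich s q R) v) w"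
      unfolding cinner_sandwich[OF carrier] by (simp add: mult_ac)
    finally show "cinner (blinfun_apply (sandwich s q R) v) w = cinner v (blinfun_apply (sandwich
        s q R) w)" ..
  qed
  moreover have "0 \<le> Re (cinner (blinfun_apply (sandwich s q R) v) v)" for v
  proof -
    let ?a = "Matrix.vec s (\<lambda>j. cinner v (q j))"
    have "cinner (blinfun_apply (sandwich s q R) v) v = (R *\<^sub>v ?a) \<bullet>c ?a"
      unfolding cinner_sandwich[OF carrier] cscalar_prod_form[OF carrier vec_carrier]
      by (intro sum.cong refl) (simp flip: cinner_commute)
    then show ?thesis using pos[of ?a] by (simp add: less_eq_complex_def del: Re_cinner)
  qed
  ultimately show ?thesis by (simp add: positive_op_def)
qed

text \<open>Both sides consist of the positive operators with range in the span and trace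
  \<open>1\<close> over \<open>q\<close>. \<open>positive_op_sum_outer\<close> leads from such
  operators to pure states, their matrix with respect to \<open>q\<close> to
  \<open>density_mats\<close>.\<close>

lemma sandwich_density_eq_pure_hull: "sandwich s q ` density_mats s = pure_hull family_span"
proof (intro equalityI subsetI)
  fix T assume "T \<in> sandwich s q ` density_mats s"
  then obtain R where R: "R \<in> density_mats s" and T: "T = sandwich s q R" by auto
  have carrier: "R \<in> carrier_mat s s" and tr: "(\<Sum>i<s. R $$ (i, i)) = 1"
    using R by (auto simp: density_mats_def)
  have ran: "range (blinfun_apply T) \<subseteq> family_span"
    unfolding T
    by (auto simp: sandwich_apply[OF carrier] intro!: complex_vector.subspace_sum[OF
        subspace_family_span]
        complex_vector.subspace_scale[OF subspace_family_span] q_in_span)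
  obtain ws where ws: "T = (\<Sum>w\<leftarrow>ws. outer w w)" "set ws \<subseteq> family_span"
    by (rule positive_op_sum_outer[OF finite_imageI[OF finite_lessThan] equalityD1[OF
        family_span_def]
          subspace_family_span sandwich_positive[OF R, folded T] ran])
  have "cinner (blinfun_apply T (q k)) (q k) = R $$ (k, k)" if "k < s" for k
  proof -
    have "cinner (blinfun_apply T (q k)) (q k)
        = (\<Sum>i<s. \<Sum>j<s. if j = k then (if i = k then R $$ (i, j) else 0) else 0)"
      unfolding T cinner_sandwich[OF carrier]
      by (intro sum.cong refl) (use that in \<open>auto simp: orthonormal\<close>)
    also have "\<dots> = R $$ (k, k)" using that by simp
    finally show ?thesis .
  qed
  then have "(\<Sum>k<s. inner (blinfun_apply T (q k)) (q k)) = Re (\<Sum>k<s. R $$ (k, k))"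
    by (simp flip: Re_cinner)
  then have "(\<Sum>w\<leftarrow>ws. (norm w)\<^sup>2) = 1"
    using form_sum_outer_in_span[OF ws(2)] by (simp add: tr ws(1))
  then show "T \<in> pure_hull family_span"
    unfolding ws(1) by (rule sum_outer_in_pure_hull[OF subspace_family_span ws(2)])
next
  fix T assume T: "T \<in> pure_hull family_span"
  let ?X = "{T. positive_op T} \<inter> {T. range (blinfun_apply T) \<subseteq> family_span} \<inter>
    {T. (\<Sum>i<s. inner (blinfun_apply T (q i)) (q i)) = 1}"
  have "pure_hull family_span \<subseteq> ?X"
    unfolding pure_hull_def
  proof (rule hull_minimal)
    have "convex {T. (\<Sum>i<s. inner (blinfun_apply T (q i)) (q i)) = 1}"
      by (intro convexI) (simp add: blinfun.add_left blinfun.scaleR_left inner_add_left sum.distrib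
          flip: sum_distrib_left)
    then show "convex ?X"
      by (intro convex_Int positive_op_convex convex_range_subset subspace_family_span)
    show "{outer q q |q. q \<in> family_span \<and> norm q = 1} \<subseteq> ?X"
    proof clarify
      fix u assume u: "u \<in> family_span" "norm u = 1"
      have "range (blinfun_apply (outer u u)) \<subseteq> family_span"
        by (auto simp: outer_apply intro!: complex_vector.subspace_scale[OF subspace_family_span
            u(1)])
      then show "outer u u \<in> ?X"
        using u by (simp only: Int_iff mem_Collect_eq positive_outer form_outer_in_span) simp
    qed
  qed
  then have pos: "positive_op T" and ran: "range (blinfun_apply T) \<subseteq> family_span"
    and tr: "(\<Sum>i<s. inner (blinfun_apply T (q i)) (q i)) = 1"
    using T by auto
  note sa = positive_opD(1)[OF pos]
  define R where "R = Matrix.mat s s (\<lambda>(i, j). cinner (blinfun_apply T (q j)) (q i))"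
  have carrier: "R \<in> carrier_mat s s" by (simp add: R_def)
  have R_nth: "R $$ (i, j) = cinner (blinfun_apply T (q j)) (q i)" if "i < s" "j < s" for i j
    using that by (simp add: R_def)
  have "R \<in> density_mats s"
    unfolding density_mats_def
  proof (intro CollectI conjI ballI carrier)
    show "mat_adjoint R = R"
    proof (rule eq_matI)
      fix i j assume "i < dim_row R" "j < dim_col R"
      then have ij: "i < s" "j < s" using carrier by auto
      have "cnj (R $$ (j, i)) = R $$ (i, j)"
        using ij by (simp add: R_nth self_adjointD(2)[OF sa] flip: cinner_commute)
      then show "mat_adjoint R $$ (i, j) = R $$ (i, j)"
        using ij carrier by (simp add: adjoint_mat_index)
    qed (use carrier in \<open>auto simp: mat_adjoint_def\<close>)
    fix a :: "complex Matrix.vec" assume a: "a \<in> carrier_vec s"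
    define z where "z = (\<Sum>j<s. cscale (vec_index a j) (q j))"
    have "cinner (blinfun_apply T z) z
        = (\<Sum>i<s. \<Sum>j<s. cnj (vec_index a i) * (vec_index a j * cinner (blinfun_apply T (q j)) (q
            i)))"
      unfolding z_def
      by (simp add: blinfun.sum_right self_adjointD(1)[OF sa] cinner.sum_left cinner.sum_right
          cinner_cscale_left cinner_cscale_right sum_distrib_left)
    also have "\<dots> = (R *\<^sub>v a) \<bullet>c a"
      unfolding cscalar_prod_form[OF carrier a] by (intro sum.cong refl) (simp add: R_nth mult_ac)
    finally have "(R *\<^sub>v a) \<bullet>c a = complex_of_real (inner (blinfun_apply T z) z)"
      by (simp add: self_adjoint_cinner_self[OF sa])
    then show "0 \<le> (R *\<^sub>v a) \<bullet>c a"
      using positive_opD(2)[OF pos, of z] by (simp add: less_eq_complex_def)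
  next
    have "(\<Sum>i<s. R $$ (i, i)) = complex_of_real (\<Sum>i<s. inner (blinfun_apply T (q i)) (q i))"
      by (simp add: R_nth self_adjoint_cinner_self[OF sa])
    then show "(\<Sum>i<s. R $$ (i, i)) = 1" by (simp only: tr of_real_1)
  qed
  moreover have "sandwich s q R = T"
  proof (rule blinfun_eqI)
    fix v
    \<comment> \<open>The orthogonal projection onto the span. The range condition says
      \<open>P T = T\<close>; taking adjoints gives \<open>T P = T\<close>, so \<open>T\<close> is
      recovered from its matrix.\<close>
    define P where "P v = (\<Sum>j<s. cscale (cinner v (q j)) (q j))" for v
    have P_sym: "cinner (P u) w = cinner u (P w)" for u w
      by (simp add: P_def cinner.sum_left cinner.sum_right cinner_cscale_left cinner_cscale_right)
        (simp add: mult.commute flip: cinner_commute)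
    have fixed: "P (blinfun_apply T u) = blinfun_apply T u" for u
      unfolding P_def by (rule expand_in_span) (use ran in auto)
    have "blinfun_apply T (P v) - blinfun_apply T v = 0"
    proof (rule cinner_eq_zero_all)
      show "cinner (blinfun_apply T (P v) - blinfun_apply T v) u = 0" for u
        by (simp add: cinner.diff_left self_adjointD(2)[OF sa] P_sym fixed)
    qed
    then have TP: "blinfun_apply T (P v) = blinfun_apply T v" by simp
    have "blinfun_apply (sandwich s q R) v
        = (\<Sum>i<s. cscale (\<Sum>j<s. R $$ (i, j) * cinner v (q j)) (q i))"
      by (simp add: sandwich_apply[OF carrier] cscale.sum_left)
    also have "\<dots> = P (blinfun_apply T (P v))"
      unfolding P_def[of "blinfun_apply T (P v)"]
    proof (intro sum.cong refl arg_cong2[of _ _ _ _ cscale])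
      fix i assume "i \<in> {..<s}"
      then show "(\<Sum>j<s. R $$ (i, j) * cinner v (q j)) = cinner (blinfun_apply T (P v)) (q i)"
        by (simp add: P_def blinfun.sum_right self_adjointD(1)[OF sa] cinner.sum_left
            cinner_cscale_left R_nth mult.commute)
    qed
    finally show "blinfun_apply (sandwich s q R) v = blinfun_apply T v" by (simp add: fixed TP)
  qed
  ultimately show "T \<in> sandwich s q ` density_mats s" by blast
qed

end

section \<open>Eigenvector frames and the composition with \<open>A\<close>\<close>

context onb
begin

text \<open>Since \<open>l \<noteq> 0\<close>, \<open>cdim\<close> is the size of a finite basis and
  not the default \<open>0\<close> of infinite dimension. Hence \<open>s\<close> orthonormal
  eigenvectors span the eigenspace, as one more independent vector would exceed the
  dimension.\<close>

lemma sandwich_eigenvectors: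
  fixes C :: "'a \<Rightarrow>\<^sub>L 'a"
  assumes C: "C \<in> compact_sa" and l: "l \<noteq> 0" and s: "s = cdim (eigenspace C l)"
    and q: "\<And>i. i < s \<Longrightarrow> blinfun_apply C (q i) = l *\<^sub>R q i"
      "\<And>i j. i < s \<Longrightarrow> j < s \<Longrightarrow> cinner (q i) (q j) = (if i = j then 1 else 0)"
  shows "sandwich s q ` density_mats s = pure_hull (eigenspace C l)"
proof -
  interpret fam: orthonormal_family s q by unfold_locales (rule q(2))
  let ?S = "eigenspace C l" and ?Q = "q ` {..<s}"
  have sub: "complex_vector.subspace ?S" using C by (intro subspace_eigenspace) (simp add:
      compact_sa_iff)
  have QS: "?Q \<subseteq> ?S" using q(1) by (auto simp: eigenspace_def)
  obtain B where B: "finite B" "?S \<subseteq> cspan B" "card B = cdim ?S"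
    by (rule eigenspace_finite_dim[OF C l])
  have "?S \<subseteq> cspan ?Q"
  proof (rule ccontr)
    assume "\<not> ?S \<subseteq> cspan ?Q"
    then obtain w where w: "w \<in> ?S" "w \<notin> cspan ?Q" by blast
    have "complex_vector.independent (insert w ?Q)"
      using w(2) fam.independent_q by (rule complex_vector.independent_insertI)
    moreover have "insert w ?Q \<subseteq> cspan B" using w(1) QS B(2) by auto
    ultimately have "card (insert w ?Q) \<le> card B"
      using complex_vector.independent_span_bound[OF B(1)] by blast
    moreover have "w \<notin> ?Q" using w(2) complex_vector.span_superset[of ?Q] by blast
    ultimately show False using B(3) fam.card_q s by simp
  qed
  then have "fam.family_span = ?S"
    unfolding fam.family_span_def using complex_vector.span_minimal[OF QS sub] by blast
  then show ?thesis using fam.sandwich_density_eq_pure_hull by simp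
qed

text \<open>\<open>A y - A x\<close> is diagonal, so its trace against \<open>Y\<close> sees only
  the diagonal of \<open>Y\<close>; this is the inclusion from right to left. The other one rests on
  \<open>c0_dual\<close> and \<open>subgradient_is_diagonal\<close>.\<close>

lemma subdifferential_composition:
  fixes A0 :: "'a \<Rightarrow>\<^sub>L 'a" and A :: "c0 \<Rightarrow> 'a \<Rightarrow>\<^sub>L 'a"
  assumes A0: "A0 \<in> compact_sa" and A: "A = (\<lambda>y. A0 + diag_op e y)"
  shows "subdifferential (lambda_max \<circ> A) x = ell1_functional ` diag_seq e ` subdiff_lambda_max e
      (A x)"
proof -
  have A_compact: "A y \<in> compact_sa" for y
    unfolding A by (intro compact_sa_add A0 diag_op_compact)
  have A_diff: "A y - A x = diag_op e (y - x)" for y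
    by (simp add: A diag_op_diff)
  show ?thesis
  proof (intro equalityI subsetI)
    fix f assume f: "f \<in> subdifferential (lambda_max \<circ> A) x"
    obtain d where d: "summable (\<lambda>k. \<bar>d k\<bar>)" "f = ell1_functional d" by (rule c0_dual)
    have "lambda_max (A x) + (\<Sum>k. d k * c0_nth y k) \<le> lambda_max (A x + diag_op e y)" for y
    proof -
      have "A x + diag_op e y = A (x + y)" using A_diff[of "x + y"] by (simp add: algebra_simps)
      moreover have "lambda_max (A (x + y)) - lambda_max (A x) \<ge> blinfun_apply f (x + y - x)"
        using f unfolding subdifferential_def by (simp only: mem_Collect_eq comp_def)
      ultimately show ?thesis by (simp add: d(2) ell1_functional_apply[OF d(1)])
    qed
    then obtain U where "U \<in> subdiff_lambda_max e (A x)" "diag_seq e U = d"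
      using subgradient_is_diagonal[OF A_compact d(1)] by blast
    then show "f \<in> ell1_functional ` diag_seq e ` subdiff_lambda_max e (A x)" using d(2) by blast
  next
    fix f assume "f \<in> ell1_functional ` diag_seq e ` subdiff_lambda_max e (A x)"
    then obtain Y where Y: "Y \<in> subdiff_lambda_max e (A x)" and f: "f = ell1_functional (diag_seq
        e Y)" by auto
    note saY = positive_opD(1)[OF subdiff_positive[OF A_compact Y]]
    note summable = subdiff_diag(2)[OF A_compact Y]
    have "blinfun_apply f (y - x) \<le> lambda_max (A y) - lambda_max (A x)" for y
    proof -
      have "summable (\<lambda>k. norm (diag_seq e Y k * c0_nth (y - x) k))"
        by (rule summable_comparison_test'[OF summable_mult2[OF summable, of "norm (y - x)"], of 0])
          (auto simp: abs_mult intro!: mult_left_mono c0_nth_le_norm)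
      then have "(\<lambda>k. complex_of_real (diag_seq e Y k * c0_nth (y - x) k)) sums
          complex_of_real (blinfun_apply f (y - x))"
        unfolding sums_of_real_iff f ell1_functional_apply[OF summable] by (intro summable_sums)
            (rule summable_norm_cancel)
      then have "op_trace e (Y o\<^sub>L (A y - A x)) = complex_of_real (blinfun_apply f (y - x))"
        by (simp add: op_trace_def A_diff diag_op_e blinfun.scaleR_right cinner.scaleR_left
            self_adjoint_cinner_self[OF saY] diag_seq_def
            scaleR_conv_of_real sums_iff mult.commute)
      moreover have "Re (op_trace e (Y o\<^sub>L (A y - A x))) \<le> lambda_max (A y) - lambda_max (A x)"
        using Y A_compact unfolding subdiff_lambda_max_def by blast
      ultimately show ?thesis by simp
    qed
    then show "f \<in> subdifferential (lambda_max \<circ> A) x" by (simp add: subdifferential_def)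
  qed
qed

end

text \<open>The equalities of the subdifferentials with hull and moment are tied to a nonzero
  eigenvalue: at \<open>lambda_max (A x) = 0\<close> the operator \<open>0\<close> is a subgradient,
  whereas every member of \<open>moment e S\<close> has sum \<open>1\<close>.\<close>

theorem theorem5:
  fixes e :: "nat \<Rightarrow> 'a::chilbert_space"
    and A0 :: "'a \<Rightarrow>\<^sub>L 'a"
    and A :: "c0 \<Rightarrow> 'a \<Rightarrow>\<^sub>L 'a"
    and x :: c0
    and S :: "'a set"
    and s :: nat
  assumes "orthonormal_basis e"
    and "A0 \<in> compact_sa"
    and "A = (\<lambda>y. A0 + diag_op e y)"
    and "S = eigenspace (A x) (lambda_max (A x))"
    and "s = cdim S"
  shows "subdifferential (lambda_max \<circ> A) x =
           ell1_functional ` diag_seq e ` subdiff_lambda_max e (A x) \<and>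
         diag_seq e ` pure_hull S = moment e S \<and>
         (lambda_max (A x) \<noteq> 0 \<longrightarrow>
           subdifferential (lambda_max \<circ> A) x = ell1_functional ` diag_seq e ` pure_hull S \<and>
           diag_seq e ` pure_hull S = diag_seq e ` subdiff_lambda_max e (A x) \<and>
           diag_seq e ` subdiff_lambda_max e (A x) = moment e S \<and>
           (\<forall>q. (\<forall>i<s. blinfun_apply (A x) (q i) = lambda_max (A x) *\<^sub>R q i) \<and>
                (\<forall>i<s. \<forall>j<s. cinner (q i) (q j) = (if i = j then 1 else 0)) \<longrightarrow>
              subdifferential (lambda_max \<circ> A) x =
                ell1_functional ` diag_seq e ` sandwich s q ` density_mats s))"
proof -
  interpret onb e by unfold_locales (rule assms(1))
  let ?C = "A x" and ?P = "pure_hull S" and ?D = "subdiff_lambda_max e (A x)"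
  have C: "?C \<in> compact_sa"
    unfolding assms(3) by (intro compact_sa_add assms(2) diag_op_compact)
  have sub: "subdifferential (lambda_max \<circ> A) x = ell1_functional ` diag_seq e ` ?D"
    by (rule subdifferential_composition[OF assms(2,3)])
  have nonzero: "?D = ?P" if "lambda_max ?C \<noteq> 0"
    using subdiff_eq_pure_hull[OF C that] by (simp add: assms(4))
  have sandwich: "sandwich s q ` density_mats s = ?P"
    if "lambda_max ?C \<noteq> 0" "\<forall>i<s. blinfun_apply ?C (q i) = lambda_max ?C *\<^sub>R q i"
      "\<forall>i<s. \<forall>j<s. cinner (q i) (q j) = (if i = j then 1 else 0)" for q
    unfolding assms(4)
    by (rule sandwich_eigenvectors[OF C that(1)]) (use assms(4,5) that in auto)
  show ?thesis
    using sub nonzero sandwich diag_seq_pure_hull[of S] by simp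
qed

end
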